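(* Let $C=\langle t\rangle$ be an infinite cyclic group and let $G_{Kl}=\mathbb{Z}\rtimes C$ be the Klein bottle group, where $t$ acts on $\mathbb{Z}$ by multiplication by $-1$. Then there is an isomorphism $$EG_{Kl}=N_w\rtimes C .$$ In other words, $EG_{Kl}$ can be described as the set $(\Lambda^2\mathbb{Z}_2)\times\mathbb{Z}_2\times C$ with the multiplication given by $$(\alpha,a,t^i)(\beta,b,t^j)=\left(\alpha+\beta+\frac{(-1)^i}{2}\cdot a\wedge b,\ a+(-1)^ib,\ t^{i+j}\right).$$
   Context: $\mathbb{Z}_2$ denotes the 2-adic integers and $\Lambda^2\mathbb{Z}_2$ the exterior square of $\mathbb{Z}_2$ over $\mathbb{Z}$ (as an abelian group); it is a $\mathbb{Q}$-vector space, so multiplication by $\frac12$ makes sense. $N_w$ is the central extension of $\mathbb{Z}_2$ by $\Lambda^2\mathbb{Z}_2$ given by the 2-cocycle $w(a,b)=\frac12\,a\wedge b$: its underlying set is $(\Lambda^2\mathbb{Z}_2)\times\mathbb{Z}_2$ with product $(\alpha,a)(\beta,b)=(\alpha+\beta+\frac12\,a\wedge b,\ a+b)$. The generator $t$ of $C$ acts on $N_w$ by $(\alpha,a)\mapsto(\alpha,-a)$. Homology is with integral coefficients. An $H\mathbb{Z}$-map is a group homomorphism inducing an isomorphism on $H_1$ and an epimorphism on $H_2$. A group $\Gamma$ is $H\mathbb{Z}$-local if every $H\mathbb{Z}$-map $G\to H$ induces a bijection $\mathrm{Hom}(H,\Gamma)\to\mathrm{Hom}(G,\Gamma)$. The $H\mathbb{Z}$-localization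 $\eta:G\to EG$ of a group $G$ is the (unique up to isomorphism) $H\mathbb{Z}$-map with $EG$ an $H\mathbb{Z}$-local group; it exists for every $G$ (Bousfield). *)

theory Defs
  imports "HOL-Algebra.Algebra"
begin

section \<open>Integral group homology (inhomogeneous bar complex)\<close>

text \<open>The generator \<open>[g\<^sub>1|\<dots>|g\<^sub>n]\<close> of the bar complex is the list \<open>[g\<^sub>1, \<dots>, g\<^sub>n]\<close>.\<close>

definition bar_chains :: "nat \<Rightarrow> 'a monoid \<Rightarrow> ('a list \<Rightarrow>\<^sub>0 int) monoid" where
  "bar_chains n G = free_Abelian_group {xs. length xs = n \<and> set xs \<subseteq> carrier G}"

definition bar_face :: "'a monoid \<Rightarrow> nat \<Rightarrow> 'a list \<Rightarrow> 'a list" where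
  "bar_face G i xs =
     (if i = 0 then tl xs
      else if i = length xs then butlast xs
      else take (i - 1) xs @ [(xs ! (i - 1)) \<otimes>\<^bsub>G\<^esub> (xs ! i)] @ drop (i + 1) xs)"

text \<open>The case split makes the differential vanish in degree 0.\<close>

definition bar_boundary :: "'a monoid \<Rightarrow> ('a list \<Rightarrow>\<^sub>0 int) \<Rightarrow> ('a list \<Rightarrow>\<^sub>0 int)" where
  "bar_boundary G = frag_extend (\<lambda>xs.
     if xs = [] then 0
     else \<Sum>i\<le>length xs. frag_cmul ((-1) ^ i) (frag_of (bar_face G i xs)))"

definition bar_cycles :: "nat \<Rightarrow> 'a monoid \<Rightarrow> ('a list \<Rightarrow>\<^sub>0 int) set" where
  "bar_cycles n G = {c \<in> carrier (bar_chains n G). bar_boundary G c = 0}"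

definition bar_boundaries :: "nat \<Rightarrow> 'a monoid \<Rightarrow> ('a list \<Rightarrow>\<^sub>0 int) set" where
  "bar_boundaries n G = bar_boundary G ` carrier (bar_chains (Suc n) G)"

definition group_homology :: "nat \<Rightarrow> 'a monoid \<Rightarrow> ('a list \<Rightarrow>\<^sub>0 int) set monoid" where
  "group_homology n G = (bar_chains n G)\<lparr>carrier := bar_cycles n G\<rparr> Mod bar_boundaries n G"

definition bar_map :: "('a \<Rightarrow> 'b) \<Rightarrow> ('a list \<Rightarrow>\<^sub>0 int) \<Rightarrow> ('b list \<Rightarrow>\<^sub>0 int)" where
  "bar_map f = frag_extend (\<lambda>xs. frag_of (map f xs))"

text \<open>For a homology class \<open>z\<close>, i.e. a coset of the boundaries of \<open>G\<close>, the set below is the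
  coset of the boundaries of \<open>H\<close> that contains the image of \<open>z\<close>.\<close>

definition group_homology_map ::
  "nat \<Rightarrow> 'a monoid \<Rightarrow> 'b monoid \<Rightarrow> ('a \<Rightarrow> 'b) \<Rightarrow> ('a list \<Rightarrow>\<^sub>0 int) set \<Rightarrow> ('b list \<Rightarrow>\<^sub>0 int) set" where
  "group_homology_map n G H f =
     (\<lambda>z \<in> carrier (group_homology n G).
        bar_boundaries n H <#>\<^bsub>bar_chains n H\<^esub> (bar_map f ` z))"


section \<open>$H\mathbb{Z}$-localization\<close>

definition HZ_map :: "'a monoid \<Rightarrow> 'b monoid \<Rightarrow> ('a \<Rightarrow> 'b) \<Rightarrow> bool" where
  "HZ_map G H f \<longleftrightarrow>
     group G \<and> group H \<and> f \<in> hom G H \<and>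
     group_homology_map 1 G H f \<in> iso (group_homology 1 G) (group_homology 1 H) \<and>
     group_homology_map 2 G H f \<in> epi (group_homology 2 G) (group_homology 2 H)"

text \<open>The carrier types of the test groups are parameters, since HOL does not quantify over
  types inside a formula; a statement that leaves \<open>'g\<close> and \<open>'h\<close> free ranges over all groups.
  Homomorphisms are taken extensional so that a function on the carrier is counted once.\<close>

definition HZ_local :: "'g itself \<Rightarrow> 'h itself \<Rightarrow> 'c monoid \<Rightarrow> bool" where
  "HZ_local TG TH \<Gamma> \<longleftrightarrow>
     group \<Gamma> \<and>
     (\<forall>(G :: 'g monoid) (H :: 'h monoid) f. HZ_map G H f \<longrightarrow>
        bij_betw (\<lambda>\<phi>. compose (carrier G) \<phi> f)
          (hom H \<Gamma> \<inter> extensional (carrier H)) (hom G \<Gamma> \<inter> extensional (carrier G)))"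

definition HZ_localization ::
  "'g itself \<Rightarrow> 'h itself \<Rightarrow> 'a monoid \<Rightarrow> ('a \<Rightarrow> 'b) \<Rightarrow> 'b monoid \<Rightarrow> bool" where
  "HZ_localization TG TH G \<eta> E \<longleftrightarrow> HZ_map G E \<eta> \<and> HZ_local TG TH E"


section \<open>Semidirect products with a cyclic group\<close>

definition semidirect_product ::
  "'n monoid \<Rightarrow> 'q monoid \<Rightarrow> ('q \<Rightarrow> 'n \<Rightarrow> 'n) \<Rightarrow> ('n \<times> 'q) monoid" where
  "semidirect_product N Q \<phi> =
     \<lparr>carrier = carrier N \<times> carrier Q,
      monoid.mult = (\<lambda>(m, p) (n, q). (m \<otimes>\<^bsub>N\<^esub> \<phi> p n, p \<otimes>\<^bsub>Q\<^esub> q)),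
      one = (\<one>\<^bsub>N\<^esub>, \<one>\<^bsub>Q\<^esub>)\<rparr>"

text \<open>The action of an infinite cyclic group \<open>C = \<langle>t\<rangle>\<close> on \<open>N\<close> in which \<open>t\<close> acts by the
  automorphism \<open>\<theta>\<close>, so that \<open>t\<^sup>i\<close> acts by \<open>\<theta>\<^sup>i\<close>.\<close>

definition cyclic_action :: "'c monoid \<Rightarrow> 'c \<Rightarrow> 'n monoid \<Rightarrow> ('n \<Rightarrow> 'n) \<Rightarrow> 'c \<Rightarrow> 'n \<Rightarrow> 'n" where
  "cyclic_action C t N \<theta> c =
     restrict \<theta> (carrier N) [^]\<^bsub>AutoGroup N\<^esub> (THE i :: int. t [^]\<^bsub>C\<^esub> i = c)"

definition Klein_bottle_group :: "'c monoid \<Rightarrow> 'c \<Rightarrow> (int \<times> 'c) monoid" where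
  "Klein_bottle_group C t =
     semidirect_product integer_group C (cyclic_action C t integer_group (\<lambda>n. - n))"


section \<open>2-adic integers and exterior squares\<close>

text \<open>The additive group of the \<open>p\<close>-adic integers, as the inverse limit of the groups
  \<open>\<int>/p\<^sup>n\<close>.\<close>

definition padic_int_group :: "nat \<Rightarrow> (nat \<Rightarrow> int) monoid" where
  "padic_int_group p =
     \<lparr>carrier = {x. \<forall>n. x n \<in> carrier (integer_mod_group (p ^ n)) \<and> x (Suc n) mod int (p ^ n) = x n},
      monoid.mult = (\<lambda>x y n. x n \<otimes>\<^bsub>integer_mod_group (p ^ n)\<^esub> y n),
      one = (\<lambda>n. \<one>\<^bsub>integer_mod_group (p ^ n)\<^esub>)\<rparr>"

abbreviation Z2 :: "(nat \<Rightarrow> int) monoid" where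
  "Z2 \<equiv> padic_int_group 2"

definition exterior_relations :: "'a monoid \<Rightarrow> ('a \<times> 'a \<Rightarrow>\<^sub>0 int) set" where
  "exterior_relations A =
     {frag_of (a \<otimes>\<^bsub>A\<^esub> b, c) - frag_of (a, c) - frag_of (b, c) |a b c.
        a \<in> carrier A \<and> b \<in> carrier A \<and> c \<in> carrier A} \<union>
     {frag_of (a, b \<otimes>\<^bsub>A\<^esub> c) - frag_of (a, b) - frag_of (a, c) |a b c.
        a \<in> carrier A \<and> b \<in> carrier A \<and> c \<in> carrier A} \<union>
     {frag_of (a, a) |a. a \<in> carrier A}"

definition exterior_kernel :: "'a monoid \<Rightarrow> ('a \<times> 'a \<Rightarrow>\<^sub>0 int) set" where
  "exterior_kernel A =
     generate (free_Abelian_group (carrier A \<times> carrier A)) (exterior_relations A)"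

definition exterior_square :: "'a monoid \<Rightarrow> ('a \<times> 'a \<Rightarrow>\<^sub>0 int) set monoid" where
  "exterior_square A = free_Abelian_group (carrier A \<times> carrier A) Mod exterior_kernel A"

definition wedge :: "'a monoid \<Rightarrow> 'a \<Rightarrow> 'a \<Rightarrow> ('a \<times> 'a \<Rightarrow>\<^sub>0 int) set" where
  "wedge A a b = exterior_kernel A #>\<^bsub>free_Abelian_group (carrier A \<times> carrier A)\<^esub> frag_of (a, b)"

text \<open>Multiplication by \<open>1/2\<close> in a uniquely 2-divisible abelian group.\<close>

definition half :: "'a monoid \<Rightarrow> 'a \<Rightarrow> 'a" where
  "half A x = (THE y. y \<in> carrier A \<and> y \<otimes>\<^bsub>A\<^esub> y = x)"


section \<open>The group $N_w$\<close>

text \<open>The extension given by a 2-cocycle \<open>w\<close> with \<open>w(1,1) = 1\<close>.\<close>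

definition cocycle_extension ::
  "'a monoid \<Rightarrow> 'q monoid \<Rightarrow> ('q \<Rightarrow> 'q \<Rightarrow> 'a) \<Rightarrow> ('a \<times> 'q) monoid" where
  "cocycle_extension A Q w =
     \<lparr>carrier = carrier A \<times> carrier Q,
      monoid.mult = (\<lambda>(\<alpha>, a) (\<beta>, b). (\<alpha> \<otimes>\<^bsub>A\<^esub> \<beta> \<otimes>\<^bsub>A\<^esub> w a b, a \<otimes>\<^bsub>Q\<^esub> b)),
      one = (\<one>\<^bsub>A\<^esub>, \<one>\<^bsub>Q\<^esub>)\<rparr>"

abbreviation Lambda2_Z2 :: "((nat \<Rightarrow> int) \<times> (nat \<Rightarrow> int) \<Rightarrow>\<^sub>0 int) set monoid" where
  "Lambda2_Z2 \<equiv> exterior_square Z2"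

definition N_w :: "(((nat \<Rightarrow> int) \<times> (nat \<Rightarrow> int) \<Rightarrow>\<^sub>0 int) set \<times> (nat \<Rightarrow> int)) monoid" where
  "N_w = cocycle_extension Lambda2_Z2 Z2 (\<lambda>a b. half Lambda2_Z2 (wedge Z2 a b))"

definition N_w_semidirect ::
  "'c monoid \<Rightarrow> 'c \<Rightarrow>
     ((((nat \<Rightarrow> int) \<times> (nat \<Rightarrow> int) \<Rightarrow>\<^sub>0 int) set \<times> (nat \<Rightarrow> int)) \<times> 'c) monoid" where
  "N_w_semidirect C t =
     semidirect_product N_w C (cyclic_action C t N_w (\<lambda>(\<alpha>, a). (\<alpha>, inv\<^bsub>Z2\<^esub> a)))"

end

theory Submission
  imports Defs
begin

text \<open>Write \<open>\<Lambda>\<close> for the exterior square of the 2-adic integers and \<open>E\<close> for \<open>N\<^sub>w \<rtimes> C\<close>. The localization map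
  is \<open>\<eta> (n, c) = ((0, n), c)\<close>; it has to be shown that \<open>E\<close> is local and that \<open>\<eta>\<close> is an \<open>H\<int>\<close>-map.

  Local groups are closed under central extensions (\<open>HZ_local_central_extension\<close>) and under inverse
  limits of towers (\<open>HZ_local_inverse_limit\<close>). The group \<open>\<int>/2\<^sup>n\<^sup>+\<^sup>1 \<rtimes> C\<close> is a central extension of
  \<open>\<int>/2\<^sup>n \<rtimes> C\<close>, because \<open>t\<close> acts by inversion and the kernel has exponent 2. Starting from the abelian
  group \<open>C\<close>, this tower shows that its limit \<open>\<int>\<^sub>2 \<rtimes> C\<close> is local. Finally \<open>t\<close> fixes \<open>\<Lambda>\<close>, so \<open>E\<close> is a central
  extension of \<open>\<int>\<^sub>2 \<rtimes> C\<close> by \<open>\<Lambda>\<close>.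

  On first homology, the commutators \<open>[(0, a), (0, b)] = a \<and> b\<close> kill \<open>\<Lambda>\<close> and the commutators of
  \<open>(0, b)\<close> with \<open>t\<close> kill \<open>2\<int>\<^sub>2\<close>. What is left is \<open>\<int>/2 \<times> C\<close>, which is also the first homology of the Klein
  bottle group. On second homology, \<open>\<eta>\<close> is onto because \<open>H\<^sub>2(E) = 0\<close> (\<open>second_homology_E\<close>).

  By \<open>second_homology_vanishes\<close>, the latter follows if in every central extension \<open>Y\<close> of \<open>E\<close> the kernel
  meets the commutator subgroup trivially. Let \<open>L\<close> be the preimage of \<open>\<Lambda>\<close> in \<open>Y\<close>. Commutators give a pairing
  of \<open>\<Lambda>\<close> and \<open>\<int>\<^sub>2\<close> with values in the kernel. A lift \<open>\<tau>\<close> of \<open>t\<close> fixes these values, but it inverts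
  the elements of \<open>\<int>\<^sub>2\<close>; so the pairing is killed by 2, and it vanishes since \<open>\<Lambda>\<close> is 2-divisible. Hence
  \<open>L\<close> commutes with the preimage of \<open>N\<^sub>w\<close>, and the commutators of lifts of \<open>a\<close> and \<open>b\<close> are bilinear and
  alternating in \<open>a\<close> and \<open>b\<close>: they define a homomorphism \<open>\<sigma>\<close> that splits \<open>L\<close> over \<open>\<Lambda>\<close>. Together with the commutators
  \<open>\<delta> b\<close> of lifts of \<open>b\<close> with \<open>\<tau>\<close>, it describes the commutator subgroup as the set of all
  \<open>\<sigma> \<alpha> \<otimes> \<delta> b\<close>. Such an element lies over \<open>(\<alpha>, 2b)\<close>, so it is trivial if it lies in the kernel.

  That \<open>\<Lambda>\<close> is uniquely 2-divisible, although the 2-adic integers are not, comes from \<open>a = \<epsilon> + 2a'\<close> with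
  \<open>\<epsilon> \<in> {0, 1}\<close>: from \<open>a \<and> b = \<epsilon> (1 \<and> b) + 2 (a' \<and> b)\<close> and \<open>1 \<and> b = 2 (1 \<and> b')\<close> one reads off a half of
  \<open>a \<and> b\<close> that is bilinear and alternating (\<open>half_wedge\<close>), hence a homomorphism inverse to doubling.\<close>

(* Degrees are written as numerals; the simplifier would turn degree 1 into a successor. *)
declare One_nat_def [simp del]

section \<open>The bar complex in low degrees\<close>

abbreviation chains :: "nat \<Rightarrow> 'a monoid \<Rightarrow> ('a list \<Rightarrow>\<^sub>0 int) set" where
  "chains n G \<equiv> carrier (bar_chains n G)"

lemma bar_chains_iff:
  "c \<in> chains n G \<longleftrightarrow> Poly_Mapping.keys c \<subseteq> {xs. length xs = n \<and> set xs \<subseteq> carrier G}"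
  by (simp add: bar_chains_def)

lemma mult_bar_chains [simp]: "x \<otimes>\<^bsub>bar_chains n G\<^esub> y = x + y"
  by (simp add: bar_chains_def)

lemma one_bar_chains [simp]: "\<one>\<^bsub>bar_chains n G\<^esub> = 0"
  by (simp add: bar_chains_def)

lemma comm_group_bar_chains: "comm_group (bar_chains n G)"
  by (simp add: bar_chains_def abelian_free_Abelian_group)

lemma group_bar_chains: "group (bar_chains n G)"
  by (simp add: bar_chains_def)

lemma bar_chains_zero [simp]: "0 \<in> chains n G"
  by (simp add: bar_chains_iff)

lemma bar_chains_add:
  "x \<in> chains n G \<Longrightarrow> y \<in> chains n G \<Longrightarrow> x + y \<in> chains n G"
  using keys_add[of x y] unfolding bar_chains_iff by blast

lemma bar_chains_diff:
  "x \<in> chains n G \<Longrightarrow> y \<in> chains n G \<Longrightarrow> x - y \<in> chains n G"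
  using keys_diff[of x y] unfolding bar_chains_iff by blast

lemma bar_chains_minus: "x \<in> chains n G \<Longrightarrow> - x \<in> chains n G"
  by (simp add: bar_chains_iff)

lemma bar_chains_of [simp]:
  "frag_of xs \<in> chains n G \<longleftrightarrow> length xs = n \<and> set xs \<subseteq> carrier G"
  by (simp add: bar_chains_iff)

lemma inv_bar_chains: "x \<in> chains n G \<Longrightarrow> inv\<^bsub>bar_chains n G\<^esub> x = - x"
  by (rule group.inv_equality[OF group_bar_chains]) (auto simp: bar_chains_minus)

lemma bar_chains_induct [consumes 1, case_names zero of diff]:
  assumes "c \<in> chains n G"
    and "P 0"
    and "\<And>xs. length xs = n \<Longrightarrow> set xs \<subseteq> carrier G \<Longrightarrow> P (frag_of xs)"
    and "\<And>x y. x \<in> chains n G \<Longrightarrow> y \<in> chains n G \<Longrightarrow> P x \<Longrightarrow> P y \<Longrightarrow> P (x - y)"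
  shows "P c"
  using assms(1) unfolding bar_chains_iff
  by (rule free_Abelian_group_induct) (use assms(2-) in \<open>auto simp: bar_chains_iff\<close>)

lemma bar_boundary_zero [simp]: "bar_boundary G 0 = 0"
  by (simp add: bar_boundary_def)

lemma bar_boundary_add: "bar_boundary G (x + y) = bar_boundary G x + bar_boundary G y"
  by (simp add: bar_boundary_def frag_extend_add)

lemma bar_boundary_diff: "bar_boundary G (x - y) = bar_boundary G x - bar_boundary G y"
  by (simp add: bar_boundary_def frag_extend_diff)

lemma bar_boundary_minus: "bar_boundary G (- x) = - bar_boundary G x"
  by (simp add: bar_boundary_def frag_extend_minus)

lemma bar_map_zero [simp]: "bar_map f 0 = 0"
  by (simp add: bar_map_def)

lemma bar_map_add: "bar_map f (x + y) = bar_map f x + bar_map f y"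
  by (simp add: bar_map_def frag_extend_add)

lemma bar_map_diff: "bar_map f (x - y) = bar_map f x - bar_map f y"
  by (simp add: bar_map_def frag_extend_diff)

lemma bar_map_of [simp]: "bar_map f (frag_of xs) = frag_of (map f xs)"
  by (simp add: bar_map_def)

lemma bar_boundary_of1: "bar_boundary G (frag_of [g]) = 0"
  by (simp add: bar_boundary_def bar_face_def)

lemma bar_boundary_of2:
  "bar_boundary G (frag_of [g, h]) = frag_of [h] - frag_of [g \<otimes>\<^bsub>G\<^esub> h] + frag_of [g]"
  by (simp add: bar_boundary_def bar_face_def numeral_2_eq_2)

lemma bar_boundary_of3:
  "bar_boundary G (frag_of [g, h, k]) =
     frag_of [h, k] - frag_of [g \<otimes>\<^bsub>G\<^esub> h, k] + frag_of [g, h \<otimes>\<^bsub>G\<^esub> k] - frag_of [g, h]"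
  by (simp add: bar_boundary_def bar_face_def numeral_3_eq_3 numeral_2_eq_2)

lemma length_1_iff: "length xs = 1 \<longleftrightarrow> (\<exists>a. xs = [a])"
  by (cases xs) (auto simp: One_nat_def)

lemma length_2_iff: "length xs = 2 \<longleftrightarrow> (\<exists>a b. xs = [a, b])"
  by (auto simp: numeral_2_eq_2 length_Suc_conv)

lemma length_3_iff: "length xs = 3 \<longleftrightarrow> (\<exists>a b c. xs = [a, b, c])"
  by (auto simp: numeral_3_eq_3 length_Suc_conv)

lemma bar_boundary_chains1:
  "c \<in> chains 1 G \<Longrightarrow> bar_boundary G c = 0"
  by (induction rule: bar_chains_induct)
    (auto simp: length_1_iff bar_boundary_of1 bar_boundary_diff)

lemma bar_boundary_chains2:
  assumes "group G" "c \<in> chains 2 G"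
  shows "bar_boundary G c \<in> chains 1 G"
proof -
  interpret group G by fact
  show ?thesis
    using assms(2) by (induction rule: bar_chains_induct)
      (auto simp: length_2_iff bar_boundary_of2 bar_boundary_diff intro!: bar_chains_diff bar_chains_add)
qed

lemma bar_boundary_chains3:
  assumes "group G" "c \<in> chains 3 G"
  shows "bar_boundary G c \<in> chains 2 G"
proof -
  interpret group G by fact
  show ?thesis
    using assms(2) by (induction rule: bar_chains_induct)
      (auto simp: length_3_iff bar_boundary_of3 bar_boundary_diff intro!: bar_chains_diff bar_chains_add)
qed

lemma bar_boundary_boundary3:
  assumes "group G" "c \<in> chains 3 G"
  shows "bar_boundary G (bar_boundary G c) = 0"
proof -
  interpret group G by fact
  show ?thesis
    using assms(2) by (induction rule: bar_chains_induct)
      (auto simp: length_3_iff bar_boundary_of3 bar_boundary_of2 bar_boundary_diff bar_boundary_add m_assoc)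
qed

lemma bar_map_chains:
  "f \<in> hom G H \<Longrightarrow> c \<in> chains n G \<Longrightarrow> bar_map f c \<in> chains n H"
  by (erule bar_chains_induct) (auto simp: bar_map_diff hom_def intro!: bar_chains_diff)

lemma bar_map_boundary2:
  assumes "f \<in> hom G H" "c \<in> chains 2 G"
  shows "bar_map f (bar_boundary G c) = bar_boundary H (bar_map f c)"
  using assms(2) by (induction rule: bar_chains_induct)
    (use assms(1) in \<open>auto simp: length_2_iff bar_boundary_of2 bar_boundary_diff bar_map_diff bar_map_add hom_mult\<close>)

lemma bar_map_boundary3:
  assumes "f \<in> hom G H" "c \<in> chains 3 G"
  shows "bar_map f (bar_boundary G c) = bar_boundary H (bar_map f c)"
  using assms(2) by (induction rule: bar_chains_induct)
    (use assms(1) in \<open>auto simp: length_3_iff bar_boundary_of3 bar_boundary_diff bar_map_diff bar_map_add hom_mult\<close>)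

lemma bar_cycles_1: "bar_cycles 1 G = chains 1 G"
  by (auto simp: bar_cycles_def bar_boundary_chains1)

lemma bar_boundaries_1: "bar_boundaries 1 G = bar_boundary G ` chains 2 G"
  by (simp add: bar_boundaries_def numeral_2_eq_2)

lemma bar_boundaries_2: "bar_boundaries 2 G = bar_boundary G ` chains 3 G"
  by (simp add: bar_boundaries_def numeral_2_eq_2 numeral_3_eq_3)

lemma bar_boundaries_1_chains: "group G \<Longrightarrow> bar_boundaries 1 G \<subseteq> chains 1 G"
  using bar_boundary_chains2 unfolding bar_boundaries_1 by blast

lemma bar_boundaries_2_cycles: "group G \<Longrightarrow> bar_boundaries 2 G \<subseteq> bar_cycles 2 G"
  using bar_boundary_chains3 bar_boundary_boundary3 by (auto simp: bar_boundaries_2 bar_cycles_def)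

section \<open>Homology isomorphisms and epimorphisms in terms of chains\<close>

definition additive_subgroup :: "('a \<Rightarrow>\<^sub>0 int) set \<Rightarrow> bool" where
  "additive_subgroup Z \<longleftrightarrow> 0 \<in> Z \<and> (\<forall>x\<in>Z. \<forall>y\<in>Z. x - y \<in> Z)"

lemma additive_subgroup_minus: "additive_subgroup Z \<Longrightarrow> x \<in> Z \<Longrightarrow> - x \<in> Z"
  unfolding additive_subgroup_def by (metis diff_0)

lemma additive_subgroup_add: "additive_subgroup Z \<Longrightarrow> x \<in> Z \<Longrightarrow> y \<in> Z \<Longrightarrow> x + y \<in> Z"
  using additive_subgroup_minus[of Z y] unfolding additive_subgroup_def
  by (metis diff_minus_eq_add)

lemma additive_subgroup_cycles: "additive_subgroup (bar_cycles n G)"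
  by (auto simp: additive_subgroup_def bar_cycles_def bar_boundary_diff bar_chains_diff)

lemma additive_subgroup_boundaries: "additive_subgroup (bar_boundaries n G)"
  unfolding additive_subgroup_def bar_boundaries_def
  by (auto simp: bar_boundary_diff[symmetric] bar_chains_diff intro!: imageI image_eqI[where x = 0])

lemma translate_eq_iff:
  assumes "additive_subgroup (B :: ('a \<Rightarrow>\<^sub>0 int) set)"
  shows "(\<lambda>b. b + x) ` B = (\<lambda>b. b + y) ` B \<longleftrightarrow> x - y \<in> B"
proof
  assume eq: "(\<lambda>b. b + x) ` B = (\<lambda>b. b + y) ` B"
  have "0 + x \<in> (\<lambda>b. b + x) ` B"
    using assms unfolding additive_subgroup_def by blast
  then obtain b where "b \<in> B" "x = b + y"
    unfolding eq by auto
  then show "x - y \<in> B" by simp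
next
  assume xy: "x - y \<in> B"
  show "(\<lambda>b. b + x) ` B = (\<lambda>b. b + y) ` B"
  proof (intro equalityI image_subsetI)
    fix b assume "b \<in> B"
    have "b + x = (b + (x - y)) + y" by simp
    then show "b + x \<in> (\<lambda>b. b + y) ` B"
      using additive_subgroup_add[OF assms \<open>b \<in> B\<close> xy] by blast
    have "b + y = (b - (x - y)) + x" by simp
    moreover have "b - (x - y) \<in> B"
      using assms \<open>b \<in> B\<close> xy by (simp add: additive_subgroup_def)
    ultimately show "b + y \<in> (\<lambda>b. b + x) ` B" by blast
  qed
qed

lemma carrier_group_homology:
  "carrier (group_homology n G) = (\<lambda>z. (\<lambda>b. b + z) ` bar_boundaries n G) ` bar_cycles n G"
  by (auto simp: group_homology_def FactGroup_def RCOSETS_def r_coset_def image_def)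

lemma mult_group_homology:
  assumes "x \<in> bar_cycles n G" "y \<in> bar_cycles n G"
  shows "(\<lambda>b. b + x) ` bar_boundaries n G \<otimes>\<^bsub>group_homology n G\<^esub> (\<lambda>b. b + y) ` bar_boundaries n G
         = (\<lambda>b. b + (x + y)) ` bar_boundaries n G" (is "?l = ?r")
proof -
  let ?B = "bar_boundaries n G"
  have l: "?l = (\<Union>b\<in>?B. \<Union>b'\<in>?B. {b + x + (b' + y)})"
    by (auto simp: group_homology_def FactGroup_def set_mult_def)
  show ?thesis
  proof (intro equalityI subsetI)
    fix u assume "u \<in> ?l"
    then obtain b b' where "b \<in> ?B" "b' \<in> ?B" "u = (b + b') + (x + y)"
      unfolding l by (auto simp: algebra_simps)
    then show "u \<in> ?r"
      using additive_subgroup_add[OF additive_subgroup_boundaries] by blast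
  next
    fix u assume "u \<in> ?r"
    then obtain b where "b \<in> ?B" "u = b + x + (0 + y)" by (auto simp: algebra_simps)
    moreover have "0 \<in> ?B"
      using additive_subgroup_boundaries unfolding additive_subgroup_def by blast
    ultimately show "u \<in> ?l" unfolding l by blast
  qed
qed

lemma group_homology_map_coset:
  assumes z: "z \<in> bar_cycles n G"
    and F: "\<And>b. b \<in> bar_boundaries n G \<Longrightarrow> bar_map f b \<in> bar_boundaries n H"
  shows "group_homology_map n G H f ((\<lambda>b. b + z) ` bar_boundaries n G) =
         (\<lambda>b. b + bar_map f z) ` bar_boundaries n H" (is "?l = ?r")
proof -
  let ?B = "bar_boundaries n G" and ?D = "bar_boundaries n H"
  have l: "?l = (\<Union>d\<in>?D. \<Union>b\<in>?B. {d + (bar_map f b + bar_map f z)})"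
    using z by (auto simp: group_homology_map_def carrier_group_homology set_mult_def bar_map_add)
  show ?thesis
  proof (intro equalityI subsetI)
    fix u assume "u \<in> ?l"
    then obtain d b where "d \<in> ?D" "b \<in> ?B" "u = (d + bar_map f b) + bar_map f z"
      unfolding l by (auto simp: algebra_simps)
    then show "u \<in> ?r"
      using additive_subgroup_add[OF additive_subgroup_boundaries] F by blast
  next
    fix u assume "u \<in> ?r"
    then obtain d where "d \<in> ?D" "u = d + (bar_map f 0 + bar_map f z)" by auto
    moreover have "0 \<in> ?B"
      using additive_subgroup_boundaries unfolding additive_subgroup_def by blast
    ultimately show "u \<in> ?l" unfolding l by blast
  qed
qed

context
  fixes n :: nat and G :: "'a monoid" and H :: "'b monoid" and f :: "'a \<Rightarrow> 'b"
  assumes cyc: "\<And>z. z \<in> bar_cycles n G \<Longrightarrow> bar_map f z \<in> bar_cycles n H"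
    and bdy: "\<And>b. b \<in> bar_boundaries n G \<Longrightarrow> bar_map f b \<in> bar_boundaries n H"
begin

lemma group_homology_map_hom: "group_homology_map n G H f \<in> hom (group_homology n G) (group_homology n H)"
proof (rule homI)
  fix U
  assume "U \<in> carrier (group_homology n G)"
  then show "group_homology_map n G H f U \<in> carrier (group_homology n H)"
    using cyc by (auto simp: carrier_group_homology group_homology_map_coset bdy)
next
  fix U V
  assume "U \<in> carrier (group_homology n G)" "V \<in> carrier (group_homology n G)"
  then obtain x y where "x \<in> bar_cycles n G" "y \<in> bar_cycles n G"
    "U = (\<lambda>b. b + x) ` bar_boundaries n G" "V = (\<lambda>b. b + y) ` bar_boundaries n G"
    by (auto simp: carrier_group_homology)
  then show "group_homology_map n G H f (U \<otimes>\<^bsub>group_homology n G\<^esub> V) =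
      group_homology_map n G H f U \<otimes>\<^bsub>group_homology n H\<^esub> group_homology_map n G H f V"
    by (simp add: mult_group_homology group_homology_map_coset bdy cyc bar_map_add
        additive_subgroup_add[OF additive_subgroup_cycles])
qed

lemma group_homology_map_surj_iff:
  "group_homology_map n G H f ` carrier (group_homology n G) = carrier (group_homology n H) \<longleftrightarrow>
   (\<forall>z \<in> bar_cycles n H. \<exists>x \<in> bar_cycles n G. z - bar_map f x \<in> bar_boundaries n H)"
proof -
  have "group_homology_map n G H f ` carrier (group_homology n G) =
      (\<lambda>x. (\<lambda>b. b + bar_map f x) ` bar_boundaries n H) ` bar_cycles n G"
    by (simp add: carrier_group_homology image_image group_homology_map_coset bdy cong: image_cong)
  moreover have "\<dots> \<subseteq> carrier (group_homology n H)"
    using cyc by (auto simp: carrier_group_homology)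
  ultimately have "group_homology_map n G H f ` carrier (group_homology n G) = carrier (group_homology n H)
    \<longleftrightarrow> carrier (group_homology n H) \<subseteq> (\<lambda>x. (\<lambda>b. b + bar_map f x) ` bar_boundaries n H) ` bar_cycles n G"
    by auto
  also have "\<dots> \<longleftrightarrow> (\<forall>z \<in> bar_cycles n H. \<exists>x \<in> bar_cycles n G.
      (\<lambda>b. b + z) ` bar_boundaries n H = (\<lambda>b. b + bar_map f x) ` bar_boundaries n H)"
    unfolding carrier_group_homology image_subset_iff by (simp add: image_iff)
  finally show ?thesis
    by (simp add: translate_eq_iff additive_subgroup_boundaries)
qed

lemma group_homology_map_inj_iff:
  "inj_on (group_homology_map n G H f) (carrier (group_homology n G)) \<longleftrightarrow>
   (\<forall>x \<in> bar_cycles n G. bar_map f x \<in> bar_boundaries n H \<longrightarrow> x \<in> bar_boundaries n G)"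
proof -
  have "inj_on (group_homology_map n G H f) (carrier (group_homology n G)) \<longleftrightarrow>
    (\<forall>x \<in> bar_cycles n G. \<forall>y \<in> bar_cycles n G.
       bar_map f x - bar_map f y \<in> bar_boundaries n H \<longrightarrow> x - y \<in> bar_boundaries n G)"
    by (simp add: inj_on_def carrier_group_homology group_homology_map_coset bdy
        translate_eq_iff additive_subgroup_boundaries)
  also have "\<dots> \<longleftrightarrow> (\<forall>x \<in> bar_cycles n G. bar_map f x \<in> bar_boundaries n H \<longrightarrow> x \<in> bar_boundaries n G)"
  proof (intro iffI ballI impI)
    fix x assume *: "\<forall>x \<in> bar_cycles n G. \<forall>y \<in> bar_cycles n G.
       bar_map f x - bar_map f y \<in> bar_boundaries n H \<longrightarrow> x - y \<in> bar_boundaries n G"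
      and "x \<in> bar_cycles n G" "bar_map f x \<in> bar_boundaries n H"
    moreover have "0 \<in> bar_cycles n G"
      using additive_subgroup_cycles unfolding additive_subgroup_def by blast
    ultimately show "x \<in> bar_boundaries n G"
      by (metis bar_map_zero diff_zero)
  next
    fix x y
    assume "\<forall>x \<in> bar_cycles n G. bar_map f x \<in> bar_boundaries n H \<longrightarrow> x \<in> bar_boundaries n G"
      "x \<in> bar_cycles n G" "y \<in> bar_cycles n G" "bar_map f x - bar_map f y \<in> bar_boundaries n H"
    then show "x - y \<in> bar_boundaries n G"
      using additive_subgroup_cycles[of n G] by (simp add: additive_subgroup_def bar_map_diff[symmetric])
  qed
  finally show ?thesis .
qed

end

text \<open>This removes the quotients: homology classes are handled as chains modulo boundaries.\<close>

lemma HZ_map_iff: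
  assumes G: "group G" and H: "group H" and f: "f \<in> hom G H"
  shows "HZ_map G H f \<longleftrightarrow>
    (\<forall>z \<in> chains 1 H. \<exists>x \<in> chains 1 G. z - bar_map f x \<in> bar_boundaries 1 H) \<and>
    (\<forall>x \<in> chains 1 G. bar_map f x \<in> bar_boundaries 1 H \<longrightarrow> x \<in> bar_boundaries 1 G) \<and>
    (\<forall>z \<in> bar_cycles 2 H. \<exists>x \<in> bar_cycles 2 G. z - bar_map f x \<in> bar_boundaries 2 H)"
proof -
  have c1: "bar_map f z \<in> bar_cycles 1 H" if "z \<in> bar_cycles 1 G" for z
    using that bar_map_chains[OF f] unfolding bar_cycles_1 by blast
  have b1: "bar_map f b \<in> bar_boundaries 1 H" if "b \<in> bar_boundaries 1 G" for b
    using that bar_map_chains[OF f] bar_map_boundary2[OF f] unfolding bar_boundaries_1 by auto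
  have c2: "bar_map f z \<in> bar_cycles 2 H" if "z \<in> bar_cycles 2 G" for z
    using that bar_map_chains[OF f] bar_map_boundary2[OF f, of z, symmetric] by (simp add: bar_cycles_def)
  have b2: "bar_map f b \<in> bar_boundaries 2 H" if "b \<in> bar_boundaries 2 G" for b
    using that bar_map_chains[OF f] bar_map_boundary3[OF f] by (auto simp: bar_boundaries_2)
  show ?thesis
    unfolding HZ_map_def iso_def epi_def bij_betw_def
    using G H f group_homology_map_hom[of 1 G f H, OF c1 b1] group_homology_map_hom[of 2 G f H, OF c2 b2]
      group_homology_map_surj_iff[of 1 G f H, OF c1 b1] group_homology_map_surj_iff[of 2 G f H, OF c2 b2]
      group_homology_map_inj_iff[of 1 G f H, OF c1 b1]
    unfolding bar_cycles_1 by auto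
qed

section \<open>Locality of central extensions and inverse limits\<close>

lemma (in group) mult_inv_eq_one_iff:
  assumes "x \<in> carrier G" "y \<in> carrier G"
  shows "x \<otimes> inv y = \<one> \<longleftrightarrow> x = y"
  using assms right_cancel[of "inv y" x y] by auto

lemma hom_bar_chains_add:
  "h \<in> hom (bar_chains n G) A \<Longrightarrow> x \<in> chains n G \<Longrightarrow> y \<in> chains n G \<Longrightarrow>
   h (x + y) = h x \<otimes>\<^bsub>A\<^esub> h y"
  using hom_mult[of h "bar_chains n G" A x y] by simp

lemma hom_bar_chains_zero: "h \<in> hom (bar_chains n G) A \<Longrightarrow> group A \<Longrightarrow> h 0 = \<one>\<^bsub>A\<^esub>"
  using hom_one[OF _ group_bar_chains] by (metis one_bar_chains)

lemma hom_bar_chains_minus: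
  assumes "h \<in> hom (bar_chains n G) A" "group A" "x \<in> chains n G"
  shows "h (- x) = inv\<^bsub>A\<^esub> h x"
proof -
  interpret group_hom "bar_chains n G" A h
    using assms by (simp add: group_hom_def group_hom_axioms_def group_bar_chains)
  show ?thesis
    using hom_inv[OF assms(3)] inv_bar_chains[OF assms(3)] by simp
qed

lemma hom_bar_chains_diff:
  assumes "h \<in> hom (bar_chains n G) A" "group A" "x \<in> chains n G" "y \<in> chains n G"
  shows "h (x - y) = h x \<otimes>\<^bsub>A\<^esub> inv\<^bsub>A\<^esub> h y"
  using hom_bar_chains_add[OF assms(1,3) bar_chains_minus[OF assms(4)]] hom_bar_chains_minus[OF assms(1,2,4)]
  by simp

lemma hom_bar_chains_of:
  assumes "comm_group A"
    and "\<And>xs. length xs = n \<Longrightarrow> set xs \<subseteq> carrier G \<Longrightarrow> F xs \<in> carrier A"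
  obtains h where "h \<in> hom (bar_chains n G) A"
    "\<And>xs. length xs = n \<Longrightarrow> set xs \<subseteq> carrier G \<Longrightarrow> h (frag_of xs) = F xs"
proof -
  have "F ` {xs. length xs = n \<and> set xs \<subseteq> carrier G} \<subseteq> carrier A"
    using assms(2) by blast
  from comm_group.free_Abelian_group_universal[OF assms(1) this] obtain h where
    "h \<in> hom (free_Abelian_group {xs. length xs = n \<and> set xs \<subseteq> carrier G}) A"
    "\<And>x. x \<in> {xs. length xs = n \<and> set xs \<subseteq> carrier G} \<Longrightarrow> h (frag_of x) = F x"
    by blast
  then show thesis
    using that[of h] by (simp add: bar_chains_def)
qed

lemma HZ_mapD:
  assumes "HZ_map G H f"
  shows "group G" "group H" "f \<in> hom G H"
    and "\<And>z. z \<in> chains 1 H \<Longrightarrow>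
           \<exists>x \<in> chains 1 G. \<exists>y \<in> chains 2 H. z = bar_map f x + bar_boundary H y"
    and "\<And>x y. x \<in> chains 1 G \<Longrightarrow> y \<in> chains 2 H \<Longrightarrow> bar_map f x = bar_boundary H y \<Longrightarrow>
           \<exists>x' \<in> chains 2 G. x = bar_boundary G x'"
    and "\<And>z. z \<in> chains 2 H \<Longrightarrow> bar_boundary H z = 0 \<Longrightarrow>
           \<exists>x \<in> chains 2 G. \<exists>y \<in> chains 3 H.
             bar_boundary G x = 0 \<and> z = bar_map f x + bar_boundary H y"
proof -
  show G: "group G" and H: "group H" and f: "f \<in> hom G H"
    using assms by (auto simp: HZ_map_def)
  note * = HZ_map_iff[OF G H f, THEN iffD1, OF assms]
  show "\<exists>x \<in> chains 1 G. \<exists>y \<in> chains 2 H. z = bar_map f x + bar_boundary H y"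
    if z: "z \<in> chains 1 H" for z
  proof -
    obtain x where "x \<in> chains 1 G" "z - bar_map f x \<in> bar_boundaries 1 H"
      using * z by blast
    then obtain y where "y \<in> chains 2 H" "z - bar_map f x = bar_boundary H y"
      unfolding bar_boundaries_1 by blast
    then have "z = bar_map f x + bar_boundary H y" by (simp add: algebra_simps)
    then show ?thesis
      using \<open>x \<in> _\<close> \<open>y \<in> _\<close> by blast
  qed
  show "\<exists>x' \<in> chains 2 G. x = bar_boundary G x'"
    if "x \<in> chains 1 G" "y \<in> chains 2 H" "bar_map f x = bar_boundary H y" for x y
  proof -
    have "bar_map f x \<in> bar_boundaries 1 H"
      using that unfolding bar_boundaries_1 by blast
    then have "x \<in> bar_boundaries 1 G"
      using * that by blast
    then show ?thesis
      unfolding bar_boundaries_1 by blast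
  qed
  show "\<exists>x \<in> chains 2 G. \<exists>y \<in> chains 3 H.
             bar_boundary G x = 0 \<and> z = bar_map f x + bar_boundary H y"
    if z: "z \<in> chains 2 H" "bar_boundary H z = 0" for z
  proof -
    have "z \<in> bar_cycles 2 H"
      using z by (simp add: bar_cycles_def)
    then obtain x where x: "x \<in> bar_cycles 2 G" "z - bar_map f x \<in> bar_boundaries 2 H"
      using * by blast
    then obtain y where "y \<in> chains 3 H" "z - bar_map f x = bar_boundary H y"
      unfolding bar_boundaries_2 by blast
    then have "z = bar_map f x + bar_boundary H y" by (simp add: algebra_simps)
    then show ?thesis
      using x \<open>y \<in> _\<close> by (auto simp: bar_cycles_def)
  qed
qed

lemma HZ_mapI:
  assumes G: "group G" and H: "group H" and f: "f \<in> hom G H"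
    and surj1: "\<And>z. z \<in> chains 1 H \<Longrightarrow>
           \<exists>x \<in> chains 1 G. \<exists>y \<in> chains 2 H. z = bar_map f x + bar_boundary H y"
    and inj1: "\<And>x y. x \<in> chains 1 G \<Longrightarrow> y \<in> chains 2 H \<Longrightarrow> bar_map f x = bar_boundary H y \<Longrightarrow>
           \<exists>x' \<in> chains 2 G. x = bar_boundary G x'"
    and surj2: "\<And>z. z \<in> chains 2 H \<Longrightarrow> bar_boundary H z = 0 \<Longrightarrow>
           \<exists>x \<in> chains 2 G. \<exists>y \<in> chains 3 H.
             bar_boundary G x = 0 \<and> z = bar_map f x + bar_boundary H y"
  shows "HZ_map G H f"
  unfolding HZ_map_iff[OF G H f]
proof (intro conjI ballI impI)
  fix z assume "z \<in> chains 1 H"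
  then obtain x y where "x \<in> chains 1 G" "y \<in> chains 2 H" "z = bar_map f x + bar_boundary H y"
    using surj1 by blast
  then show "\<exists>x \<in> chains 1 G. z - bar_map f x \<in> bar_boundaries 1 H"
    unfolding bar_boundaries_1 by (intro bexI[of _ x]) auto
next
  fix x assume "x \<in> chains 1 G" "bar_map f x \<in> bar_boundaries 1 H"
  then show "x \<in> bar_boundaries 1 G"
    using inj1 unfolding bar_boundaries_1 by blast
next
  fix z assume "z \<in> bar_cycles 2 H"
  then obtain x y where "x \<in> chains 2 G" "y \<in> chains 3 H" "bar_boundary G x = 0"
    "z = bar_map f x + bar_boundary H y"
    using surj2 unfolding bar_cycles_def by blast
  then show "\<exists>x \<in> bar_cycles 2 G. z - bar_map f x \<in> bar_boundaries 2 H"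
    unfolding bar_boundaries_2 bar_cycles_def by (intro bexI[of _ x]) auto
qed

text \<open>This takes the place of the universal coefficient theorem. Every 2-cycle of \<open>H\<close> comes, up to a
  boundary, from a 2-cycle of \<open>G\<close>, and there \<open>c\<close> agrees with \<open>b\<close> composed with the boundary map; so \<open>c\<close> vanishes on 2-cycles and
  induces a homomorphism on the 1-boundaries of \<open>H\<close>. The isomorphism on first homology makes
  the 1-chains of \<open>H\<close> the pushout of the 1-chains of \<open>G\<close> and the 1-boundaries of \<open>H\<close> over the 1-boundaries of \<open>G\<close>, so that \<open>b\<close> and the
  induced homomorphism glue to \<open>\<gamma>\<close>.\<close>

lemma cochain_extension:
  assumes f: "HZ_map G H f" and A: "comm_group A"
    and b: "b \<in> hom (bar_chains 1 G) A" and c: "c \<in> hom (bar_chains 2 H) A"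
    and c0: "\<And>w. w \<in> chains 3 H \<Longrightarrow> c (bar_boundary H w) = \<one>\<^bsub>A\<^esub>"
    and bc: "\<And>x. x \<in> chains 2 G \<Longrightarrow> b (bar_boundary G x) = c (bar_map f x)"
  obtains \<gamma> where "\<gamma> \<in> hom (bar_chains 1 H) A"
    "\<And>y. y \<in> chains 2 H \<Longrightarrow> \<gamma> (bar_boundary H y) = c y"
    "\<And>x. x \<in> chains 1 G \<Longrightarrow> \<gamma> (bar_map f x) = b x"
proof -
  interpret A: comm_group A by fact
  note G = HZ_mapD(1)[OF f] and H = HZ_mapD(2)[OF f] and hom = HZ_mapD(3)[OF f]
  note in_b = hom_in_carrier[OF b] and in_c = hom_in_carrier[OF c]
  note map1 = bar_map_chains[OF hom, of _ 1] and map2 = bar_map_chains[OF hom, of _ 2]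
  note bd2 = bar_boundary_chains2[OF H] and bd3 = bar_boundary_chains3[OF H]
  have vanish: "b x \<otimes>\<^bsub>A\<^esub> c y = \<one>\<^bsub>A\<^esub>"
    if x: "x \<in> chains 1 G" and y: "y \<in> chains 2 H"
      and 0: "bar_map f x + bar_boundary H y = 0" for x y
  proof -
    have "bar_map f x = bar_boundary H (- y)"
      using 0 by (simp add: bar_boundary_minus eq_neg_iff_add_eq_0)
    then obtain x2 where x2: "x2 \<in> chains 2 G" "x = bar_boundary G x2"
      using HZ_mapD(5)[OF f x bar_chains_minus[OF y]] by blast
    have "bar_boundary H (bar_map f x2 + y) = 0"
      using 0 x2 by (simp add: bar_boundary_add bar_map_boundary2[OF hom])
    then obtain x' w where x': "x' \<in> chains 2 G" "bar_boundary G x' = 0"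
      and w: "w \<in> chains 3 H" "bar_map f x2 + y = bar_map f x' + bar_boundary H w"
      using HZ_mapD(6)[OF f bar_chains_add[OF map2[OF x2(1)] y]] by blast
    have "b x \<otimes>\<^bsub>A\<^esub> c y = c (bar_map f x2) \<otimes>\<^bsub>A\<^esub> c y"
      using bc[OF x2(1)] x2 by simp
    also have "\<dots> = c (bar_map f x' + bar_boundary H w)"
      using hom_bar_chains_add[OF c map2[OF x2(1)] y] w by simp
    also have "\<dots> = b (bar_boundary G x')"
      using hom_bar_chains_add[OF c map2[OF x'(1)] bd3[OF w(1)]] c0[OF w(1)] bc[OF x'(1)] in_c[OF map2[OF x'(1)]] by simp
    also have "\<dots> = \<one>\<^bsub>A\<^esub>"
      using x' hom_bar_chains_zero[OF b A.is_group] by simp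
    finally show ?thesis .
  qed
  define \<gamma> where "\<gamma> z = (THE v. \<exists>x \<in> chains 1 G. \<exists>y \<in> chains 2 H.
      z = bar_map f x + bar_boundary H y \<and> v = b x \<otimes>\<^bsub>A\<^esub> c y)" for z
  have \<gamma>: "\<gamma> (bar_map f x + bar_boundary H y) = b x \<otimes>\<^bsub>A\<^esub> c y"
    if x: "x \<in> chains 1 G" and y: "y \<in> chains 2 H" for x y
    unfolding \<gamma>_def
  proof (rule the_equality)
    fix v
    assume "\<exists>x'\<in>chains 1 G. \<exists>y'\<in>chains 2 H.
      bar_map f x + bar_boundary H y = bar_map f x' + bar_boundary H y' \<and> v = b x' \<otimes>\<^bsub>A\<^esub> c y'"
    then obtain x' y' where x': "x' \<in> chains 1 G" and y': "y' \<in> chains 2 H"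
      and eq: "bar_map f x + bar_boundary H y = bar_map f x' + bar_boundary H y'" and v: "v = b x' \<otimes>\<^bsub>A\<^esub> c y'"
      by blast
    have "b (x - x') \<otimes>\<^bsub>A\<^esub> c (y - y') = \<one>\<^bsub>A\<^esub>"
      using eq by (intro vanish bar_chains_diff x x' y y')
        (simp add: bar_map_diff bar_boundary_diff algebra_simps)
    then have "b x \<otimes>\<^bsub>A\<^esub> c y \<otimes>\<^bsub>A\<^esub> inv\<^bsub>A\<^esub> v = \<one>\<^bsub>A\<^esub>"
      using in_b[OF x] in_b[OF x'] in_c[OF y] in_c[OF y']
      by (simp add: hom_bar_chains_diff[OF b A.is_group x x'] hom_bar_chains_diff[OF c A.is_group y y'] v
          A.inv_mult A.m_ac)
    then show "v = b x \<otimes>\<^bsub>A\<^esub> c y"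
      using in_b[OF x] in_b[OF x'] in_c[OF y] in_c[OF y'] v
      by (simp add: A.mult_inv_eq_one_iff)
  qed (use x y in blast)
  have ex: "\<exists>x \<in> chains 1 G. \<exists>y \<in> chains 2 H. z = bar_map f x + bar_boundary H y"
    if "z \<in> chains 1 H" for z
    using HZ_mapD(4)[OF f that] .
  show thesis
  proof (rule that)
    show "\<gamma> \<in> hom (bar_chains 1 H) A"
    proof (rule homI)
      fix z assume "z \<in> chains 1 H"
      then show "\<gamma> z \<in> carrier A"
        using ex[of z] \<gamma> in_b in_c by auto
    next
      fix z z' assume "z \<in> chains 1 H" "z' \<in> chains 1 H"
      then obtain x y x' y' where
        x: "x \<in> chains 1 G" and y: "y \<in> chains 2 H" and
        x': "x' \<in> chains 1 G" and y': "y' \<in> chains 2 H" and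
        z: "z = bar_map f x + bar_boundary H y" "z' = bar_map f x' + bar_boundary H y'"
        using ex by metis
      have "z + z' = bar_map f (x + x') + bar_boundary H (y + y')"
        unfolding z by (simp add: bar_map_add bar_boundary_add algebra_simps)
      then have "\<gamma> (z + z') = b (x + x') \<otimes>\<^bsub>A\<^esub> c (y + y')"
        using \<gamma>[OF bar_chains_add[OF x x'] bar_chains_add[OF y y']] by simp
      then show "\<gamma> (z \<otimes>\<^bsub>bar_chains 1 H\<^esub> z') = \<gamma> z \<otimes>\<^bsub>A\<^esub> \<gamma> z'"
        using in_b[OF x] in_b[OF x'] in_c[OF y] in_c[OF y']
        unfolding z mult_bar_chains by (simp add: \<gamma> x x' y y' hom_bar_chains_add[OF b] hom_bar_chains_add[OF c] A.m_ac)
    qed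
  next
    fix y assume y: "y \<in> chains 2 H"
    show "\<gamma> (bar_boundary H y) = c y"
      using \<gamma>[OF bar_chains_zero y] hom_bar_chains_zero[OF b A.is_group] in_c[OF y] by simp
  next
    fix x assume x: "x \<in> chains 1 G"
    show "\<gamma> (bar_map f x) = b x"
      using \<gamma>[OF x bar_chains_zero] hom_bar_chains_zero[OF c A.is_group] in_b[OF x] by simp
  qed
qed

lemma hom_on_chains:
  assumes H: "group H" and A: "comm_group A" and d: "d \<in> hom H A"
  obtains D where "D \<in> hom (bar_chains 1 H) A"
    "\<And>h. h \<in> carrier H \<Longrightarrow> D (frag_of [h]) = d h"
    "\<And>y. y \<in> chains 2 H \<Longrightarrow> D (bar_boundary H y) = \<one>\<^bsub>A\<^esub>"
proof -
  interpret A: comm_group A by fact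
  interpret H: group H by fact
  have dc: "d x \<in> carrier A" if "x \<in> carrier H" for x
    using d that by (rule hom_in_carrier)
  obtain D where D: "D \<in> hom (bar_chains 1 H) A"
    and Dof': "\<And>xs. length xs = 1 \<Longrightarrow> set xs \<subseteq> carrier H \<Longrightarrow> D (frag_of xs) = d (hd xs)"
    by (rule hom_bar_chains_of[OF A, of 1 H "\<lambda>xs. d (hd xs)"]) (auto simp: length_1_iff dc)
  have Dof: "D (frag_of [h]) = d h" if "h \<in> carrier H" for h
    using Dof'[of "[h]"] that by simp
  have "D (bar_boundary H y) = \<one>\<^bsub>A\<^esub>" if "y \<in> chains 2 H" for y
    using that
  proof (induction rule: bar_chains_induct)
    case (of xs)
    then obtain k l where xs: "xs = [k, l]" "k \<in> carrier H" "l \<in> carrier H" by (auto simp: length_2_iff)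
    have "bar_boundary H (frag_of xs) = (frag_of [k] + frag_of [l]) - frag_of [k \<otimes>\<^bsub>H\<^esub> l]"
      by (simp add: xs bar_boundary_of2)
    then have "D (bar_boundary H (frag_of xs)) = (d k \<otimes>\<^bsub>A\<^esub> d l) \<otimes>\<^bsub>A\<^esub> inv\<^bsub>A\<^esub> d (k \<otimes>\<^bsub>H\<^esub> l)"
      using xs by (simp add: hom_bar_chains_diff[OF D A.is_group] bar_chains_add hom_bar_chains_add[OF D] Dof)
    then show ?case
      using xs by (simp add: hom_mult[OF d] dc)
  qed (simp_all add: hom_bar_chains_zero[OF D A.is_group] bar_boundary_diff
        hom_bar_chains_diff[OF D A.is_group] bar_boundary_chains2[OF H])
  then show thesis
    using that D Dof by blast
qed

text \<open>A 1-chain of \<open>H\<close> is an image of a chain of \<open>G\<close> plus a boundary, and \<open>d\<close> vanishes on both.\<close>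

lemma HZ_map_hom_eq:
  assumes f: "HZ_map G H f" and A: "comm_group A" and d: "d \<in> hom H A"
    and 0: "\<And>g. g \<in> carrier G \<Longrightarrow> d (f g) = \<one>\<^bsub>A\<^esub>" and h: "h \<in> carrier H"
  shows "d h = \<one>\<^bsub>A\<^esub>"
proof -
  interpret A: comm_group A by fact
  note H = HZ_mapD(2)[OF f] and hom = HZ_mapD(3)[OF f]
  obtain D where D: "D \<in> hom (bar_chains 1 H) A" and Dof: "\<And>h. h \<in> carrier H \<Longrightarrow> D (frag_of [h]) = d h"
    and D0: "\<And>y. y \<in> chains 2 H \<Longrightarrow> D (bar_boundary H y) = \<one>\<^bsub>A\<^esub>"
    using hom_on_chains[OF H A d] by blast
  obtain x y where x: "x \<in> chains 1 G" and y: "y \<in> chains 2 H"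
    and h_eq: "frag_of [h] = bar_map f x + bar_boundary H y"
    using HZ_mapD(4)[OF f, of "frag_of [h]"] h by auto
  have "D (bar_map f x) = \<one>\<^bsub>A\<^esub>"
    using x
  proof (induction rule: bar_chains_induct)
    case (of xs)
    then obtain g where "xs = [g]" "g \<in> carrier G" by (auto simp: length_1_iff)
    then show ?case
      using Dof[of "f g"] hom_in_carrier[OF hom] by (simp add: 0)
  qed (simp_all add: hom_bar_chains_zero[OF D A.is_group] bar_map_diff
        hom_bar_chains_diff[OF D A.is_group bar_map_chains[OF hom] bar_map_chains[OF hom]])
  then have "D (frag_of [h]) = \<one>\<^bsub>A\<^esub>"
    unfolding h_eq using hom_bar_chains_add[OF D bar_map_chains[OF hom x] bar_boundary_chains2[OF H y]] D0[OF y]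
    by simp
  then show ?thesis
    using Dof[OF h] by simp
qed

text \<open>Functions are compared on the carriers only, which avoids extensional representatives.\<close>

lemma HZ_localI:
  fixes \<Gamma> :: "'c monoid"
  assumes "group \<Gamma>"
    and ex: "\<And>(G :: 'g monoid) (H :: 'h monoid) f \<phi>. HZ_map G H f \<Longrightarrow> \<phi> \<in> hom G \<Gamma> \<Longrightarrow>
      \<exists>\<psi> \<in> hom H \<Gamma>. \<forall>g \<in> carrier G. \<psi> (f g) = \<phi> g"
    and uniq: "\<And>(G :: 'g monoid) (H :: 'h monoid) f \<psi> \<psi>' h. HZ_map G H f \<Longrightarrow> \<psi> \<in> hom H \<Gamma> \<Longrightarrow> \<psi>' \<in> hom H \<Gamma> \<Longrightarrow>
      (\<And>g. g \<in> carrier G \<Longrightarrow> \<psi> (f g) = \<psi>' (f g)) \<Longrightarrow> h \<in> carrier H \<Longrightarrow> \<psi> h = \<psi>' h"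
  shows "HZ_local TYPE('g) TYPE('h) \<Gamma>"
  unfolding HZ_local_def
proof (intro conjI allI impI)
  fix G :: "'g monoid" and H :: "'h monoid" and f
  assume f: "HZ_map G H f"
  interpret G: group G by (rule HZ_mapD(1)[OF f])
  interpret H: group H by (rule HZ_mapD(2)[OF f])
  note hom = HZ_mapD(3)[OF f]
  show "bij_betw (\<lambda>\<phi>. compose (carrier G) \<phi> f)
          (hom H \<Gamma> \<inter> extensional (carrier H)) (hom G \<Gamma> \<inter> extensional (carrier G))"
    unfolding bij_betw_def
  proof (intro conjI)
    show "inj_on (\<lambda>\<phi>. compose (carrier G) \<phi> f) (hom H \<Gamma> \<inter> extensional (carrier H))"
    proof (rule inj_onI)
      fix \<psi> \<psi>'
      assume \<psi>: "\<psi> \<in> hom H \<Gamma> \<inter> extensional (carrier H)" and \<psi>': "\<psi>' \<in> hom H \<Gamma> \<inter> extensional (carrier H)"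
        and eq: "compose (carrier G) \<psi> f = compose (carrier G) \<psi>' f"
      have "\<psi> (f g) = \<psi>' (f g)" if "g \<in> carrier G" for g
        using fun_cong[OF eq, of g] that by (simp add: compose_def)
      then have "\<psi> h = \<psi>' h" if "h \<in> carrier H" for h
        using uniq[OF f, of \<psi> \<psi>'] \<psi> \<psi>' that by blast
      then show "\<psi> = \<psi>'"
        using \<psi> \<psi>' by (intro extensionalityI[of _ "carrier H"]) auto
    qed
    show "(\<lambda>\<phi>. compose (carrier G) \<phi> f) ` (hom H \<Gamma> \<inter> extensional (carrier H)) = hom G \<Gamma> \<inter> extensional (carrier G)"
    proof (intro equalityI subsetI)
      fix \<phi> assume "\<phi> \<in> (\<lambda>\<phi>. compose (carrier G) \<phi> f) ` (hom H \<Gamma> \<inter> extensional (carrier H))"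
      then obtain \<psi> where "\<psi> \<in> hom H \<Gamma>" "\<phi> = compose (carrier G) \<psi> f" by blast
      then show "\<phi> \<in> hom G \<Gamma> \<inter> extensional (carrier G)"
        using hom_in_carrier[OF hom] hom_mult[OF hom] hom_in_carrier[of \<psi> H \<Gamma>] hom_mult[of \<psi> H \<Gamma>]
        by (auto simp: hom_def compose_def)
    next
      fix \<phi> assume \<phi>: "\<phi> \<in> hom G \<Gamma> \<inter> extensional (carrier G)"
      then obtain \<psi> where \<psi>: "\<psi> \<in> hom H \<Gamma>" "\<forall>g \<in> carrier G. \<psi> (f g) = \<phi> g"
        using ex[OF f, of \<phi>] by blast
      have "restrict \<psi> (carrier H) \<in> hom H \<Gamma> \<inter> extensional (carrier H)"
        using \<psi>(1) by (auto simp: hom_def)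
      moreover have "compose (carrier G) (restrict \<psi> (carrier H)) f = \<phi>"
        using \<psi>(2) \<phi> hom_in_carrier[OF hom]
        by (intro extensionalityI[of _ "carrier G"]) (auto simp: compose_def)
      ultimately show "\<phi> \<in> (\<lambda>\<phi>. compose (carrier G) \<phi> f) ` (hom H \<Gamma> \<inter> extensional (carrier H))"
        by blast
    qed
  qed
qed fact

lemma HZ_localD:
  fixes \<Gamma> :: "'c monoid" and G :: "'g monoid" and H :: "'h monoid"
  assumes loc: "HZ_local TYPE('g) TYPE('h) \<Gamma>" and f: "HZ_map G H f"
  shows HZ_local_extend: "\<phi> \<in> hom G \<Gamma> \<Longrightarrow> \<exists>\<psi> \<in> hom H \<Gamma>. \<forall>g \<in> carrier G. \<psi> (f g) = \<phi> g"
    and HZ_local_unique: "\<psi> \<in> hom H \<Gamma> \<Longrightarrow> \<psi>' \<in> hom H \<Gamma> \<Longrightarrow>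
      (\<And>g. g \<in> carrier G \<Longrightarrow> \<psi> (f g) = \<psi>' (f g)) \<Longrightarrow> h \<in> carrier H \<Longrightarrow> \<psi> h = \<psi>' h"
proof -
  interpret G: group G by (rule HZ_mapD(1)[OF f])
  interpret H: group H by (rule HZ_mapD(2)[OF f])
  note hom = HZ_mapD(3)[OF f]
  have bij: "bij_betw (\<lambda>\<phi>. compose (carrier G) \<phi> f)
          (hom H \<Gamma> \<inter> extensional (carrier H)) (hom G \<Gamma> \<inter> extensional (carrier G))"
    using loc f unfolding HZ_local_def by blast
  show "\<exists>\<psi> \<in> hom H \<Gamma>. \<forall>g \<in> carrier G. \<psi> (f g) = \<phi> g" if "\<phi> \<in> hom G \<Gamma>"
  proof -
    have "restrict \<phi> (carrier G) \<in> hom G \<Gamma> \<inter> extensional (carrier G)"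
      using that by (auto simp: hom_def)
    then obtain \<psi> where "\<psi> \<in> hom H \<Gamma>" "compose (carrier G) \<psi> f = restrict \<phi> (carrier G)"
      using bij unfolding bij_betw_def by (metis (no_types, lifting) IntD1 imageE)
    then show ?thesis
      by (intro bexI[of _ \<psi>] ballI) (metis compose_eq restrict_apply', assumption)
  qed
  show "\<psi> h = \<psi>' h" if \<psi>: "\<psi> \<in> hom H \<Gamma>" and \<psi>': "\<psi>' \<in> hom H \<Gamma>"
    and eq: "\<And>g. g \<in> carrier G \<Longrightarrow> \<psi> (f g) = \<psi>' (f g)" and h: "h \<in> carrier H"
  proof -
    have "restrict \<psi> (carrier H) = restrict \<psi>' (carrier H)"
    proof (rule inj_onD[OF bij_betw_imp_inj_on[OF bij]])
      show "compose (carrier G) (restrict \<psi> (carrier H)) f = compose (carrier G) (restrict \<psi>' (carrier H)) f"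
        using eq hom_in_carrier[OF hom] by (auto simp: compose_def)
    qed (use \<psi> \<psi>' in \<open>auto simp: hom_def\<close>)
    then show ?thesis
      using h by (metis restrict_apply')
  qed
qed

lemma HZ_local_group: "HZ_local TG TH \<Gamma> \<Longrightarrow> group \<Gamma>"
  by (simp add: HZ_local_def)

lemma HZ_local_trivial:
  assumes "group \<Gamma>" "carrier \<Gamma> = {\<one>\<^bsub>\<Gamma>\<^esub>}"
  shows "HZ_local TYPE('g) TYPE('h) \<Gamma>"
proof (rule HZ_localI[OF assms(1)])
  interpret group \<Gamma> by fact
  fix G :: "'g monoid" and H :: "'h monoid" and f \<phi>
  assume "\<phi> \<in> hom G \<Gamma>"
  moreover have "(\<lambda>_. \<one>\<^bsub>\<Gamma>\<^esub>) \<in> hom H \<Gamma>"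
    by (simp add: hom_def)
  ultimately show "\<exists>\<psi> \<in> hom H \<Gamma>. \<forall>g \<in> carrier G. \<psi> (f g) = \<phi> g"
    using assms(2) hom_in_carrier[of \<phi> G \<Gamma>] by fastforce
next
  fix G :: "'g monoid" and H :: "'h monoid" and f \<psi> \<psi>' h
  assume "\<psi> \<in> hom H \<Gamma>" "\<psi>' \<in> hom H \<Gamma>" "h \<in> carrier H"
  then show "\<psi> h = \<psi>' h"
    using assms(2) hom_in_carrier[of \<psi> H \<Gamma> h] hom_in_carrier[of \<psi>' H \<Gamma> h] by simp
qed

lemma (in group) inv_cancel:
  assumes "x \<in> carrier G" "y \<in> carrier G"
  shows "inv x \<otimes> (x \<otimes> y) = y" "x \<otimes> (inv x \<otimes> y) = y"
  using assms by (simp_all add: m_assoc[symmetric])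

text \<open>Existence: a homomorphism to \<open>\<Gamma>\<close> is composed with \<open>p\<close>, extended to \<open>\<psi>\<close> by locality of \<open>Q\<close>, and lifted to a
  function \<open>\<sigma>\<close> to \<open>\<Gamma>\<close>. The failure \<open>\<kappa>\<close> of \<open>\<sigma>\<close> to be a homomorphism is a 2-cocycle with values in the kernel,
  and the given homomorphism exhibits its restriction to \<open>G\<close> as the coboundary of \<open>\<beta>\<close>. The extension \<open>\<gamma>\<close>
  of \<open>\<beta>\<close> supplied by \<open>cochain_extension\<close> corrects \<open>\<sigma>\<close> to a homomorphism.
  Uniqueness: two extensions differ by a homomorphism to the kernel that is trivial on the image of \<open>G\<close>.\<close>

lemma HZ_local_central_extension:
  fixes \<Gamma> :: "'c monoid" (structure) and Q :: "'q monoid"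
  assumes \<Gamma>: "group \<Gamma>" and p: "p \<in> hom \<Gamma> Q" and surj: "p ` carrier \<Gamma> = carrier Q"
    and central: "\<And>k x. k \<in> carrier \<Gamma> \<Longrightarrow> p k = \<one>\<^bsub>Q\<^esub> \<Longrightarrow> x \<in> carrier \<Gamma> \<Longrightarrow> k \<otimes> x = x \<otimes> k"
    and loc: "HZ_local TYPE('g) TYPE('h) Q"
  shows "HZ_local TYPE('g) TYPE('h) \<Gamma>"
proof -
  interpret \<Gamma>: group \<Gamma> by fact
  interpret Q: group Q by (rule HZ_local_group[OF loc])
  interpret p: group_hom \<Gamma> Q p using p by unfold_locales
  define K where "K = \<Gamma>\<lparr>carrier := kernel \<Gamma> Q p\<rparr>"
  have carrier_K: "k \<in> carrier K \<longleftrightarrow> k \<in> carrier \<Gamma> \<and> p k = \<one>\<^bsub>Q\<^esub>" for k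
    by (auto simp: K_def kernel_def)
  have mult_K [simp]: "x \<otimes>\<^bsub>K\<^esub> y = x \<otimes> y" and one_K [simp]: "\<one>\<^bsub>K\<^esub> = \<one>" for x y
    by (simp_all add: K_def)
  have "group K"
    unfolding K_def by (rule subgroup.subgroup_is_group[OF p.subgroup_kernel \<Gamma>])
  then have K: "comm_group K"
    by (rule group.group_comm_groupI) (use central in \<open>auto simp: carrier_K\<close>)
  interpret K: comm_group K by fact
  have inv_K: "inv\<^bsub>K\<^esub> x = inv x" if "x \<in> carrier K" for x
    using \<Gamma>.m_inv_consistent[OF p.subgroup_kernel, of x] that by (simp add: K_def)
  show ?thesis
  proof (rule HZ_localI[OF \<Gamma>])
    fix G :: "'g monoid" and H :: "'h monoid" and f \<psi> \<psi>' h
    assume f: "HZ_map G H f" and \<psi>: "\<psi> \<in> hom H \<Gamma>" and \<psi>': "\<psi>' \<in> hom H \<Gamma>"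
      and eq: "\<And>g. g \<in> carrier G \<Longrightarrow> \<psi> (f g) = \<psi>' (f g)" and h: "h \<in> carrier H"
    interpret H: group H by (rule HZ_mapD(2)[OF f])
    note hom = HZ_mapD(3)[OF f]
    note in\<psi> = hom_in_carrier[OF \<psi>] and in\<psi>' = hom_in_carrier[OF \<psi>']
    have "(p \<circ> \<psi>) k = (p \<circ> \<psi>') k" if "k \<in> carrier H" for k
      by (rule HZ_local_unique[OF loc f hom_compose[OF \<psi> p] hom_compose[OF \<psi>' p] _ that]) (simp add: eq)
    then have pk: "p (\<psi> k) = p (\<psi>' k)" if "k \<in> carrier H" for k
      using that by simp
    have inK: "\<psi> k \<otimes> inv \<psi>' k \<in> carrier K" if "k \<in> carrier H" for k
      using that in\<psi>[of k] in\<psi>'[of k] pk by (simp add: carrier_K)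
    have hom_d: "(\<lambda>k. \<psi> k \<otimes> inv \<psi>' k) \<in> hom H K"
    proof (rule homI)
      fix k l assume k: "k \<in> carrier H" and l: "l \<in> carrier H"
      note c = in\<psi>[OF k] in\<psi>[OF l] in\<psi>'[OF k] in\<psi>'[OF l]
      let ?m = "\<psi> l \<otimes> inv \<psi>' l"
      have "\<psi> (k \<otimes>\<^bsub>H\<^esub> l) \<otimes> inv \<psi>' (k \<otimes>\<^bsub>H\<^esub> l) = \<psi> k \<otimes> (?m \<otimes> inv \<psi>' k)"
        using c k l by (simp add: hom_mult[OF \<psi>] hom_mult[OF \<psi>'] \<Gamma>.inv_mult_group \<Gamma>.m_assoc)
      also have "?m \<otimes> inv \<psi>' k = inv \<psi>' k \<otimes> ?m"
        using inK[OF l] c by (intro central) (auto simp: carrier_K)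
      finally show "\<psi> (k \<otimes>\<^bsub>H\<^esub> l) \<otimes> inv \<psi>' (k \<otimes>\<^bsub>H\<^esub> l) =
          \<psi> k \<otimes> inv \<psi>' k \<otimes>\<^bsub>K\<^esub> ?m"
        using c by (simp add: \<Gamma>.m_assoc)
    qed (rule inK)
    have "\<psi> h \<otimes> inv \<psi>' h = \<one>\<^bsub>K\<^esub>"
    proof (rule HZ_map_hom_eq[OF f K hom_d _ h])
      fix g assume "g \<in> carrier G"
      then show "\<psi> (f g) \<otimes> inv \<psi>' (f g) = \<one>\<^bsub>K\<^esub>"
        using eq in\<psi>'[OF hom_in_carrier[OF hom]] by simp
    qed
    then show "\<psi> h = \<psi>' h"
      using in\<psi>[OF h] in\<psi>'[OF h] by (simp add: \<Gamma>.mult_inv_eq_one_iff)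
  next
    fix G :: "'g monoid" and H :: "'h monoid" and f \<phi>
    assume f: "HZ_map G H f" and \<phi>: "\<phi> \<in> hom G \<Gamma>"
    interpret G: group G by (rule HZ_mapD(1)[OF f])
    interpret H: group H by (rule HZ_mapD(2)[OF f])
    note hom = HZ_mapD(3)[OF f] and in\<phi> = hom_in_carrier[OF \<phi>]
    note inf = hom_in_carrier[OF hom]
    obtain \<psi> where \<psi>: "\<psi> \<in> hom H Q" and \<psi>f: "\<And>g. g \<in> carrier G \<Longrightarrow> \<psi> (f g) = p (\<phi> g)"
      using HZ_local_extend[OF loc f hom_compose[OF \<phi> p]] by auto
    define \<sigma> where "\<sigma> h = (SOME x. x \<in> carrier \<Gamma> \<and> p x = \<psi> h)" for h
    have \<sigma>: "\<sigma> h \<in> carrier \<Gamma>" "p (\<sigma> h) = \<psi> h" if "h \<in> carrier H" for h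
    proof -
      have "\<exists>x. x \<in> carrier \<Gamma> \<and> p x = \<psi> h"
        using surj hom_in_carrier[OF \<psi> that] by (metis imageE)
      from someI_ex[OF this] show "\<sigma> h \<in> carrier \<Gamma>" "p (\<sigma> h) = \<psi> h"
        unfolding \<sigma>_def by blast+
    qed
    define \<kappa> where "\<kappa> h k = \<sigma> (h \<otimes>\<^bsub>H\<^esub> k) \<otimes> inv (\<sigma> h \<otimes> \<sigma> k)" for h k
    have \<kappa>K: "\<kappa> h k \<in> carrier K" if "h \<in> carrier H" "k \<in> carrier H" for h k
      using that hom_in_carrier[OF \<psi>, of h] hom_in_carrier[OF \<psi>, of k] \<sigma>[of h] \<sigma>[of k] \<sigma>[of "h \<otimes>\<^bsub>H\<^esub> k"]
      by (simp add: \<kappa>_def carrier_K hom_mult[OF \<psi>])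
    have \<kappa>c: "\<kappa> h k \<in> carrier \<Gamma>" if "h \<in> carrier H" "k \<in> carrier H" for h k
      using \<kappa>K that by (simp add: carrier_K)
    have \<kappa>z: "x \<otimes> \<kappa> h k = \<kappa> h k \<otimes> x" if "h \<in> carrier H" "k \<in> carrier H" "x \<in> carrier \<Gamma>" for h k x
      using central[of "\<kappa> h k" x] \<kappa>K[of h k] that by (simp add: carrier_K)
    have \<sigma>mult: "\<sigma> (h \<otimes>\<^bsub>H\<^esub> k) = \<kappa> h k \<otimes> (\<sigma> h \<otimes> \<sigma> k)" if "h \<in> carrier H" "k \<in> carrier H" for h k
      using that \<sigma>[of h] \<sigma>[of k] \<sigma>[of "h \<otimes>\<^bsub>H\<^esub> k"] by (simp add: \<kappa>_def \<Gamma>.m_assoc)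
    have cocycle: "\<kappa> k l \<otimes> \<kappa> h (k \<otimes>\<^bsub>H\<^esub> l) = \<kappa> (h \<otimes>\<^bsub>H\<^esub> k) l \<otimes> \<kappa> h k"
      if h: "h \<in> carrier H" and k: "k \<in> carrier H" and l: "l \<in> carrier H" for h k l
    proof -
      note \<sigma>c = \<sigma>(1)[OF h] \<sigma>(1)[OF k] \<sigma>(1)[OF l]
      let ?s = "\<sigma> h \<otimes> (\<sigma> k \<otimes> \<sigma> l)"
      have "\<sigma> (h \<otimes>\<^bsub>H\<^esub> k \<otimes>\<^bsub>H\<^esub> l) = \<kappa> (h \<otimes>\<^bsub>H\<^esub> k) l \<otimes> (\<kappa> h k \<otimes> (\<sigma> h \<otimes> \<sigma> k) \<otimes> \<sigma> l)"
        using h k l \<sigma>mult by simp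
      then have 1: "\<sigma> (h \<otimes>\<^bsub>H\<^esub> k \<otimes>\<^bsub>H\<^esub> l) = \<kappa> (h \<otimes>\<^bsub>H\<^esub> k) l \<otimes> \<kappa> h k \<otimes> ?s"
        using h k l \<sigma>c \<kappa>c by (simp add: \<Gamma>.m_assoc)
      have "\<sigma> (h \<otimes>\<^bsub>H\<^esub> (k \<otimes>\<^bsub>H\<^esub> l)) = \<kappa> h (k \<otimes>\<^bsub>H\<^esub> l) \<otimes> (\<sigma> h \<otimes> \<kappa> k l \<otimes> (\<sigma> k \<otimes> \<sigma> l))"
        using h k l \<sigma>mult \<sigma>c \<kappa>c by (simp add: \<Gamma>.m_assoc)
      also have "\<sigma> h \<otimes> \<kappa> k l = \<kappa> k l \<otimes> \<sigma> h"
        using h k l \<sigma>c by (intro \<kappa>z) auto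
      also have "\<kappa> h (k \<otimes>\<^bsub>H\<^esub> l) \<otimes> (\<kappa> k l \<otimes> \<sigma> h \<otimes> (\<sigma> k \<otimes> \<sigma> l)) =
          \<kappa> h (k \<otimes>\<^bsub>H\<^esub> l) \<otimes> \<kappa> k l \<otimes> ?s"
        using h k l \<sigma>c \<kappa>c by (simp add: \<Gamma>.m_assoc)
      also have "\<kappa> h (k \<otimes>\<^bsub>H\<^esub> l) \<otimes> \<kappa> k l = \<kappa> k l \<otimes> \<kappa> h (k \<otimes>\<^bsub>H\<^esub> l)"
        using h k l \<kappa>c by (intro \<kappa>z) auto
      finally have "\<kappa> k l \<otimes> \<kappa> h (k \<otimes>\<^bsub>H\<^esub> l) \<otimes> ?s = \<kappa> (h \<otimes>\<^bsub>H\<^esub> k) l \<otimes> \<kappa> h k \<otimes> ?s"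
        using 1 h k l by (simp add: H.m_assoc)
      then show ?thesis
        using h k l \<sigma>c \<kappa>c by simp
    qed
    define \<beta> where "\<beta> g = \<phi> g \<otimes> inv \<sigma> (f g)" for g
    have \<beta>K: "\<beta> g \<in> carrier K" if "g \<in> carrier G" for g
      using that in\<phi>[of g] \<sigma>[OF inf[OF that]] \<psi>f[of g] by (simp add: \<beta>_def carrier_K)
    have \<phi>\<beta>: "\<phi> g = \<beta> g \<otimes> \<sigma> (f g)" if "g \<in> carrier G" for g
      using that in\<phi>[of g] \<sigma>[OF inf[OF that]] by (simp add: \<beta>_def \<Gamma>.m_assoc)
    have coboundary: "\<beta> g \<otimes> \<beta> g' = \<beta> (g \<otimes>\<^bsub>G\<^esub> g') \<otimes> \<kappa> (f g) (f g')"
      if g: "g \<in> carrier G" and g': "g' \<in> carrier G" for g g'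
    proof -
      note c = \<sigma>(1)[OF inf[OF g]] \<sigma>(1)[OF inf[OF g']] \<beta>K[OF g] \<beta>K[OF g'] \<beta>K[OF G.m_closed[OF g g']]
        \<kappa>c[OF inf[OF g] inf[OF g']]
      let ?s = "\<sigma> (f g) \<otimes> \<sigma> (f g')"
      have "\<phi> (g \<otimes>\<^bsub>G\<^esub> g') = \<beta> g \<otimes> (\<sigma> (f g) \<otimes> \<beta> g' \<otimes> \<sigma> (f g'))"
        unfolding hom_mult[OF \<phi> g g'] \<phi>\<beta>[OF g] \<phi>\<beta>[OF g'] using c by (simp add: \<Gamma>.m_assoc carrier_K)
      also have "\<sigma> (f g) \<otimes> \<beta> g' = \<beta> g' \<otimes> \<sigma> (f g)"
        using c central[of "\<beta> g'" "\<sigma> (f g)"] by (simp add: carrier_K)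
      finally have "\<phi> (g \<otimes>\<^bsub>G\<^esub> g') = \<beta> g \<otimes> \<beta> g' \<otimes> ?s"
        using c by (simp add: \<Gamma>.m_assoc carrier_K)
      moreover have "\<phi> (g \<otimes>\<^bsub>G\<^esub> g') = \<beta> (g \<otimes>\<^bsub>G\<^esub> g') \<otimes> \<kappa> (f g) (f g') \<otimes> ?s"
        using \<phi>\<beta>[of "g \<otimes>\<^bsub>G\<^esub> g'"] g g' c by (simp add: hom_mult[OF hom] \<sigma>mult inf \<Gamma>.m_assoc carrier_K)
      ultimately show ?thesis
        using c by (simp add: carrier_K)
    qed
    obtain c where c: "c \<in> hom (bar_chains 2 H) K"
      and cof': "\<And>xs. length xs = 2 \<Longrightarrow> set xs \<subseteq> carrier H \<Longrightarrow> c (frag_of xs) = \<kappa> (xs ! 0) (xs ! 1)"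
      by (rule hom_bar_chains_of[OF K, of 2 H "\<lambda>xs. \<kappa> (xs ! 0) (xs ! 1)"]) (auto simp: length_2_iff \<kappa>K)
    obtain b where b: "b \<in> hom (bar_chains 1 G) K"
      and bof': "\<And>xs. length xs = 1 \<Longrightarrow> set xs \<subseteq> carrier G \<Longrightarrow> b (frag_of xs) = \<beta> (hd xs)"
      by (rule hom_bar_chains_of[OF K, of 1 G "\<lambda>xs. \<beta> (hd xs)"]) (auto simp: length_1_iff \<beta>K)
    have cof: "c (frag_of [h, k]) = \<kappa> h k" if "h \<in> carrier H" "k \<in> carrier H" for h k
      using cof'[of "[h, k]"] that by simp
    have bof: "b (frag_of [g]) = \<beta> g" if "g \<in> carrier G" for g
      using bof'[of "[g]"] that by simp
    note cdiff = hom_bar_chains_diff[OF c K.is_group] and bdiff = hom_bar_chains_diff[OF b K.is_group]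
    have c0: "c (bar_boundary H w) = \<one>\<^bsub>K\<^esub>" if "w \<in> chains 3 H" for w
      using that
    proof (induction rule: bar_chains_induct)
      case (of xs)
      then obtain h k l where xs: "xs = [h, k, l]" and h: "h \<in> carrier H" and k: "k \<in> carrier H" and l: "l \<in> carrier H"
        by (auto simp: length_3_iff)
      have "bar_boundary H (frag_of xs) = (frag_of [k, l] + frag_of [h, k \<otimes>\<^bsub>H\<^esub> l]) -
          (frag_of [h \<otimes>\<^bsub>H\<^esub> k, l] + frag_of [h, k])"
        by (simp add: xs bar_boundary_of3)
      then have "c (bar_boundary H (frag_of xs)) = (\<kappa> k l \<otimes>\<^bsub>K\<^esub> \<kappa> h (k \<otimes>\<^bsub>H\<^esub> l)) \<otimes>\<^bsub>K\<^esub>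
          inv\<^bsub>K\<^esub> (\<kappa> (h \<otimes>\<^bsub>H\<^esub> k) l \<otimes>\<^bsub>K\<^esub> \<kappa> h k)"
        using h k l by (simp add: cdiff bar_chains_add hom_bar_chains_add[OF c] cof del: mult_K)
      also have "\<dots> = \<one>\<^bsub>K\<^esub>"
        using h k l cocycle[OF h k l] K.r_inv[of "\<kappa> (h \<otimes>\<^bsub>H\<^esub> k) l \<otimes>\<^bsub>K\<^esub> \<kappa> h k"] K.m_closed[OF \<kappa>K \<kappa>K, of "h \<otimes>\<^bsub>H\<^esub> k" l h k]
        by simp
      finally show ?case .
    qed (simp_all add: hom_bar_chains_zero[OF c K.is_group] bar_boundary_diff cdiff
        bar_boundary_chains3[OF H.is_group] del: one_K mult_K)
    have bc: "b (bar_boundary G x) = c (bar_map f x)" if "x \<in> chains 2 G" for x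
      using that
    proof (induction rule: bar_chains_induct)
      case zero
      show ?case
        by (simp add: hom_bar_chains_zero[OF c K.is_group] hom_bar_chains_zero[OF b K.is_group])
    next
      case (of xs)
      then obtain g g' where xs: "xs = [g, g']" and g: "g \<in> carrier G" and g': "g' \<in> carrier G"
        by (auto simp: length_2_iff)
      have "bar_boundary G (frag_of xs) = (frag_of [g] + frag_of [g']) - frag_of [g \<otimes>\<^bsub>G\<^esub> g']"
        by (simp add: xs bar_boundary_of2)
      then have "b (bar_boundary G (frag_of xs)) = (\<beta> g \<otimes>\<^bsub>K\<^esub> \<beta> g') \<otimes>\<^bsub>K\<^esub> inv\<^bsub>K\<^esub> \<beta> (g \<otimes>\<^bsub>G\<^esub> g')"
        using g g' by (simp add: bdiff bar_chains_add hom_bar_chains_add[OF b] bof del: mult_K)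
      also have "\<beta> g \<otimes>\<^bsub>K\<^esub> \<beta> g' = \<kappa> (f g) (f g') \<otimes>\<^bsub>K\<^esub> \<beta> (g \<otimes>\<^bsub>G\<^esub> g')"
        using coboundary[OF g g'] K.m_comm[OF \<kappa>K \<beta>K, of "f g" "f g'" "g \<otimes>\<^bsub>G\<^esub> g'"] g g' inf by simp
      also have "\<dots> \<otimes>\<^bsub>K\<^esub> inv\<^bsub>K\<^esub> \<beta> (g \<otimes>\<^bsub>G\<^esub> g') = \<kappa> (f g) (f g')"
        using g g' \<beta>K \<kappa>K inf by (simp add: K.m_assoc del: mult_K one_K)
      finally show ?case
        using g g' inf by (simp add: xs cof)
    next
      case (diff x y)
      then show ?case
        by (simp add: bar_boundary_diff bar_map_diff cdiff bdiff bar_boundary_chains2[OF G.is_group] bar_map_chains[OF hom])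
    qed
    obtain \<gamma> where \<gamma>: "\<gamma> \<in> hom (bar_chains 1 H) K"
      and \<gamma>c: "\<And>y. y \<in> chains 2 H \<Longrightarrow> \<gamma> (bar_boundary H y) = c y"
      and \<gamma>b: "\<And>x. x \<in> chains 1 G \<Longrightarrow> \<gamma> (bar_map f x) = b x"
      using cochain_extension[OF f K b c c0 bc] by blast
    have \<gamma>K: "\<gamma> (frag_of [h]) \<in> carrier K" if "h \<in> carrier H" for h
      using that by (intro hom_in_carrier[OF \<gamma>]) simp
    have \<gamma>mult: "\<gamma> (frag_of [h]) \<otimes> \<gamma> (frag_of [k]) = \<gamma> (frag_of [h \<otimes>\<^bsub>H\<^esub> k]) \<otimes> \<kappa> h k"
      if h: "h \<in> carrier H" and k: "k \<in> carrier H" for h k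
    proof -
      have "frag_of [h] + frag_of [k] = frag_of [h \<otimes>\<^bsub>H\<^esub> k] + bar_boundary H (frag_of [h, k])"
        by (simp add: bar_boundary_of2)
      then have "\<gamma> (frag_of [h] + frag_of [k]) = \<gamma> (frag_of [h \<otimes>\<^bsub>H\<^esub> k] + bar_boundary H (frag_of [h, k]))"
        by simp
      then show ?thesis
        using h k by (simp add: hom_bar_chains_add[OF \<gamma>] bar_boundary_chains2[OF H.is_group] \<gamma>c cof)
    qed
    show "\<exists>\<psi> \<in> hom H \<Gamma>. \<forall>g \<in> carrier G. \<psi> (f g) = \<phi> g"
    proof (intro bexI[of _ "\<lambda>h. \<gamma> (frag_of [h]) \<otimes> \<sigma> h"] ballI homI)
      fix g assume g: "g \<in> carrier G"
      then show "\<gamma> (frag_of [f g]) \<otimes> \<sigma> (f g) = \<phi> g"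
        using \<gamma>b[of "frag_of [g]"] by (simp add: bof \<phi>\<beta>)
    next
      fix h assume "h \<in> carrier H"
      then show "\<gamma> (frag_of [h]) \<otimes> \<sigma> h \<in> carrier \<Gamma>"
        using \<gamma>K \<sigma> by (simp add: carrier_K)
    next
      fix h k assume h: "h \<in> carrier H" and k: "k \<in> carrier H"
      note cc = \<gamma>K[OF h] \<gamma>K[OF k] \<gamma>K[OF H.m_closed[OF h k]] \<sigma>(1)[OF h] \<sigma>(1)[OF k] \<kappa>c[OF h k]
      have "\<gamma> (frag_of [h \<otimes>\<^bsub>H\<^esub> k]) \<otimes> \<sigma> (h \<otimes>\<^bsub>H\<^esub> k) =
          \<gamma> (frag_of [h \<otimes>\<^bsub>H\<^esub> k]) \<otimes> \<kappa> h k \<otimes> (\<sigma> h \<otimes> \<sigma> k)"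
        using cc by (simp add: \<sigma>mult h k \<Gamma>.m_assoc carrier_K)
      also have "\<dots> = \<gamma> (frag_of [h]) \<otimes> (\<gamma> (frag_of [k]) \<otimes> \<sigma> h) \<otimes> \<sigma> k"
        using cc by (simp add: \<gamma>mult[OF h k, symmetric] \<Gamma>.m_assoc carrier_K)
      also have "\<gamma> (frag_of [k]) \<otimes> \<sigma> h = \<sigma> h \<otimes> \<gamma> (frag_of [k])"
        using cc by (intro central) (auto simp: carrier_K)
      finally show "\<gamma> (frag_of [h \<otimes>\<^bsub>H\<^esub> k]) \<otimes> \<sigma> (h \<otimes>\<^bsub>H\<^esub> k) =
          \<gamma> (frag_of [h]) \<otimes> \<sigma> h \<otimes> (\<gamma> (frag_of [k]) \<otimes> \<sigma> k)"
        using cc by (simp add: \<Gamma>.m_assoc carrier_K)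
    qed
  qed
qed

text \<open>The extensions to the levels \<open>Q n\<close> fit together because each of them is unique.\<close>

lemma HZ_local_inverse_limit:
  fixes \<Gamma> :: "'c monoid" and Q :: "nat \<Rightarrow> 'q monoid"
  assumes \<Gamma>: "group \<Gamma>" and loc: "\<And>n. HZ_local TYPE('g) TYPE('h) (Q n)"
    and p: "\<And>n. p n \<in> hom \<Gamma> (Q n)" and q: "\<And>n. q n \<in> hom (Q (Suc n)) (Q n)"
    and qp: "\<And>n x. x \<in> carrier \<Gamma> \<Longrightarrow> q n (p (Suc n) x) = p n x"
    and lim: "\<And>y. (\<And>n. y n \<in> carrier (Q n)) \<Longrightarrow> (\<And>n. q n (y (Suc n)) = y n) \<Longrightarrow>
        \<exists>x \<in> carrier \<Gamma>. \<forall>n. p n x = y n"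
    and inj: "\<And>x y. x \<in> carrier \<Gamma> \<Longrightarrow> y \<in> carrier \<Gamma> \<Longrightarrow> (\<And>n. p n x = p n y) \<Longrightarrow> x = y"
  shows "HZ_local TYPE('g) TYPE('h) \<Gamma>"
proof (rule HZ_localI[OF \<Gamma>])
  interpret \<Gamma>: group \<Gamma> by fact
  fix G :: "'g monoid" and H :: "'h monoid" and f \<psi> \<psi>' h
  assume f: "HZ_map G H f" and \<psi>: "\<psi> \<in> hom H \<Gamma>" and \<psi>': "\<psi>' \<in> hom H \<Gamma>"
    and eq: "\<And>g. g \<in> carrier G \<Longrightarrow> \<psi> (f g) = \<psi>' (f g)" and h: "h \<in> carrier H"
  interpret H: group H by (rule HZ_mapD(2)[OF f])
  have "(p n \<circ> \<psi>) h = (p n \<circ> \<psi>') h" for n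
    by (rule HZ_local_unique[OF loc f hom_compose[OF \<psi> p] hom_compose[OF \<psi>' p] _ h]) (simp add: eq)
  then show "\<psi> h = \<psi>' h"
    using hom_in_carrier[OF \<psi> h] hom_in_carrier[OF \<psi>' h] by (intro inj) auto
next
  interpret \<Gamma>: group \<Gamma> by fact
  fix G :: "'g monoid" and H :: "'h monoid" and f \<phi>
  assume f: "HZ_map G H f" and \<phi>: "\<phi> \<in> hom G \<Gamma>"
  interpret G: group G by (rule HZ_mapD(1)[OF f])
  interpret H: group H by (rule HZ_mapD(2)[OF f])
  have "\<forall>n. \<exists>\<psi>. \<psi> \<in> hom H (Q n) \<and> (\<forall>g \<in> carrier G. \<psi> (f g) = p n (\<phi> g))"
    using HZ_local_extend[OF loc f hom_compose[OF \<phi> p]] by fastforce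
  then obtain \<psi> where \<psi>: "\<And>n. \<psi> n \<in> hom H (Q n)" and \<psi>f: "\<And>n g. g \<in> carrier G \<Longrightarrow> \<psi> n (f g) = p n (\<phi> g)"
    by metis
  have q\<psi>: "q n (\<psi> (Suc n) h) = \<psi> n h" if h: "h \<in> carrier H" for n h
  proof -
    have "(q n \<circ> \<psi> (Suc n)) h = \<psi> n h"
      by (rule HZ_local_unique[OF loc f hom_compose[OF \<psi> q] \<psi> _ h])
        (simp add: \<psi>f qp hom_in_carrier[OF \<phi>])
    then show ?thesis by simp
  qed
  define \<Psi> where "\<Psi> h = (SOME x. x \<in> carrier \<Gamma> \<and> (\<forall>n. p n x = \<psi> n h))" for h
  have \<Psi>: "\<Psi> h \<in> carrier \<Gamma>" "p n (\<Psi> h) = \<psi> n h" if h: "h \<in> carrier H" for h n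
  proof -
    have "\<exists>x \<in> carrier \<Gamma>. \<forall>n. p n x = \<psi> n h"
      by (rule lim) (use h hom_in_carrier[OF \<psi>] q\<psi> in auto)
    then have "\<exists>x. x \<in> carrier \<Gamma> \<and> (\<forall>n. p n x = \<psi> n h)" by blast
    from someI_ex[OF this] show "\<Psi> h \<in> carrier \<Gamma>" "p n (\<Psi> h) = \<psi> n h"
      unfolding \<Psi>_def by blast+
  qed
  show "\<exists>\<psi> \<in> hom H \<Gamma>. \<forall>g \<in> carrier G. \<psi> (f g) = \<phi> g"
  proof (intro bexI[of _ \<Psi>] ballI homI)
    fix g assume "g \<in> carrier G"
    then show "\<Psi> (f g) = \<phi> g"
      using hom_in_carrier[OF HZ_mapD(3)[OF f]] hom_in_carrier[OF \<phi>] by (intro inj) (auto simp: \<Psi> \<psi>f)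
  next
    fix h k assume "h \<in> carrier H" "k \<in> carrier H"
    then show "\<Psi> (h \<otimes>\<^bsub>H\<^esub> k) = \<Psi> h \<otimes>\<^bsub>\<Gamma>\<^esub> \<Psi> k"
      using \<Psi> hom_mult[OF \<psi>] hom_mult[OF p] by (intro inj) auto
  qed (use \<Psi> in auto)
qed

text \<open>An abelian group is a central extension of the trivial group.\<close>

lemma HZ_local_comm_group:
  fixes A :: "'a monoid"
  assumes "comm_group A"
  shows "HZ_local TYPE('g) TYPE('h) A"
proof -
  interpret comm_group A by fact
  let ?T = "A\<lparr>carrier := {\<one>\<^bsub>A\<^esub>}\<rparr>"
  have T: "group ?T"
    by (rule subgroup.subgroup_is_group[OF triv_subgroup is_group])
  show ?thesis
  proof (rule HZ_local_central_extension[OF is_group _ _ _ HZ_local_trivial[OF T]])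
    show "(\<lambda>_. \<one>\<^bsub>A\<^esub>) \<in> hom A ?T"
      by (simp add: hom_def)
    show "(\<lambda>_. \<one>\<^bsub>A\<^esub>) ` carrier A = carrier ?T"
      using one_closed by auto
    show "carrier ?T = {\<one>\<^bsub>?T\<^esub>}"
      by simp
    show "k \<otimes>\<^bsub>A\<^esub> x = x \<otimes>\<^bsub>A\<^esub> k" if "k \<in> carrier A" "x \<in> carrier A" for k x
      using that by (rule m_comm)
  qed
qed

text \<open>An isomorphism is a central extension with trivial kernel.\<close>

lemma HZ_local_iso:
  assumes loc: "HZ_local TYPE('g) TYPE('h) \<Gamma>" and M: "group M" and r: "r \<in> iso M \<Gamma>"
  shows "HZ_local TYPE('g) TYPE('h) M"
proof (rule HZ_local_central_extension[OF M _ _ _ loc])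
  interpret M: group M by fact
  interpret \<Gamma>: group \<Gamma> by (rule HZ_local_group[OF loc])
  show r': "r \<in> hom M \<Gamma>" and "r ` carrier M = carrier \<Gamma>"
    using r by (auto simp: iso_def bij_betw_def)
  fix k x assume "k \<in> carrier M" "r k = \<one>\<^bsub>\<Gamma>\<^esub>" "x \<in> carrier M"
  moreover have "r \<one>\<^bsub>M\<^esub> = \<one>\<^bsub>\<Gamma>\<^esub>"
    by (rule hom_one[OF r' M \<Gamma>.is_group])
  ultimately have "k = \<one>\<^bsub>M\<^esub>"
    using r by (auto simp: iso_def bij_betw_def intro: inj_onD[of r "carrier M"])
  then show "k \<otimes>\<^bsub>M\<^esub> x = x \<otimes>\<^bsub>M\<^esub> k"
    using \<open>x \<in> carrier M\<close> by simp
qed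

lemma HZ_map_iso:
  assumes f: "HZ_map G E f" and M: "group M" and r: "r \<in> iso E M"
  shows "HZ_map G M (r \<circ> f)"
proof -
  note G = HZ_mapD(1)[OF f] and E = HZ_mapD(2)[OF f] and hom = HZ_mapD(3)[OF f]
  have r': "r \<in> hom E M" using r by (simp add: iso_def)
  define s where "s = inv_into (carrier E) r"
  have s': "s \<in> hom M E"
    unfolding s_def using group.iso_set_sym[OF E r] by (simp add: iso_def)
  have rs: "r (s x) = x" if "x \<in> carrier M" for x
    unfolding s_def using r that by (simp add: iso_def bij_betw_inv_into_right[of r "carrier E" "carrier M"])
  have sr: "s (r x) = x" if "x \<in> carrier E" for x
    unfolding s_def using r that by (simp add: iso_def bij_betw_inv_into_left[of r "carrier E" "carrier M"])
  have comp: "bar_map (r \<circ> f) x = bar_map r (bar_map f x)" for x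
    using subset_UNIV by (induction x rule: frag_induction) (simp_all add: bar_map_diff comp_def)
  have brs: "bar_map r (bar_map s x) = x" if "x \<in> chains n M" for x n
    using that by (induction rule: bar_chains_induct) (auto simp: bar_map_diff rs subset_iff frag_of_eq intro!: map_idI)
  have bsr: "bar_map s (bar_map r x) = x" if "x \<in> chains n E" for x n
    using that by (induction rule: bar_chains_induct) (auto simp: bar_map_diff sr subset_iff frag_of_eq intro!: map_idI)
  show ?thesis
  proof (rule HZ_mapI[OF G M hom_compose[OF hom r']])
    fix z assume z: "z \<in> chains 1 M"
    then obtain x y where x: "x \<in> chains 1 G" and y: "y \<in> chains 2 E"
      and e: "bar_map s z = bar_map f x + bar_boundary E y"
      using HZ_mapD(4)[OF f bar_map_chains[OF s' z]] by blast
    have "z = bar_map (r \<circ> f) x + bar_boundary M (bar_map r y)"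
      using arg_cong[OF e, of "bar_map r"] brs[OF z] y
      by (simp add: bar_map_add comp bar_map_boundary2[OF r'])
    then show "\<exists>x\<in>chains 1 G. \<exists>y\<in>chains 2 M. z = bar_map (r \<circ> f) x + bar_boundary M y"
      using x bar_map_chains[OF r' y] by blast
  next
    fix x y assume x: "x \<in> chains 1 G" and y: "y \<in> chains 2 M"
      and e: "bar_map (r \<circ> f) x = bar_boundary M y"
    have "bar_map f x = bar_boundary E (bar_map s y)"
      using arg_cong[OF e, of "bar_map s"] bsr[OF bar_map_chains[OF hom x]] y
      by (simp add: comp bar_map_boundary2[OF s'])
    then show "\<exists>x'\<in>chains 2 G. x = bar_boundary G x'"
      using HZ_mapD(5)[OF f x bar_map_chains[OF s' y]] by blast
  next
    fix z assume z: "z \<in> chains 2 M" and z0: "bar_boundary M z = 0"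
    have "bar_boundary E (bar_map s z) = 0"
      using bar_map_boundary2[OF s' z] z0 by simp
    then obtain x y where x: "x \<in> chains 2 G" "bar_boundary G x = 0" and y: "y \<in> chains 3 E"
      and e: "bar_map s z = bar_map f x + bar_boundary E y"
      using HZ_mapD(6)[OF f bar_map_chains[OF s' z]] by blast
    have "z = bar_map (r \<circ> f) x + bar_boundary M (bar_map r y)"
      using arg_cong[OF e, of "bar_map r"] brs[OF z] y
      by (simp add: bar_map_add comp bar_map_boundary3[OF r'])
    then show "\<exists>x\<in>chains 2 G. \<exists>y\<in>chains 3 M.
        bar_boundary G x = 0 \<and> z = bar_map (r \<circ> f) x + bar_boundary M y"
      using x bar_map_chains[OF r' y] by blast
  qed
qed

lemma HZ_localization_iso:
  assumes "HZ_localization TYPE('g) TYPE('h) G \<eta> E" and M: "group M" and r: "r \<in> iso E M"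
  shows "HZ_localization TYPE('g) TYPE('h) G (r \<circ> \<eta>) M"
proof -
  have f: "HZ_map G E \<eta>" and loc: "HZ_local TYPE('g) TYPE('h) E"
    using assms(1) by (auto simp: HZ_localization_def)
  have "inv_into (carrier E) r \<in> iso M E"
    by (rule group.iso_set_sym[OF HZ_mapD(2)[OF f] r])
  then show ?thesis
    unfolding HZ_localization_def using HZ_map_iso[OF f M r] HZ_local_iso[OF loc M] by blast
qed

(* Products of cosets are computed on representatives, not as products of sets. *)
declare mult_FactGroup [simp del] one_FactGroup [simp del]

section \<open>A criterion for the vanishing of the second homology\<close>

lemma (in normal) mult_coset_Mod:
  "x \<in> carrier G \<Longrightarrow> y \<in> carrier G \<Longrightarrow> (H #> x) \<otimes>\<^bsub>G Mod H\<^esub> (H #> y) = H #> (x \<otimes> y)"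
  by (simp add: FactGroup_def rcos_sum)

lemma (in normal) coset_in_Mod: "x \<in> carrier G \<Longrightarrow> H #> x \<in> carrier (G Mod H)"
  by (auto simp: FactGroup_def RCOSETS_def)

lemma (in normal) in_Mod_coset:
  "A \<in> carrier (G Mod H) \<Longrightarrow> \<exists>x \<in> carrier G. A = H #> x"
  by (auto simp: FactGroup_def RCOSETS_def)

lemma (in normal) coset_eq_iff:
  assumes "x \<in> carrier G" "y \<in> carrier G"
  shows "H #> x = H #> y \<longleftrightarrow> x \<otimes> inv y \<in> H"
proof
  assume "H #> x = H #> y"
  then have "x \<in> H #> y"
    using rcos_self[OF assms(1) subgroup_axioms] by simp
  then show "x \<otimes> inv y \<in> H"
    using rcos_module[OF is_group assms(2,1)] by simp
next
  assume "x \<otimes> inv y \<in> H"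
  then have "x \<in> H #> y"
    using rcos_module[OF is_group assms(2,1)] by simp
  then show "H #> x = H #> y"
    using repr_independence[OF _ assms(2) subgroup_axioms] by simp
qed

lemma (in normal) coset_one_iff: "x \<in> carrier G \<Longrightarrow> H #> x = H \<longleftrightarrow> x \<in> H"
  using coset_join1[OF _ _ subgroup_axioms] coset_join2[OF _ subgroup_axioms] by blast

lemma (in group) normal_comm_quotient:
  assumes S: "subgroup S G" and comm: "\<And>x y. x \<in> carrier G \<Longrightarrow> y \<in> carrier G \<Longrightarrow> x \<otimes> y \<otimes> inv x \<otimes> inv y \<in> S"
  shows "S \<lhd> G" "comm_group (G Mod S)"
proof -
  show N: "S \<lhd> G"
  proof (rule normal_invI[OF S])
    fix x h assume "x \<in> carrier G" "h \<in> S"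
    moreover have "h \<in> carrier G"
      using S \<open>h \<in> S\<close> by (rule subgroup.mem_carrier)
    ultimately have "x \<otimes> h \<otimes> inv x = (x \<otimes> h \<otimes> inv x \<otimes> inv h) \<otimes> h"
      by (simp add: m_assoc)
    then show "x \<otimes> h \<otimes> inv x \<in> S"
      using subgroup.m_closed[OF S comm[OF \<open>x \<in> carrier G\<close> \<open>h \<in> carrier G\<close>] \<open>h \<in> S\<close>] by metis
  qed
  interpret N: normal S G by fact
  show "comm_group (G Mod S)"
  proof (rule group.group_comm_groupI[OF N.factorgroup_is_group])
    fix A B assume "A \<in> carrier (G Mod S)" "B \<in> carrier (G Mod S)"
    then obtain x y where x: "x \<in> carrier G" "A = S #> x" and y: "y \<in> carrier G" "B = S #> y"
      using N.in_Mod_coset by metis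
    then show "A \<otimes>\<^bsub>G Mod S\<^esub> B = B \<otimes>\<^bsub>G Mod S\<^esub> A"
      using comm[of x y] by (simp add: N.mult_coset_Mod N.coset_eq_iff inv_mult_group m_assoc)
  qed
qed

text \<open>It suffices to normalize the value at the unit: the cocycle identity then gives
  \<open>w(1, a) = w(a, 1) = 1\<close>.\<close>

locale normalized_cocycle =
  A: comm_group A + Q: group Q for A :: "'a monoid" and Q :: "'q monoid" +
  fixes w :: "'q \<Rightarrow> 'q \<Rightarrow> 'a"
  assumes w_closed [simp]: "a \<in> carrier Q \<Longrightarrow> b \<in> carrier Q \<Longrightarrow> w a b \<in> carrier A"
    and w_one: "w \<one>\<^bsub>Q\<^esub> \<one>\<^bsub>Q\<^esub> = \<one>\<^bsub>A\<^esub>"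
    and w_cocycle: "a \<in> carrier Q \<Longrightarrow> b \<in> carrier Q \<Longrightarrow> c \<in> carrier Q \<Longrightarrow>
      w a b \<otimes>\<^bsub>A\<^esub> w (a \<otimes>\<^bsub>Q\<^esub> b) c = w b c \<otimes>\<^bsub>A\<^esub> w a (b \<otimes>\<^bsub>Q\<^esub> c)"
begin

lemma w_left_one [simp]: "a \<in> carrier Q \<Longrightarrow> w \<one>\<^bsub>Q\<^esub> a = \<one>\<^bsub>A\<^esub>"
  using w_cocycle[of "\<one>\<^bsub>Q\<^esub>" "\<one>\<^bsub>Q\<^esub>" a] by (simp add: w_one)

lemma w_right_one [simp]: "a \<in> carrier Q \<Longrightarrow> w a \<one>\<^bsub>Q\<^esub> = \<one>\<^bsub>A\<^esub>"
  using w_cocycle[of a "\<one>\<^bsub>Q\<^esub>" "\<one>\<^bsub>Q\<^esub>"] by (simp add: w_one)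

lemma carrier_ext: "carrier (cocycle_extension A Q w) = carrier A \<times> carrier Q"
  by (simp add: cocycle_extension_def)

lemma mult_ext: "(\<alpha>, a) \<otimes>\<^bsub>cocycle_extension A Q w\<^esub> (\<beta>, b) = (\<alpha> \<otimes>\<^bsub>A\<^esub> \<beta> \<otimes>\<^bsub>A\<^esub> w a b, a \<otimes>\<^bsub>Q\<^esub> b)"
  by (simp add: cocycle_extension_def)

lemma one_ext: "\<one>\<^bsub>cocycle_extension A Q w\<^esub> = (\<one>\<^bsub>A\<^esub>, \<one>\<^bsub>Q\<^esub>)"
  by (simp add: cocycle_extension_def)

lemma group_ext: "group (cocycle_extension A Q w)"
proof (rule groupI)
  fix x y z
  assume x: "x \<in> carrier (cocycle_extension A Q w)" and y: "y \<in> carrier (cocycle_extension A Q w)"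
    and z: "z \<in> carrier (cocycle_extension A Q w)"
  obtain \<alpha> a \<beta> b \<gamma> c where e: "x = (\<alpha>, a)" "y = (\<beta>, b)" "z = (\<gamma>, c)"
    by (cases x, cases y, cases z)
  have cl: "\<alpha> \<in> carrier A" "\<beta> \<in> carrier A" "\<gamma> \<in> carrier A" "a \<in> carrier Q" "b \<in> carrier Q" "c \<in> carrier Q"
    using x y z by (auto simp: e carrier_ext)
  have "\<alpha> \<otimes>\<^bsub>A\<^esub> \<beta> \<otimes>\<^bsub>A\<^esub> w a b \<otimes>\<^bsub>A\<^esub> \<gamma> \<otimes>\<^bsub>A\<^esub> w (a \<otimes>\<^bsub>Q\<^esub> b) c =
      \<alpha> \<otimes>\<^bsub>A\<^esub> \<beta> \<otimes>\<^bsub>A\<^esub> \<gamma> \<otimes>\<^bsub>A\<^esub> (w a b \<otimes>\<^bsub>A\<^esub> w (a \<otimes>\<^bsub>Q\<^esub> b) c)"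
    using cl by (simp add: A.m_ac)
  also have "\<dots> = \<alpha> \<otimes>\<^bsub>A\<^esub> (\<beta> \<otimes>\<^bsub>A\<^esub> \<gamma> \<otimes>\<^bsub>A\<^esub> w b c) \<otimes>\<^bsub>A\<^esub> w a (b \<otimes>\<^bsub>Q\<^esub> c)"
    unfolding w_cocycle[OF cl(4,5,6)] using cl by (simp add: A.m_ac)
  finally show "x \<otimes>\<^bsub>cocycle_extension A Q w\<^esub> y \<otimes>\<^bsub>cocycle_extension A Q w\<^esub> z =
      x \<otimes>\<^bsub>cocycle_extension A Q w\<^esub> (y \<otimes>\<^bsub>cocycle_extension A Q w\<^esub> z)"
    using cl by (simp add: e mult_ext Q.m_assoc)
next
  fix x assume x: "x \<in> carrier (cocycle_extension A Q w)"
  obtain \<alpha> a where e: "x = (\<alpha>, a)" by (cases x)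
  have cl: "\<alpha> \<in> carrier A" "a \<in> carrier Q"
    using x by (auto simp: e carrier_ext)
  show "\<exists>y\<in>carrier (cocycle_extension A Q w). y \<otimes>\<^bsub>cocycle_extension A Q w\<^esub> x = \<one>\<^bsub>cocycle_extension A Q w\<^esub>"
    using cl by (intro bexI[of _ "(inv\<^bsub>A\<^esub> (\<alpha> \<otimes>\<^bsub>A\<^esub> w (inv\<^bsub>Q\<^esub> a) a), inv\<^bsub>Q\<^esub> a)"])
      (simp_all add: e mult_ext one_ext carrier_ext A.m_assoc)
qed (auto simp: carrier_ext mult_ext one_ext)

lemma snd_ext_hom: "snd \<in> hom (cocycle_extension A Q w) Q"
  by (auto simp: hom_def carrier_ext mult_ext)

end

lemma bar_boundaries_normal:
  assumes "bar_boundaries n G \<subseteq> chains n G"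
  shows "bar_boundaries n G \<lhd> bar_chains n G"
proof -
  let ?B = "bar_boundaries n G"
  interpret C: comm_group "bar_chains n G" by (rule comm_group_bar_chains)
  have "subgroup ?B (bar_chains n G)"
  proof (rule C.subgroupI)
    show "inv\<^bsub>bar_chains n G\<^esub> b \<in> ?B" if "b \<in> ?B" for b
      using that additive_subgroup_minus[OF additive_subgroup_boundaries that] inv_bar_chains[of b n G] assms by auto
    show "?B \<noteq> {}"
      using additive_subgroup_boundaries[of n G] unfolding additive_subgroup_def by blast
  qed (simp_all add: assms additive_subgroup_add[OF additive_subgroup_boundaries])
  then show ?thesis
    by (simp add: C.normal_iff_subgroup)
qed

text \<open>The symbols \<open>[g|h]\<close> form a 2-cocycle with values in the 2-chains modulo boundaries; let \<open>Y\<close> be the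
  central extension that it defines. In the abelian quotient of \<open>Y\<close> by \<open>S\<close>, the standard lifts satisfy
  \<open>s(g) s(h) = [g|h] s(g h)\<close>. Hence the map from 2-chains to this quotient factors through the
  boundary map, and the class of a cycle is trivial there, i.e. it lies in \<open>S\<close>. As \<open>S\<close> meets the kernel
  trivially, the cycle is a boundary.\<close>

lemma second_homology_vanishes:
  fixes E :: "'e monoid"
  assumes E: "group E"
    and ext: "\<And>(Y :: (('e list \<Rightarrow>\<^sub>0 int) set \<times> 'e) monoid) p.
      group Y \<Longrightarrow> p \<in> hom Y E \<Longrightarrow> p ` carrier Y = carrier E \<Longrightarrow>
      (\<And>k x. k \<in> carrier Y \<Longrightarrow> p k = \<one>\<^bsub>E\<^esub> \<Longrightarrow> x \<in> carrier Y \<Longrightarrow> k \<otimes>\<^bsub>Y\<^esub> x = x \<otimes>\<^bsub>Y\<^esub> k) \<Longrightarrow>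
      \<exists>S. subgroup S Y \<and>
        (\<forall>x \<in> carrier Y. \<forall>y \<in> carrier Y. x \<otimes>\<^bsub>Y\<^esub> y \<otimes>\<^bsub>Y\<^esub> inv\<^bsub>Y\<^esub> x \<otimes>\<^bsub>Y\<^esub> inv\<^bsub>Y\<^esub> y \<in> S) \<and>
        (\<forall>s \<in> S. p s = \<one>\<^bsub>E\<^esub> \<longrightarrow> s = \<one>\<^bsub>Y\<^esub>)"
  shows "bar_cycles 2 E \<subseteq> bar_boundaries 2 E"
proof
  fix z assume z: "z \<in> bar_cycles 2 E"
  interpret E: group E by fact
  let ?C = "bar_chains 2 E" and ?B = "bar_boundaries 2 E"
  interpret C: comm_group ?C by (rule comm_group_bar_chains)
  have N: "?B \<lhd> ?C"
    using bar_boundaries_2_cycles[OF E] by (intro bar_boundaries_normal) (auto simp: bar_cycles_def)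
  interpret N: normal ?B ?C by (rule N)
  define A where "A = ?C Mod ?B"
  have "comm_group A"
    unfolding A_def by (rule C.abelian_FactGroup[OF normal_imp_subgroup[OF N]])
  interpret A: comm_group A by fact
  define cl where "cl x = ?B #>\<^bsub>?C\<^esub> x" for x
  have cl_in [simp]: "cl x \<in> carrier A" if "x \<in> carrier ?C" for x
    unfolding cl_def A_def using that by (rule N.coset_in_Mod)
  have cl_add: "cl (x + y) = cl x \<otimes>\<^bsub>A\<^esub> cl y" if "x \<in> carrier ?C" "y \<in> carrier ?C" for x y
    unfolding cl_def A_def using N.mult_coset_Mod[OF that] by simp
  have cl_one: "cl x = \<one>\<^bsub>A\<^esub> \<longleftrightarrow> x \<in> ?B" if "x \<in> carrier ?C" for x
    unfolding cl_def A_def one_FactGroup using that by (rule N.coset_one_iff)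
  have cl_0 [simp]: "cl 0 = \<one>\<^bsub>A\<^esub>"
    using additive_subgroup_boundaries[of 2 E] by (simp add: cl_one additive_subgroup_def)
  have cl_eq: "cl x = cl y" if "x - y \<in> ?B" "x \<in> carrier ?C" "y \<in> carrier ?C" for x y
    using cl_add[of "x - y" y] that cl_one[of "x - y"] by (simp add: bar_chains_diff)
  \<comment> \<open>\<open>[1|1]\<close> is no boundary, so it is subtracted to normalize the cocycle; the lift of \<open>g\<close> is then
    \<open>(cl e, g)\<close> instead of \<open>(1, g)\<close>.\<close>
  define e where "e = frag_of [\<one>\<^bsub>E\<^esub>, \<one>\<^bsub>E\<^esub>]"
  have e [simp]: "e \<in> carrier ?C"
    by (simp add: e_def)
  have g2 [simp]: "frag_of [g, h] \<in> carrier ?C" if "g \<in> carrier E" "h \<in> carrier E" for g h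
    using that by simp
  define w where "w g h = cl (frag_of [g, h] - e)" for g h
  interpret W: normalized_cocycle A E w
  proof
    fix a b c assume a: "a \<in> carrier E" and b: "b \<in> carrier E" and c: "c \<in> carrier E"
    let ?l = "(frag_of [a, b] - e) + (frag_of [a \<otimes>\<^bsub>E\<^esub> b, c] - e)"
      and ?r = "(frag_of [b, c] - e) + (frag_of [a, b \<otimes>\<^bsub>E\<^esub> c] - e)"
    have lr: "?l \<in> carrier ?C" "?r \<in> carrier ?C"
      using a b c by (auto intro!: bar_chains_add bar_chains_diff)
    have "?l - ?r = bar_boundary E (- frag_of [a, b, c])"
      by (simp add: bar_boundary_minus bar_boundary_of3)
    moreover have "- frag_of [a, b, c] \<in> chains 3 E"
      using a b c by (intro bar_chains_minus) simp
    ultimately have "?l - ?r \<in> ?B"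
      unfolding bar_boundaries_2 by blast
    from cl_eq[OF this lr] show "w a b \<otimes>\<^bsub>A\<^esub> w (a \<otimes>\<^bsub>E\<^esub> b) c = w b c \<otimes>\<^bsub>A\<^esub> w a (b \<otimes>\<^bsub>E\<^esub> c)"
      using a b c by (simp add: w_def cl_add bar_chains_diff)
  qed (simp_all add: w_def e_def[symmetric] bar_chains_diff)
  define Y where "Y = cocycle_extension A E w"
  interpret Y: group Y
    unfolding Y_def by (rule W.group_ext)
  have Y_in: "(\<alpha>, a) \<in> carrier Y \<longleftrightarrow> \<alpha> \<in> carrier A \<and> a \<in> carrier E" for \<alpha> a
    by (simp add: Y_def W.carrier_ext)
  note Y_mult = W.mult_ext[folded Y_def] and Y_one = W.one_ext[folded Y_def]
  have "\<exists>S. subgroup S Y \<and>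
        (\<forall>x \<in> carrier Y. \<forall>y \<in> carrier Y. x \<otimes>\<^bsub>Y\<^esub> y \<otimes>\<^bsub>Y\<^esub> inv\<^bsub>Y\<^esub> x \<otimes>\<^bsub>Y\<^esub> inv\<^bsub>Y\<^esub> y \<in> S) \<and>
        (\<forall>s \<in> S. snd s = \<one>\<^bsub>E\<^esub> \<longrightarrow> s = \<one>\<^bsub>Y\<^esub>)"
  proof (rule ext[OF Y.is_group])
    show "snd \<in> hom Y E"
      unfolding Y_def by (rule W.snd_ext_hom)
    show "snd ` carrier Y = carrier E"
      unfolding Y_def W.carrier_ext by force
    show "k \<otimes>\<^bsub>Y\<^esub> x = x \<otimes>\<^bsub>Y\<^esub> k" if "k \<in> carrier Y" "snd k = \<one>\<^bsub>E\<^esub>" "x \<in> carrier Y" for k x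
      using that by (cases k, cases x) (auto simp: Y_in Y_mult A.m_comm)
  qed
  then obtain S where S: "subgroup S Y"
    and comm: "\<And>x y. x \<in> carrier Y \<Longrightarrow> y \<in> carrier Y \<Longrightarrow> x \<otimes>\<^bsub>Y\<^esub> y \<otimes>\<^bsub>Y\<^esub> inv\<^bsub>Y\<^esub> x \<otimes>\<^bsub>Y\<^esub> inv\<^bsub>Y\<^esub> y \<in> S"
    and triv: "\<And>s. s \<in> S \<Longrightarrow> snd s = \<one>\<^bsub>E\<^esub> \<Longrightarrow> s = \<one>\<^bsub>Y\<^esub>"
    by blast
  interpret S: normal S Y
    by (rule Y.normal_comm_quotient(1)[OF S comm])
  interpret V: comm_group "Y Mod S"
    by (rule Y.normal_comm_quotient(2)[OF S comm])
  let ?V = "Y Mod S" and ?q = "\<lambda>y. S #>\<^bsub>Y\<^esub> y"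
  obtain D where D: "D \<in> hom (bar_chains 1 E) ?V"
    and Dof': "\<And>xs. length xs = 1 \<Longrightarrow> set xs \<subseteq> carrier E \<Longrightarrow> D (frag_of xs) = ?q (cl e, hd xs)"
    by (rule hom_bar_chains_of[OF V.comm_group_axioms, of 1 E "\<lambda>xs. ?q (cl e, hd xs)"])
      (auto simp: length_1_iff Y_in intro!: S.coset_in_Mod)
  have Dof: "D (frag_of [g]) = ?q (cl e, g)" if "g \<in> carrier E" for g
    using Dof'[of "[g]"] that by simp
  have I: "(\<lambda>c. ?q (cl c, \<one>\<^bsub>E\<^esub>)) \<in> hom ?C ?V"
    by (rule homI) (simp_all add: Y_in S.coset_in_Mod S.mult_coset_Mod Y_mult cl_add)
  have DI: "D (bar_boundary E c) = ?q (cl c, \<one>\<^bsub>E\<^esub>)" if "c \<in> carrier ?C" for c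
    using that
  proof (induction rule: bar_chains_induct)
    case zero
    show ?case
      using S.coset_one_iff[of "\<one>\<^bsub>Y\<^esub>"] S.one_closed
      by (simp add: hom_bar_chains_zero[OF D V.is_group] Y_one one_FactGroup)
  next
    case (of xs)
    then obtain g h where xs: "xs = [g, h]" and g: "g \<in> carrier E" and h: "h \<in> carrier E"
      by (auto simp: length_2_iff)
    have gh: "cl (frag_of [g, h]) = cl e \<otimes>\<^bsub>A\<^esub> w g h"
      using cl_add[of e "frag_of [g, h] - e"] g h by (simp add: w_def bar_chains_diff)
    have "D (frag_of [g] + frag_of [h]) = ?q ((cl e, g) \<otimes>\<^bsub>Y\<^esub> (cl e, h))"
      using g h by (simp add: hom_bar_chains_add[OF D] Dof S.mult_coset_Mod Y_in)
    also have "(cl e, g) \<otimes>\<^bsub>Y\<^esub> (cl e, h) = (cl (frag_of [g, h]), \<one>\<^bsub>E\<^esub>) \<otimes>\<^bsub>Y\<^esub> (cl e, g \<otimes>\<^bsub>E\<^esub> h)"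
      using g h by (simp add: Y_mult gh A.m_ac)
    also have "?q \<dots> = ?q (cl (frag_of [g, h]), \<one>\<^bsub>E\<^esub>) \<otimes>\<^bsub>?V\<^esub> D (frag_of [g \<otimes>\<^bsub>E\<^esub> h])"
      using g h by (simp add: Dof S.mult_coset_Mod Y_in)
    finally have *: "D (frag_of [g] + frag_of [h]) = ?q (cl (frag_of [g, h]), \<one>\<^bsub>E\<^esub>) \<otimes>\<^bsub>?V\<^esub> D (frag_of [g \<otimes>\<^bsub>E\<^esub> h])" .
    have "bar_boundary E (frag_of xs) = (frag_of [g] + frag_of [h]) - frag_of [g \<otimes>\<^bsub>E\<^esub> h]"
      by (simp add: xs bar_boundary_of2)
    then have "D (bar_boundary E (frag_of xs)) = D (frag_of [g] + frag_of [h]) \<otimes>\<^bsub>?V\<^esub> inv\<^bsub>?V\<^esub> D (frag_of [g \<otimes>\<^bsub>E\<^esub> h])"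
      using g h by (simp add: hom_bar_chains_diff[OF D V.is_group] bar_chains_add)
    then show ?case
      using g h unfolding * xs
      by (simp add: V.m_assoc hom_in_carrier[OF D] S.coset_in_Mod Y_in)
  next
    case (diff x y)
    then show ?case
      by (simp add: bar_boundary_diff hom_bar_chains_diff[OF D V.is_group] bar_boundary_chains2[OF E]
          hom_bar_chains_diff[OF I V.is_group])
  qed
  have zC: "z \<in> carrier ?C" "bar_boundary E z = 0"
    using z by (auto simp: bar_cycles_def)
  have "?q (cl z, \<one>\<^bsub>E\<^esub>) = S"
    using DI[OF zC(1)] by (simp add: zC hom_bar_chains_zero[OF D V.is_group] one_FactGroup)
  then have "(cl z, \<one>\<^bsub>E\<^esub>) \<in> S"
    using zC by (simp add: S.coset_one_iff Y_in)
  then have "cl z = \<one>\<^bsub>A\<^esub>"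
    using triv[of "(cl z, \<one>\<^bsub>E\<^esub>)"] by (simp add: Y_one)
  then show "z \<in> ?B"
    using zC by (simp add: cl_one)
qed

section \<open>Exterior squares\<close>

locale plain_comm_group = comm_group G for G :: "'a monoid" (structure)
begin

abbreviation "\<Lambda> \<equiv> exterior_square G"

lemma exterior_relations_keys: "exterior_relations G \<subseteq> carrier (free_Abelian_group (carrier G \<times> carrier G))"
proof
  fix x assume "x \<in> exterior_relations G"
  moreover have *: "frag_of p - frag_of q - frag_of r \<in> carrier (free_Abelian_group (carrier G \<times> carrier G))"
    if "p \<in> carrier G \<times> carrier G" "q \<in> carrier G \<times> carrier G" "r \<in> carrier G \<times> carrier G" for p q r
  proof -
    have "Poly_Mapping.keys (frag_of p - frag_of q - frag_of r) \<subseteq> {p, q, r}"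
      using keys_diff[of "frag_of p - frag_of q" "frag_of r"] keys_diff[of "frag_of p" "frag_of q"] by auto
    then show ?thesis using that by auto
  qed
  ultimately show "x \<in> carrier (free_Abelian_group (carrier G \<times> carrier G))"
    unfolding exterior_relations_def
    by (auto simp del: carrier_free_Abelian_group_iff simp add: frag_of_in_free_Abelian_group intro!: *)
qed

lemma exterior_kernel_normal: "exterior_kernel G \<lhd> free_Abelian_group (carrier G \<times> carrier G)"
  unfolding exterior_kernel_def
  using group.generate_is_subgroup[OF group_free_Abelian_group exterior_relations_keys]
  by (simp add: comm_group.normal_iff_subgroup[OF abelian_free_Abelian_group])

lemma comm_group_exterior_square: "comm_group \<Lambda>"
  unfolding exterior_square_def
  by (rule comm_group.abelian_FactGroup[OF abelian_free_Abelian_group normal_imp_subgroup[OF exterior_kernel_normal]])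

sublocale ext: comm_group \<Lambda>
  by (rule comm_group_exterior_square)

lemma wedge_closed [simp]: "a \<in> carrier G \<Longrightarrow> b \<in> carrier G \<Longrightarrow> wedge G a b \<in> carrier \<Lambda>"
  unfolding wedge_def exterior_square_def by (intro normal.coset_in_Mod[OF exterior_kernel_normal]) simp

lemma wedge_relation:
  assumes "frag_of p - frag_of q - frag_of r \<in> exterior_relations G"
    and "p \<in> carrier G \<times> carrier G" "q \<in> carrier G \<times> carrier G" "r \<in> carrier G \<times> carrier G"
  shows "wedge G (fst p) (snd p) = wedge G (fst q) (snd q) \<otimes>\<^bsub>\<Lambda>\<^esub> wedge G (fst r) (snd r)"
proof -
  let ?F = "free_Abelian_group (carrier G \<times> carrier G)"
  have qr: "frag_of q + frag_of r \<in> carrier ?F"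
    using assms group.is_monoid[OF group_free_Abelian_group[of "carrier G \<times> carrier G"]]
      monoid.m_closed[of ?F "frag_of q" "frag_of r"] by simp
  have "frag_of p - frag_of q - frag_of r \<in> exterior_kernel G"
    unfolding exterior_kernel_def by (rule generate.incl[OF assms(1)])
  then have "frag_of p \<otimes>\<^bsub>?F\<^esub> inv\<^bsub>?F\<^esub> (frag_of q + frag_of r) \<in> exterior_kernel G"
    using qr by (simp add: algebra_simps)
  then have "exterior_kernel G #>\<^bsub>?F\<^esub> frag_of p = exterior_kernel G #>\<^bsub>?F\<^esub> (frag_of q + frag_of r)"
    using qr assms(2) by (subst normal.coset_eq_iff[OF exterior_kernel_normal]) simp_all
  then show ?thesis
    using assms normal.mult_coset_Mod[OF exterior_kernel_normal, of "frag_of q" "frag_of r"] by (simp add: wedge_def exterior_square_def)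
qed

lemma wedge_mult_left:
  assumes "a \<in> carrier G" "b \<in> carrier G" "c \<in> carrier G"
  shows "wedge G (a \<otimes> b) c = wedge G a c \<otimes>\<^bsub>\<Lambda>\<^esub> wedge G b c"
  using wedge_relation[of "(a \<otimes> b, c)" "(a, c)" "(b, c)"] assms by (auto simp: exterior_relations_def)

lemma wedge_mult_right:
  assumes "a \<in> carrier G" "b \<in> carrier G" "c \<in> carrier G"
  shows "wedge G a (b \<otimes> c) = wedge G a b \<otimes>\<^bsub>\<Lambda>\<^esub> wedge G a c"
  using wedge_relation[of "(a, b \<otimes> c)" "(a, b)" "(a, c)"] assms by (auto simp: exterior_relations_def)

lemma wedge_self [simp]:
  assumes "a \<in> carrier G"
  shows "wedge G a a = \<one>\<^bsub>\<Lambda>\<^esub>"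
proof -
  have "frag_of (a, a) \<in> exterior_kernel G"
    unfolding exterior_kernel_def using assms by (intro generate.incl) (auto simp: exterior_relations_def)
  then show ?thesis
    using assms by (simp add: wedge_def exterior_square_def one_FactGroup normal.coset_one_iff[OF exterior_kernel_normal])
qed

lemma wedge_one_left [simp]: "c \<in> carrier G \<Longrightarrow> wedge G \<one> c = \<one>\<^bsub>\<Lambda>\<^esub>"
  using wedge_mult_left[of \<one> \<one> c] by simp

lemma wedge_one_right [simp]: "c \<in> carrier G \<Longrightarrow> wedge G c \<one> = \<one>\<^bsub>\<Lambda>\<^esub>"
  using wedge_mult_right[of c \<one> \<one>] by simp

lemma wedge_inv_left: "a \<in> carrier G \<Longrightarrow> c \<in> carrier G \<Longrightarrow> wedge G (inv a) c = inv\<^bsub>\<Lambda>\<^esub> wedge G a c"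
  using wedge_mult_left[of "inv a" a c] by (intro ext.inv_equality[symmetric]) simp_all

lemma wedge_inv_right: "a \<in> carrier G \<Longrightarrow> c \<in> carrier G \<Longrightarrow> wedge G a (inv c) = inv\<^bsub>\<Lambda>\<^esub> wedge G a c"
  using wedge_mult_right[of a "inv c" c] by (intro ext.inv_equality[symmetric]) simp_all

lemma wedge_swap:
  assumes "a \<in> carrier G" "b \<in> carrier G"
  shows "wedge G a b \<otimes>\<^bsub>\<Lambda>\<^esub> wedge G b a = \<one>\<^bsub>\<Lambda>\<^esub>"
proof -
  have "\<one>\<^bsub>\<Lambda>\<^esub> = wedge G (a \<otimes> b) (a \<otimes> b)"
    using assms by simp
  also have "\<dots> = wedge G a b \<otimes>\<^bsub>\<Lambda>\<^esub> wedge G b a"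
    using assms by (simp add: wedge_mult_left wedge_mult_right del: wedge_self)
      (simp add: ext.m_ac)
  finally show ?thesis by simp
qed

text \<open>There is no case for inverses, since the inverse of \<open>a \<and> b\<close> is \<open>a\<^sup>-\<^sup>1 \<and> b\<close>.\<close>

lemma exterior_square_induct [consumes 1, case_names one wedge mult]:
  assumes x: "x \<in> carrier \<Lambda>"
    and 1: "P \<one>\<^bsub>\<Lambda>\<^esub>"
    and w: "\<And>a b. a \<in> carrier G \<Longrightarrow> b \<in> carrier G \<Longrightarrow> P (wedge G a b)"
    and m: "\<And>x y. x \<in> carrier \<Lambda> \<Longrightarrow> y \<in> carrier \<Lambda> \<Longrightarrow> P x \<Longrightarrow> P y \<Longrightarrow> P (x \<otimes>\<^bsub>\<Lambda>\<^esub> y)"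
  shows "P x"
proof -
  let ?F = "free_Abelian_group (carrier G \<times> carrier G)"
  define cl where "cl c = exterior_kernel G #>\<^bsub>?F\<^esub> c" for c
  have clin: "cl c \<in> carrier \<Lambda>" if "Poly_Mapping.keys c \<subseteq> carrier G \<times> carrier G" for c
    unfolding cl_def exterior_square_def using that by (intro normal.coset_in_Mod[OF exterior_kernel_normal]) simp
  have cladd: "cl (c + d) = cl c \<otimes>\<^bsub>\<Lambda>\<^esub> cl d"
    if "Poly_Mapping.keys c \<subseteq> carrier G \<times> carrier G" "Poly_Mapping.keys d \<subseteq> carrier G \<times> carrier G" for c d
    unfolding cl_def exterior_square_def using normal.mult_coset_Mod[OF exterior_kernel_normal, of c d] that by simp
  have cl0: "cl 0 = \<one>\<^bsub>\<Lambda>\<^esub>"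
    using normal.coset_one_iff[OF exterior_kernel_normal, of 0] subgroup.one_closed[OF normal_imp_subgroup[OF exterior_kernel_normal]] by (simp add: cl_def exterior_square_def one_FactGroup)
  have "P (cl c) \<and> P (cl (- c))" if "Poly_Mapping.keys c \<subseteq> carrier G \<times> carrier G" for c
    using that
  proof (induction rule: free_Abelian_group_induct[consumes 1])
    case 1
    show ?case using \<open>P \<one>\<^bsub>\<Lambda>\<^esub>\<close> by (simp add: cl0)
  next
    case (2 c d)
    then show ?case
      using m[OF clin clin, of c "- d"] m[OF clin clin, of "- c" d] by (simp add: cladd[symmetric])
  next
    case (3 p)
    then obtain a b where p: "p = (a, b)" and ab: "a \<in> carrier G" "b \<in> carrier G" by auto
    have c: "cl (frag_of p) = wedge G a b"
      by (simp add: cl_def wedge_def p)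
    have "cl (- frag_of p) = inv\<^bsub>\<Lambda>\<^esub> wedge G a b"
      using cladd[of "- frag_of p" "frag_of p"] clin[of "- frag_of p"] ab
      by (intro ext.inv_equality[symmetric]) (simp_all add: cl0 c, simp_all add: p)
    then show ?case
      using w[of a b] w[of "inv a" b] ab by (simp add: c wedge_inv_left)
  qed
  moreover obtain c where "Poly_Mapping.keys c \<subseteq> carrier G \<times> carrier G" "x = cl c"
    using normal.in_Mod_coset[OF exterior_kernel_normal, of x] x unfolding exterior_square_def cl_def by auto
  ultimately show ?thesis by blast
qed

lemma exterior_square_universal:
  fixes B :: "'b monoid"
  assumes B: "comm_group B"
    and \<beta>: "\<And>a b. a \<in> carrier G \<Longrightarrow> b \<in> carrier G \<Longrightarrow> \<beta> a b \<in> carrier B"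
    and left: "\<And>a b c. a \<in> carrier G \<Longrightarrow> b \<in> carrier G \<Longrightarrow> c \<in> carrier G \<Longrightarrow> \<beta> (a \<otimes> b) c = \<beta> a c \<otimes>\<^bsub>B\<^esub> \<beta> b c"
    and right: "\<And>a b c. a \<in> carrier G \<Longrightarrow> b \<in> carrier G \<Longrightarrow> c \<in> carrier G \<Longrightarrow> \<beta> a (b \<otimes> c) = \<beta> a b \<otimes>\<^bsub>B\<^esub> \<beta> a c"
    and self: "\<And>a. a \<in> carrier G \<Longrightarrow> \<beta> a a = \<one>\<^bsub>B\<^esub>"
  obtains h where "h \<in> hom \<Lambda> B" "\<And>a b. a \<in> carrier G \<Longrightarrow> b \<in> carrier G \<Longrightarrow> h (wedge G a b) = \<beta> a b"
proof -
  interpret B: comm_group B by fact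
  let ?F = "free_Abelian_group (carrier G \<times> carrier G)"
  have "case_prod \<beta> ` (carrier G \<times> carrier G) \<subseteq> carrier B"
    using \<beta> by auto
  from B.free_Abelian_group_universal[OF this] obtain h0 where h0: "h0 \<in> hom ?F B"
    and h0of: "\<And>a b. a \<in> carrier G \<Longrightarrow> b \<in> carrier G \<Longrightarrow> h0 (frag_of (a, b)) = \<beta> a b"
    by (metis SigmaI case_prod_conv)
  interpret h0: group_hom ?F B h0
    using h0 by (simp add: group_hom_def group_hom_axioms_def B.is_group)
  have diff: "h0 (c - d) = h0 c \<otimes>\<^bsub>B\<^esub> inv\<^bsub>B\<^esub> h0 d"
    if "Poly_Mapping.keys c \<subseteq> carrier G \<times> carrier G" "Poly_Mapping.keys d \<subseteq> carrier G \<times> carrier G" for c d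
    using h0.hom_mult[of c "- d"] h0.hom_inv[of d] that by simp
  have 2: "Poly_Mapping.keys (frag_of p - frag_of q) \<subseteq> carrier G \<times> carrier G"
    if "p \<in> carrier G \<times> carrier G" "q \<in> carrier G \<times> carrier G" for p q
    using keys_diff[of "frag_of p" "frag_of q"] that by auto
  have rel: "h0 (frag_of p - frag_of q - frag_of r) = h0 (frag_of p) \<otimes>\<^bsub>B\<^esub> inv\<^bsub>B\<^esub> (h0 (frag_of q) \<otimes>\<^bsub>B\<^esub> h0 (frag_of r))"
    if "p \<in> carrier G \<times> carrier G" "q \<in> carrier G \<times> carrier G" "r \<in> carrier G \<times> carrier G" for p q r
    using that 2[of p q] h0.hom_closed[of "frag_of p"] h0.hom_closed[of "frag_of q"] h0.hom_closed[of "frag_of r"]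
    by (simp add: diff B.inv_mult B.m_assoc)
  have "exterior_relations G \<subseteq> kernel ?F B h0"
  proof
    fix x assume x: "x \<in> exterior_relations G"
    then have "h0 x = \<one>\<^bsub>B\<^esub>"
      unfolding exterior_relations_def by (auto simp: rel h0of left right self \<beta>)
    then show "x \<in> kernel ?F B h0"
      using subsetD[OF exterior_relations_keys x] unfolding kernel_def by blast
  qed
  then have "exterior_kernel G \<subseteq> kernel ?F B h0"
    unfolding exterior_kernel_def by (intro group.generate_subgroup_incl[OF group_free_Abelian_group] h0.subgroup_kernel)
  from h0.FactGroup_universal_kernel[OF exterior_kernel_normal this] obtain h where
    "h \<in> hom \<Lambda> B" and h: "\<And>x. x \<in> carrier ?F \<Longrightarrow> h (exterior_kernel G #>\<^bsub>?F\<^esub> x) = h0 x"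
    unfolding exterior_square_def by blast
  moreover have "h (wedge G a b) = \<beta> a b" if "a \<in> carrier G" "b \<in> carrier G" for a b
    unfolding wedge_def using that by (simp add: h h0of)
  ultimately show thesis
    using that by blast
qed

end

section \<open>Halving in exterior squares\<close>

text \<open>In additive notation with \<open>e = 1\<close>: every element has the form \<open>2a'\<close> or \<open>1 + 2a'\<close> in exactly one way.
  This is all that halving uses of the 2-adic integers.\<close>

locale two_adic_like = plain_comm_group G for G :: "'a monoid" (structure) +
  fixes e
  assumes e_closed [simp]: "e \<in> carrier G"
    and no_two_torsion: "a \<in> carrier G \<Longrightarrow> a \<otimes> a = \<one> \<Longrightarrow> a = \<one>"
    and e_not_square: "a \<in> carrier G \<Longrightarrow> a \<otimes> a \<noteq> e"
    and square_or_e_square: "a \<in> carrier G \<Longrightarrow> \<exists>a' \<in> carrier G. a = a' \<otimes> a' \<or> a = e \<otimes> (a' \<otimes> a')"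
begin

lemma square_inj: "a \<in> carrier G \<Longrightarrow> b \<in> carrier G \<Longrightarrow> a \<otimes> a = b \<otimes> b \<Longrightarrow> a = b"
proof -
  assume ab: "a \<in> carrier G" "b \<in> carrier G" "a \<otimes> a = b \<otimes> b"
  have "(a \<otimes> inv b) \<otimes> (a \<otimes> inv b) = (a \<otimes> a) \<otimes> inv (b \<otimes> b)"
    using ab(1,2) by (simp add: inv_mult m_ac)
  then have "a \<otimes> inv b = \<one>"
    using ab by (subst no_two_torsion) simp_all
  then show "a = b"
    using ab by (simp add: mult_inv_eq_one_iff)
qed

text \<open>The binary expansion \<open>a = digit a + 2 quot a\<close>, in additive notation.\<close>

definition digit :: "'a \<Rightarrow> 'a" where
  "digit a = (if \<exists>a' \<in> carrier G. a = a' \<otimes> a' then \<one> else e)"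

definition quot :: "'a \<Rightarrow> 'a" where
  "quot a = (SOME a'. a' \<in> carrier G \<and> a = digit a \<otimes> (a' \<otimes> a'))"

lemma digit_cases: "digit a = \<one> \<or> digit a = e"
  by (auto simp: digit_def)

lemma digit_closed [simp]: "digit a \<in> carrier G"
  by (auto simp: digit_def)

lemma e_not_one: "e \<noteq> \<one>"
  using e_not_square[of \<one>] by auto

lemma quot: "a \<in> carrier G \<Longrightarrow> quot a \<in> carrier G \<and> a = digit a \<otimes> (quot a \<otimes> quot a)"
proof -
  assume a: "a \<in> carrier G"
  have "\<exists>a'. a' \<in> carrier G \<and> a = digit a \<otimes> (a' \<otimes> a')"
    using square_or_e_square[OF a] by (auto simp: digit_def)
  then show ?thesis
    unfolding quot_def by (rule someI_ex)
qed

lemma quot_closed [simp]: "a \<in> carrier G \<Longrightarrow> quot a \<in> carrier G"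
  using quot by blast

lemma digit_quot_unique:
  assumes b: "b \<in> carrier G" and d: "d = \<one> \<or> d = e" and a: "a = d \<otimes> (b \<otimes> b)"
  shows "digit a = d" "quot a = b"
proof -
  have ac: "a \<in> carrier G" using a b d by auto
  show dig: "digit a = d"
  proof (cases "d = \<one>")
    case True
    then show ?thesis using a b by (auto simp: digit_def)
  next
    case False
    have "a \<noteq> a' \<otimes> a'" if a': "a' \<in> carrier G" for a'
    proof
      assume "a = a' \<otimes> a'"
      then have "e \<otimes> (b \<otimes> b) = a' \<otimes> a'" using a d False by simp
      then have "(a' \<otimes> inv b) \<otimes> (a' \<otimes> inv b) = (e \<otimes> (b \<otimes> b)) \<otimes> inv (b \<otimes> b)"
        using a' b by (simp add: inv_mult m_ac)
      also have "\<dots> = e" using b by (simp add: m_assoc)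
      finally show False using e_not_square[of "a' \<otimes> inv b"] a' b by simp
    qed
    then show ?thesis using d False by (auto simp: digit_def)
  qed
  have "d \<in> carrier G" using d by auto
  then have "quot a \<otimes> quot a = b \<otimes> b"
    using conjunct2[OF quot[OF ac]] a b ac \<open>d \<in> carrier G\<close> unfolding dig
    by (metis l_cancel m_closed quot_closed)
  then show "quot a = b"
    using square_inj[of "quot a" b] ac b by simp
qed

lemma digit_quot_mult:
  assumes a: "a \<in> carrier G" and b: "b \<in> carrier G"
  shows "digit (a \<otimes> b) = (if digit a = digit b then \<one> else e)"
    and "quot (a \<otimes> b) = quot a \<otimes> quot b \<otimes> (if digit a = e \<and> digit b = e then e else \<one>)"
proof -
  let ?d = "if digit a = digit b then \<one> else e" and ?c = "if digit a = e \<and> digit b = e then e else \<one>"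
  have "digit a \<otimes> digit b = ?d \<otimes> (?c \<otimes> ?c)"
    using digit_cases[of a] digit_cases[of b] by auto
  moreover have "a \<otimes> b = digit a \<otimes> digit b \<otimes> (quot a \<otimes> quot a \<otimes> (quot b \<otimes> quot b))"
    by (subst (1) conjunct2[OF quot[OF a]], subst (1) conjunct2[OF quot[OF b]])
      (use a b in \<open>simp add: m_ac\<close>)
  ultimately have "a \<otimes> b = ?d \<otimes> ((quot a \<otimes> quot b \<otimes> ?c) \<otimes> (quot a \<otimes> quot b \<otimes> ?c))"
    using a b by (simp add: m_ac split del: if_split) (simp add: m_ac)
  from digit_quot_unique[OF _ _ this] show "digit (a \<otimes> b) = ?d" "quot (a \<otimes> b) = quot a \<otimes> quot b \<otimes> ?c"
    using a b by auto
qed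

text \<open>Half of \<open>e \<and> b\<close>: the digit of \<open>b\<close> is a multiple of \<open>e\<close> and contributes nothing.\<close>

definition half_e_wedge where
  "half_e_wedge b = wedge G e (quot b)"

text \<open>Half of \<open>a \<and> b = digit a \<and> b + 2 (quot a \<and> b)\<close>, in additive notation.\<close>

definition half_wedge where
  "half_wedge a b = wedge G (quot a) b \<otimes>\<^bsub>\<Lambda>\<^esub> (if digit a = e then half_e_wedge b else \<one>\<^bsub>\<Lambda>\<^esub>)"

lemma half_e_wedge_closed [simp]: "b \<in> carrier G \<Longrightarrow> half_e_wedge b \<in> carrier \<Lambda>"
  by (simp add: half_e_wedge_def)

lemma half_wedge_closed [simp]: "a \<in> carrier G \<Longrightarrow> b \<in> carrier G \<Longrightarrow> half_wedge a b \<in> carrier \<Lambda>"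
  by (simp add: half_wedge_def)

lemma half_e_wedge_mult:
  "b \<in> carrier G \<Longrightarrow> c \<in> carrier G \<Longrightarrow> half_e_wedge (b \<otimes> c) = half_e_wedge b \<otimes>\<^bsub>\<Lambda>\<^esub> half_e_wedge c"
  by (simp add: half_e_wedge_def digit_quot_mult wedge_mult_right)

lemma half_e_wedge_square:
  assumes "b \<in> carrier G"
  shows "half_e_wedge b \<otimes>\<^bsub>\<Lambda>\<^esub> half_e_wedge b = wedge G e b"
proof -
  have "wedge G e b = wedge G e (digit b \<otimes> (quot b \<otimes> quot b))"
    using quot[OF assms] by simp
  also have "\<dots> = half_e_wedge b \<otimes>\<^bsub>\<Lambda>\<^esub> half_e_wedge b"
    using assms digit_cases[of b] by (auto simp: half_e_wedge_def wedge_mult_right)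
  finally show ?thesis by simp
qed

lemma half_wedge_mult_right:
  "a \<in> carrier G \<Longrightarrow> b \<in> carrier G \<Longrightarrow> c \<in> carrier G \<Longrightarrow>
   half_wedge a (b \<otimes> c) = half_wedge a b \<otimes>\<^bsub>\<Lambda>\<^esub> half_wedge a c"
  by (simp add: half_wedge_def half_e_wedge_mult wedge_mult_right ext.m_ac)

text \<open>If both digits are \<open>e\<close>, the carry contributes \<open>e \<and> c\<close>, and the two digits contribute the half of \<open>e \<and> c\<close> twice.\<close>

lemma half_wedge_mult_left:
  assumes "a \<in> carrier G" "b \<in> carrier G" "c \<in> carrier G"
  shows "half_wedge (a \<otimes> b) c = half_wedge a c \<otimes>\<^bsub>\<Lambda>\<^esub> half_wedge b c"
  using digit_cases[of a] digit_cases[of b] e_not_one assms half_e_wedge_square[of c]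
  by (auto simp: half_wedge_def digit_quot_mult wedge_mult_left ext.m_ac)

lemma half_wedge_self:
  assumes a: "a \<in> carrier G"
  shows "half_wedge a a = \<one>\<^bsub>\<Lambda>\<^esub>"
proof -
  have "wedge G (quot a) a = wedge G (quot a) (digit a \<otimes> (quot a \<otimes> quot a))"
    using quot[OF a] by simp
  also have "\<dots> = wedge G (quot a) (digit a)"
    using a by (simp add: wedge_mult_right)
  finally show ?thesis
    using digit_cases[of a] e_not_one a wedge_swap[of "quot a" e] by (auto simp: half_wedge_def half_e_wedge_def)
qed

lemma half_wedge_square:
  assumes a: "a \<in> carrier G" and b: "b \<in> carrier G"
  shows "half_wedge a b \<otimes>\<^bsub>\<Lambda>\<^esub> half_wedge a b = wedge G a b"
proof -
  have "wedge G a b = wedge G (digit a \<otimes> (quot a \<otimes> quot a)) b"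
    using quot[OF a] by simp
  also have "\<dots> = wedge G (digit a) b \<otimes>\<^bsub>\<Lambda>\<^esub> (wedge G (quot a) b \<otimes>\<^bsub>\<Lambda>\<^esub> wedge G (quot a) b)"
    using a b by (simp add: wedge_mult_left)
  finally show ?thesis
    using digit_cases[of a] e_not_one a b half_e_wedge_square[OF b, symmetric] by (auto simp: half_wedge_def ext.m_ac)
qed

lemma exterior_square_halving:
  obtains h where "h \<in> hom \<Lambda> \<Lambda>" "\<And>x. x \<in> carrier \<Lambda> \<Longrightarrow> h x \<otimes>\<^bsub>\<Lambda>\<^esub> h x = x"
proof -
  obtain h where h: "h \<in> hom \<Lambda> \<Lambda>"
    and hw: "\<And>a b. a \<in> carrier G \<Longrightarrow> b \<in> carrier G \<Longrightarrow> h (wedge G a b) = half_wedge a b"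
    using exterior_square_universal[OF comm_group_exterior_square half_wedge_closed half_wedge_mult_left
        half_wedge_mult_right half_wedge_self] by blast
  have "h x \<otimes>\<^bsub>\<Lambda>\<^esub> h x = x" if "x \<in> carrier \<Lambda>" for x
    using that
  proof (induction rule: exterior_square_induct)
    case one
    then show ?case
      using hom_one[OF h] by (simp add: ext.is_group)
  next
    case (wedge a b)
    then show ?case by (simp add: hw half_wedge_square)
  next
    case (mult x y)
    then have "h (x \<otimes>\<^bsub>\<Lambda>\<^esub> y) \<otimes>\<^bsub>\<Lambda>\<^esub> h (x \<otimes>\<^bsub>\<Lambda>\<^esub> y) = (h x \<otimes>\<^bsub>\<Lambda>\<^esub> h x) \<otimes>\<^bsub>\<Lambda>\<^esub> (h y \<otimes>\<^bsub>\<Lambda>\<^esub> h y)"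
      using hom_in_carrier[OF h] by (simp add: hom_mult[OF h] ext.m_ac)
    then show ?case using mult by simp
  qed
  then show thesis
    using that h by blast
qed

text \<open>The halving homomorphism is a left inverse of doubling, so halves are unique.\<close>

lemma half_unique:
  assumes "y \<in> carrier \<Lambda>" and "y \<otimes>\<^bsub>\<Lambda>\<^esub> y = x"
  shows "half \<Lambda> x = y"
proof -
  obtain h where h: "h \<in> hom \<Lambda> \<Lambda>" and hh: "\<And>x. x \<in> carrier \<Lambda> \<Longrightarrow> h x \<otimes>\<^bsub>\<Lambda>\<^esub> h x = x"
    using exterior_square_halving by blast
  have "h (z \<otimes>\<^bsub>\<Lambda>\<^esub> z) = z" if "z \<in> carrier \<Lambda>" for z
    using that by (simp add: hom_mult[OF h] hh)
  then show ?thesis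
    unfolding half_def using assms by (intro the_equality) metis+
qed

lemma half_square:
  assumes "x \<in> carrier \<Lambda>"
  shows "half \<Lambda> x \<in> carrier \<Lambda>" "half \<Lambda> x \<otimes>\<^bsub>\<Lambda>\<^esub> half \<Lambda> x = x"
proof -
  obtain h where h: "h \<in> hom \<Lambda> \<Lambda>" and hh: "\<And>x. x \<in> carrier \<Lambda> \<Longrightarrow> h x \<otimes>\<^bsub>\<Lambda>\<^esub> h x = x"
    using exterior_square_halving by blast
  have "half \<Lambda> x = h x"
    using assms hom_in_carrier[OF h] hh by (intro half_unique) auto
  then show "half \<Lambda> x \<in> carrier \<Lambda>" "half \<Lambda> x \<otimes>\<^bsub>\<Lambda>\<^esub> half \<Lambda> x = x"
    using assms hom_in_carrier[OF h] hh by auto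
qed

end

section \<open>The 2-adic integers\<close>

lemma padic_carrier:
  "x \<in> carrier (padic_int_group p) \<longleftrightarrow>
    (\<forall>n. x n \<in> carrier (integer_mod_group (p ^ n)) \<and> x (Suc n) mod int (p ^ n) = x n)"
  by (simp add: padic_int_group_def)

lemma padic_mult: "(x \<otimes>\<^bsub>padic_int_group p\<^esub> y) n = (x n + y n) mod int (p ^ n)"
  by (simp add: padic_int_group_def)

lemma padic_one: "\<one>\<^bsub>padic_int_group p\<^esub> = (\<lambda>n. 0)"
  by (simp add: padic_int_group_def)

lemma padic_mod_step: "(z mod int (p ^ Suc n)) mod int (p ^ n) = z mod int (p ^ n)"
  by (rule mod_mod_cancel) simp

lemma comm_group_padic: "comm_group (padic_int_group p)"
proof -
  let ?Z = "padic_int_group p" and ?M = "\<lambda>n. integer_mod_group (p ^ n)"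
  have M: "comm_group (?M n)" for n by simp
  have "group ?Z"
  proof (rule groupI)
    show "\<one>\<^bsub>?Z\<^esub> \<in> carrier ?Z"
      by (auto simp: padic_carrier padic_one)
  next
    fix x y assume x: "x \<in> carrier ?Z" and y: "y \<in> carrier ?Z"
    have "(x n + y n) mod int (p ^ n) \<in> carrier (?M n)" for n
      using monoid.m_closed[OF comm_group.axioms(1)[OF M, THEN comm_monoid.axioms(1)], of "x n" n "y n"] x y
      by (simp add: padic_carrier)
    moreover have "(x (Suc n) + y (Suc n)) mod int (p ^ Suc n) mod int (p ^ n) = (x n + y n) mod int (p ^ n)" for n
      unfolding padic_mod_step using x y by (metis mod_add_eq padic_carrier)
    ultimately show "x \<otimes>\<^bsub>?Z\<^esub> y \<in> carrier ?Z"
      unfolding padic_carrier padic_mult by blast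
  next
    fix x y z assume "x \<in> carrier ?Z" "y \<in> carrier ?Z" "z \<in> carrier ?Z"
    show "x \<otimes>\<^bsub>?Z\<^esub> y \<otimes>\<^bsub>?Z\<^esub> z = x \<otimes>\<^bsub>?Z\<^esub> (y \<otimes>\<^bsub>?Z\<^esub> z)"
      by (rule ext) (simp add: padic_mult mod_add_left_eq mod_add_right_eq add.assoc)
  next
    fix x assume x: "x \<in> carrier ?Z"
    show "\<one>\<^bsub>?Z\<^esub> \<otimes>\<^bsub>?Z\<^esub> x = x"
    proof (rule ext)
      fix n
      have "x n mod int (p ^ n) = x n"
        using x unfolding padic_carrier by (metis mod_mod_trivial)
      then show "(\<one>\<^bsub>?Z\<^esub> \<otimes>\<^bsub>?Z\<^esub> x) n = x n"
        by (simp add: padic_mult padic_one)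
    qed
    define y where "y n = (- x n) mod int (p ^ n)" for n
    have "y n \<in> carrier (?M n)" for n
      using group.inv_closed[OF group_integer_mod_group, of "x n" "p ^ n"] x by (simp add: padic_carrier y_def)
    moreover have "y (Suc n) mod int (p ^ n) = y n" for n
      unfolding y_def padic_mod_step using x by (metis mod_minus_cong mod_mod_trivial padic_carrier)
    ultimately have "y \<in> carrier ?Z"
      unfolding padic_carrier by blast
    moreover have "y \<otimes>\<^bsub>?Z\<^esub> x = \<one>\<^bsub>?Z\<^esub>"
      by (rule ext) (simp add: padic_mult padic_one y_def mod_add_left_eq)
    ultimately show "\<exists>y \<in> carrier ?Z. y \<otimes>\<^bsub>?Z\<^esub> x = \<one>\<^bsub>?Z\<^esub>"
      by blast
  qed
  then show ?thesis
    by (rule group.group_comm_groupI) (auto simp: padic_mult fun_eq_iff add.commute)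
qed

lemma padic_inv:
  assumes "x \<in> carrier (padic_int_group p)"
  shows "(inv\<^bsub>padic_int_group p\<^esub> x) n = (- x n) mod int (p ^ n)"
proof -
  interpret comm_group "padic_int_group p" by (rule comm_group_padic)
  let ?y = "inv\<^bsub>padic_int_group p\<^esub> x"
  have y: "?y n mod int (p ^ n) = ?y n"
    using inv_closed[OF assms] unfolding padic_carrier by (metis mod_mod_trivial)
  have "(?y n + x n) mod int (p ^ n) = 0"
    using fun_cong[OF l_inv[OF assms], of n] by (simp add: padic_mult padic_one)
  then have "((?y n + x n) mod int (p ^ n) + (- x n)) mod int (p ^ n) = (- x n) mod int (p ^ n)"
    by simp
  then show ?thesis
    using y by (simp add: mod_diff_left_eq)
qed

lemma Z2_carrier:
  "x \<in> carrier Z2 \<longleftrightarrow> (\<forall>n. 0 \<le> x n \<and> x n < 2 ^ n \<and> x (Suc n) mod 2 ^ n = x n)"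
  by (simp add: padic_carrier carrier_integer_mod_group)

definition Z2_one :: "nat \<Rightarrow> int" where
  "Z2_one n = 1 mod 2 ^ n"

lemma Z2_mod2: "x \<in> carrier Z2 \<Longrightarrow> x (Suc n) mod 2 = x 1"
proof (induction n)
  case 0
  then have "0 \<le> x 1" "x 1 < 2 ^ 1"
    unfolding Z2_carrier by blast+
  then show ?case by (simp add: One_nat_def)
next
  case (Suc n)
  have "x (Suc (Suc n)) mod 2 = (x (Suc (Suc n)) mod 2 ^ Suc n) mod 2"
    by (rule mod_mod_cancel[symmetric]) simp
  then show ?case
    using Suc unfolding Z2_carrier by metis
qed

text \<open>Dropping the last binary digit.\<close>

lemma Z2_shift:
  assumes "x \<in> carrier Z2"
  shows "(\<lambda>n. x (Suc n) div 2) \<in> carrier Z2"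
  unfolding Z2_carrier
proof (intro allI conjI)
  fix n
  have x: "0 \<le> x (Suc n)" "x (Suc n) < 2 ^ Suc n" "x (Suc (Suc n)) mod 2 ^ Suc n = x (Suc n)"
    using assms unfolding Z2_carrier by blast+
  show "0 \<le> x (Suc n) div 2" using x by simp
  show "x (Suc n) div 2 < 2 ^ n" using x by (simp add: div_less_iff_less_mult)
  have "x (Suc (Suc n)) div 2 mod 2 ^ n = (x (Suc (Suc n)) mod (2 * 2 ^ n)) div 2"
    by (simp add: mod_mult2_eq' [of _ 2 "2 ^ n"] zmod_zmult2_eq)
  then show "x (Suc (Suc n)) div 2 mod 2 ^ n = x (Suc n) div 2"
    using x by simp
qed

interpretation Z2: two_adic_like Z2 Z2_one
proof -
  interpret comm_group Z2 by (rule comm_group_padic)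
  show "two_adic_like Z2 Z2_one"
  proof unfold_locales
    show "Z2_one \<in> carrier Z2"
      unfolding Z2_carrier Z2_one_def by (intro allI conjI mod_mod_cancel) simp_all
  next
    fix a assume a: "a \<in> carrier Z2" and "a \<otimes>\<^bsub>Z2\<^esub> a = \<one>\<^bsub>Z2\<^esub>"
    then have eq: "(a n + a n) mod 2 ^ n = 0" for n
      by (metis padic_mult padic_one of_nat_numeral of_nat_power)
    show "a = \<one>\<^bsub>Z2\<^esub>"
    proof (rule ext)
      fix n
      have "2 ^ Suc n dvd 2 * a (Suc n)"
        using eq[of "Suc n"] by (simp add: mod_eq_0_iff_dvd)
      then have "2 ^ n dvd a (Suc n)" by simp
      then have "a (Suc n) mod 2 ^ n = 0" by simp
      then show "a n = \<one>\<^bsub>Z2\<^esub> n"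
        using a unfolding Z2_carrier padic_one by metis
    qed
  next
    fix a assume a: "a \<in> carrier Z2"
    have "(a \<otimes>\<^bsub>Z2\<^esub> a) 1 \<noteq> Z2_one 1"
      by (simp add: padic_mult Z2_one_def One_nat_def mult_2[symmetric])
    then show "a \<otimes>\<^bsub>Z2\<^esub> a \<noteq> Z2_one" by metis
  next
    fix a assume a: "a \<in> carrier Z2"
    let ?b = "\<lambda>n. a (Suc n) div 2"
    have dbl: "2 * (a (Suc n) div 2) = a (Suc n) - a 1" for n
      using Z2_mod2[OF a, of n] by (metis minus_mod_eq_mult_div)
    have an: "a (Suc n) mod 2 ^ n = a n" for n
      using a unfolding Z2_carrier by blast
    have "0 \<le> a 1" "a 1 < 2 ^ 1"
      using a unfolding Z2_carrier by blast+
    then consider "a 1 = 0" | "a 1 = 1" by fastforce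
    then have "a = ?b \<otimes>\<^bsub>Z2\<^esub> ?b \<or> a = Z2_one \<otimes>\<^bsub>Z2\<^esub> (?b \<otimes>\<^bsub>Z2\<^esub> ?b)"
    proof cases
      case 1
      then have "a n = (?b \<otimes>\<^bsub>Z2\<^esub> ?b) n" for n
        using dbl[of n] an[of n] by (simp add: padic_mult mult_2[symmetric])
      then show ?thesis by blast
    next
      case 2
      then have "a n = (Z2_one \<otimes>\<^bsub>Z2\<^esub> (?b \<otimes>\<^bsub>Z2\<^esub> ?b)) n" for n
      proof -
        have "(Z2_one \<otimes>\<^bsub>Z2\<^esub> (?b \<otimes>\<^bsub>Z2\<^esub> ?b)) n = (1 mod 2 ^ n + (2 * (a (Suc n) div 2)) mod 2 ^ n) mod 2 ^ n"
          unfolding padic_mult Z2_one_def mult_2 by simp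
        also have "\<dots> = (1 + 2 * (a (Suc n) div 2)) mod 2 ^ n"
          by (rule mod_add_eq)
        finally show ?thesis
          using dbl[of n] an[of n] 2 by simp
      qed
      then show ?thesis by blast
    qed
    then show "\<exists>a'\<in>carrier Z2. a = a' \<otimes>\<^bsub>Z2\<^esub> a' \<or> a = Z2_one \<otimes>\<^bsub>Z2\<^esub> (a' \<otimes>\<^bsub>Z2\<^esub> a')"
      using Z2_shift[OF a] by blast
  qed
qed

lemma (in two_adic_like) half_wedge_eq:
  "a \<in> carrier G \<Longrightarrow> b \<in> carrier G \<Longrightarrow> half \<Lambda> (wedge G a b) = half_wedge a b"
  by (rule half_unique) (simp_all add: half_wedge_square)

lemma (in two_adic_like) half_wedge_one [simp]:
  "a \<in> carrier G \<Longrightarrow> half_wedge \<one> a = \<one>\<^bsub>\<Lambda>\<^esub>" "a \<in> carrier G \<Longrightarrow> half_wedge a \<one> = \<one>\<^bsub>\<Lambda>\<^esub>"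
  using half_wedge_mult_left[of \<one> \<one> a] half_wedge_mult_right[of a \<one> \<one>] by simp_all

lemma (in two_adic_like) half_wedge_inv_left:
  "a \<in> carrier G \<Longrightarrow> b \<in> carrier G \<Longrightarrow> half_wedge (inv a) b = inv\<^bsub>\<Lambda>\<^esub> half_wedge a b"
  using half_wedge_mult_left[of "inv a" a b] by (intro ext.inv_equality[symmetric]) simp_all

lemma (in two_adic_like) half_wedge_inv_right:
  "a \<in> carrier G \<Longrightarrow> b \<in> carrier G \<Longrightarrow> half_wedge a (inv b) = inv\<^bsub>\<Lambda>\<^esub> half_wedge a b"
  using half_wedge_mult_right[of a "inv b" b] by (intro ext.inv_equality[symmetric]) simp_all

lemma (in two_adic_like) half_wedge_swap:
  assumes "a \<in> carrier G" "b \<in> carrier G"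
  shows "half_wedge a b = inv\<^bsub>\<Lambda>\<^esub> half_wedge b a"
proof -
  have "\<one>\<^bsub>\<Lambda>\<^esub> = half_wedge (a \<otimes> b) (a \<otimes> b)"
    using assms by (simp add: half_wedge_self)
  also have "\<dots> = half_wedge a b \<otimes>\<^bsub>\<Lambda>\<^esub> half_wedge b a"
    using assms by (simp add: half_wedge_mult_left half_wedge_mult_right) (simp add: half_wedge_self ext.m_ac)
  finally show ?thesis
    using assms by (intro ext.inv_equality[symmetric]) simp_all
qed

section \<open>Infinite cyclic groups acting through an involution\<close>

locale infinite_cyclic = group C for C :: "'c monoid" (structure) +
  fixes t
  assumes t_closed [simp]: "t \<in> carrier C"
    and generated: "carrier C = generate C {t}"
    and infinite: "infinite (carrier C)"
begin

lemma pow_t_inj: "t [^] (i :: int) = t [^] j \<longleftrightarrow> i = j"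
proof -
  have "ord t = 0"
    using generate_pow_card[OF t_closed] generated infinite by simp
  then show ?thesis
    using int_pow_eq[OF t_closed, of i j] by auto
qed

definition exponent :: "'c \<Rightarrow> int" where
  "exponent c = (THE i. t [^] i = c)"

lemma exponent_pow [simp]: "exponent (t [^] (i :: int)) = i"
  by (simp add: exponent_def pow_t_inj)

lemma pow_exponent: "c \<in> carrier C \<Longrightarrow> t [^] exponent c = c"
  using generate_pow[OF t_closed] generated by auto

lemma exponent_mult: "c \<in> carrier C \<Longrightarrow> d \<in> carrier C \<Longrightarrow> exponent (c \<otimes> d) = exponent c + exponent d"
  by (metis exponent_pow int_pow_mult pow_exponent t_closed)

lemma exponent_t [simp]: "exponent t = 1"
  using exponent_pow[of 1] by simp

lemma exponent_one [simp]: "exponent \<one> = 0"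
  using exponent_pow[of 0] by simp

lemma commutative: "c \<in> carrier C \<Longrightarrow> d \<in> carrier C \<Longrightarrow> c \<otimes> d = d \<otimes> c"
  by (metis add.commute int_pow_mult pow_exponent t_closed)

text \<open>The power \<open>\<theta>\<^sup>i\<close> of an involution, where \<open>c = t\<^sup>i\<close>.\<close>

definition twist :: "('n \<Rightarrow> 'n) \<Rightarrow> 'c \<Rightarrow> 'n \<Rightarrow> 'n" where
  "twist \<theta> c n = (if even (exponent c) then n else \<theta> n)"

lemma twist_one [simp]: "twist \<theta> \<one> n = n"
  by (simp add: twist_def)

lemma twist_t [simp]: "twist \<theta> t n = \<theta> n"
  by (simp add: twist_def)

lemma cyclic_action_twist:
  assumes N: "group N" and \<theta>: "\<theta> \<in> hom N N" and inv: "\<And>n. n \<in> carrier N \<Longrightarrow> \<theta> (\<theta> n) = n"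
    and n: "n \<in> carrier N"
  shows "cyclic_action C t N \<theta> c n = twist \<theta> c n"
proof -
  interpret N: group N by fact
  interpret A: group "AutoGroup N" by (rule N.AutoGroup)
  let ?r = "restrict \<theta> (carrier N)"
  have \<theta>c: "\<theta> m \<in> carrier N" if "m \<in> carrier N" for m
    using \<theta> that by (rule hom_in_carrier)
  have "bij_betw \<theta> (carrier N) (carrier N)"
    by (rule bij_betwI[where g = \<theta>]) (use \<theta>c inv in auto)
  then have "?r \<in> Bij (carrier N)"
    by (simp add: Bij_def bij_betw_cong[of "carrier N" ?r \<theta>])
  moreover have "?r \<in> hom N N"
    using \<theta> by (auto simp: hom_def)
  ultimately have r: "?r \<in> carrier (AutoGroup N)"
    by (simp add: AutoGroup_def auto_def)
  have rr: "?r \<otimes>\<^bsub>AutoGroup N\<^esub> ?r = \<one>\<^bsub>AutoGroup N\<^esub>"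
    using \<open>?r \<in> Bij (carrier N)\<close> \<theta>c inv by (auto simp: AutoGroup_def BijGroup_def compose_def fun_eq_iff)
  have even: "?r [^]\<^bsub>AutoGroup N\<^esub> (2 * i :: int) = \<one>\<^bsub>AutoGroup N\<^esub>" for i
  proof -
    have "?r [^]\<^bsub>AutoGroup N\<^esub> (2 :: int) = \<one>\<^bsub>AutoGroup N\<^esub>"
      using A.int_pow_mult[OF r, of 1 1] rr A.int_pow_1[OF r] by simp
    then show ?thesis
      using A.int_pow_pow[OF r, of 2 i] by simp
  qed
  have pow: "?r [^]\<^bsub>AutoGroup N\<^esub> (i :: int) = (if even i then \<one>\<^bsub>AutoGroup N\<^esub> else ?r)" for i
  proof (cases "even i")
    case True
    then show ?thesis using even by (auto elim!: evenE)
  next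
    case False
    then obtain j where "i = 2 * j + 1" by (auto elim!: oddE)
    then show ?thesis
      using A.int_pow_mult[OF r, of "2 * j" 1] even[of j] r A.int_pow_1[OF r] by simp
  qed
  have one: "\<one>\<^bsub>AutoGroup N\<^esub> n = n"
    using n by (simp add: AutoGroup_def BijGroup_def)
  show ?thesis
    unfolding cyclic_action_def exponent_def[symmetric] twist_def pow using n one by simp
qed

definition twisted_product :: "'n monoid \<Rightarrow> ('n \<Rightarrow> 'n) \<Rightarrow> ('n \<times> 'c) monoid" where
  "twisted_product N \<theta> = semidirect_product N C (cyclic_action C t N \<theta>)"

lemma carrier_twisted [simp]: "carrier (twisted_product N \<theta>) = carrier N \<times> carrier C"
  by (simp add: twisted_product_def semidirect_product_def)

lemma one_twisted: "\<one>\<^bsub>twisted_product N \<theta>\<^esub> = (\<one>\<^bsub>N\<^esub>, \<one>)"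
  by (simp add: twisted_product_def semidirect_product_def)

lemma mult_twisted:
  assumes "group N" "\<theta> \<in> hom N N" "\<And>n. n \<in> carrier N \<Longrightarrow> \<theta> (\<theta> n) = n" "n \<in> carrier N"
  shows "(m, c) \<otimes>\<^bsub>twisted_product N \<theta>\<^esub> (n, d) = (m \<otimes>\<^bsub>N\<^esub> twist \<theta> c n, c \<otimes> d)"
  using cyclic_action_twist[OF assms] by (simp add: twisted_product_def semidirect_product_def)

lemma group_twisted:
  assumes N: "group N" and \<theta>: "\<theta> \<in> hom N N" and inv: "\<And>n. n \<in> carrier N \<Longrightarrow> \<theta> (\<theta> n) = n"
  shows "group (twisted_product N \<theta>)"
proof -
  interpret N: group N by fact
  note mult = mult_twisted[OF N \<theta> inv]
  have tw [simp]: "twist \<theta> c n \<in> carrier N" if "n \<in> carrier N" for c n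
    using hom_in_carrier[OF \<theta> that] that by (simp add: twist_def)
  have twm: "twist \<theta> c (m \<otimes>\<^bsub>N\<^esub> n) = twist \<theta> c m \<otimes>\<^bsub>N\<^esub> twist \<theta> c n"
    if "m \<in> carrier N" "n \<in> carrier N" for c m n
    using hom_mult[OF \<theta> that] that by (simp add: twist_def)
  have twt: "twist \<theta> c (twist \<theta> d n) = twist \<theta> (c \<otimes> d) n" if "c \<in> carrier C" "d \<in> carrier C" "n \<in> carrier N" for c d n
    using that by (simp add: twist_def exponent_mult inv)
  show ?thesis
  proof (rule groupI)
    fix x y z
    assume "x \<in> carrier (twisted_product N \<theta>)" "y \<in> carrier (twisted_product N \<theta>)" "z \<in> carrier (twisted_product N \<theta>)"
    then show "x \<otimes>\<^bsub>twisted_product N \<theta>\<^esub> y \<otimes>\<^bsub>twisted_product N \<theta>\<^esub> z =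
        x \<otimes>\<^bsub>twisted_product N \<theta>\<^esub> (y \<otimes>\<^bsub>twisted_product N \<theta>\<^esub> z)"
      by (cases x, cases y, cases z) (simp add: mult twm twt N.m_assoc m_assoc)
  next
    fix x assume "x \<in> carrier (twisted_product N \<theta>)"
    moreover obtain n c where x: "x = (n, c)" by (cases x)
    ultimately have nc: "n \<in> carrier N" "c \<in> carrier C" by auto
    have "twist \<theta> (inv c) (inv\<^bsub>N\<^esub> n) \<otimes>\<^bsub>N\<^esub> twist \<theta> (inv c) n = \<one>\<^bsub>N\<^esub>"
      using nc by (simp add: twm[symmetric]) (simp add: twist_def hom_one[OF \<theta> N N])
    then show "\<exists>y\<in>carrier (twisted_product N \<theta>). y \<otimes>\<^bsub>twisted_product N \<theta>\<^esub> x = \<one>\<^bsub>twisted_product N \<theta>\<^esub>"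
      using nc by (intro bexI[of _ "(twist \<theta> (inv c) (inv\<^bsub>N\<^esub> n), inv c)"]) (simp_all add: x mult one_twisted)
  next
    fix x assume "x \<in> carrier (twisted_product N \<theta>)"
    then show "\<one>\<^bsub>twisted_product N \<theta>\<^esub> \<otimes>\<^bsub>twisted_product N \<theta>\<^esub> x = x"
      by (cases x) (simp add: mult one_twisted)
  next
    fix x y assume "x \<in> carrier (twisted_product N \<theta>)" "y \<in> carrier (twisted_product N \<theta>)"
    then show "x \<otimes>\<^bsub>twisted_product N \<theta>\<^esub> y \<in> carrier (twisted_product N \<theta>)"
      by (cases x, cases y) (simp add: mult)
  qed (simp add: one_twisted)
qed

end

section \<open>The group $N_w \rtimes C$\<close>

interpretation Nw: normalized_cocycle Lambda2_Z2 Z2 "\<lambda>a b. half Lambda2_Z2 (wedge Z2 a b)"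
proof unfold_locales
  show "half Lambda2_Z2 (wedge Z2 \<one>\<^bsub>Z2\<^esub> \<one>\<^bsub>Z2\<^esub>) = \<one>\<^bsub>Lambda2_Z2\<^esub>"
    using Z2.half_unique[of "\<one>\<^bsub>Lambda2_Z2\<^esub>" "\<one>\<^bsub>Lambda2_Z2\<^esub>"] by simp
qed (simp_all add: Z2.half_wedge_eq Z2.half_wedge_mult_left Z2.half_wedge_mult_right Z2.ext.m_ac)

lemma group_N_w: "group N_w"
  unfolding N_w_def by (rule Nw.group_ext)

lemma carrier_N_w: "carrier N_w = carrier Lambda2_Z2 \<times> carrier Z2"
  unfolding N_w_def by (rule Nw.carrier_ext)

lemma one_N_w: "\<one>\<^bsub>N_w\<^esub> = (\<one>\<^bsub>Lambda2_Z2\<^esub>, \<one>\<^bsub>Z2\<^esub>)"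
  unfolding N_w_def by (rule Nw.one_ext)

lemma mult_N_w:
  "a \<in> carrier Z2 \<Longrightarrow> b \<in> carrier Z2 \<Longrightarrow>
   (\<alpha>, a) \<otimes>\<^bsub>N_w\<^esub> (\<beta>, b) = (\<alpha> \<otimes>\<^bsub>Lambda2_Z2\<^esub> \<beta> \<otimes>\<^bsub>Lambda2_Z2\<^esub> Z2.half_wedge a b, a \<otimes>\<^bsub>Z2\<^esub> b)"
  unfolding N_w_def by (simp add: Nw.mult_ext Z2.half_wedge_eq)

lemma reflection_hom: "(\<lambda>(\<alpha>, a). (\<alpha>, inv\<^bsub>Z2\<^esub> a)) \<in> hom N_w N_w"
  by (rule homI)
    (auto simp: carrier_N_w mult_N_w Z2.half_wedge_inv_left Z2.half_wedge_inv_right Z2.inv_mult)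

context infinite_cyclic
begin

abbreviation "E \<equiv> N_w_semidirect C t"

lemma E_twisted: "E = twisted_product N_w (\<lambda>(\<alpha>, a). (\<alpha>, inv\<^bsub>Z2\<^esub> a))"
  by (simp add: N_w_semidirect_def twisted_product_def)

lemma group_E: "group E"
  unfolding E_twisted by (rule group_twisted[OF group_N_w reflection_hom]) (auto simp: carrier_N_w)

lemma carrier_E: "carrier E = (carrier Lambda2_Z2 \<times> carrier Z2) \<times> carrier C"
  by (simp add: E_twisted carrier_N_w)

lemma one_E: "\<one>\<^bsub>E\<^esub> = ((\<one>\<^bsub>Lambda2_Z2\<^esub>, \<one>\<^bsub>Z2\<^esub>), \<one>)"
  by (simp add: E_twisted one_twisted one_N_w)

abbreviation act :: "'c \<Rightarrow> (nat \<Rightarrow> int) \<Rightarrow> nat \<Rightarrow> int" where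
  "act \<equiv> twist (\<lambda>a. inv\<^bsub>Z2\<^esub> a)"

lemma act_closed [simp]: "a \<in> carrier Z2 \<Longrightarrow> act c a \<in> carrier Z2"
  by (simp add: twist_def)

lemma mult_E:
  assumes "a \<in> carrier Z2" "\<beta> \<in> carrier Lambda2_Z2" "b \<in> carrier Z2"
  shows "((\<alpha>, a), c) \<otimes>\<^bsub>E\<^esub> ((\<beta>, b), d) =
    ((\<alpha> \<otimes>\<^bsub>Lambda2_Z2\<^esub> \<beta> \<otimes>\<^bsub>Lambda2_Z2\<^esub> Z2.half_wedge a (act c b), a \<otimes>\<^bsub>Z2\<^esub> act c b), c \<otimes> d)"
proof -
  have "((\<alpha>, a), c) \<otimes>\<^bsub>E\<^esub> ((\<beta>, b), d) =
      ((\<alpha>, a) \<otimes>\<^bsub>N_w\<^esub> twist (\<lambda>(\<alpha>, a). (\<alpha>, inv\<^bsub>Z2\<^esub> a)) c (\<beta>, b), c \<otimes> d)"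
    unfolding E_twisted using assms
    by (intro mult_twisted[OF group_N_w reflection_hom]) (auto simp: carrier_N_w)
  also have "twist (\<lambda>(\<alpha>, a). (\<alpha>, inv\<^bsub>Z2\<^esub> a)) c (\<beta>, b) = (\<beta>, act c b)"
    by (simp add: twist_def)
  finally show ?thesis
    using assms by (simp add: mult_N_w)
qed

sublocale E: group E
  by (rule group_E)

text \<open>The elements of \<open>E\<close> that come from its three factors.\<close>

definition el_L :: "((nat \<Rightarrow> int) \<times> (nat \<Rightarrow> int) \<Rightarrow>\<^sub>0 int) set \<Rightarrow> _" where
  "el_L \<alpha> = ((\<alpha>, \<one>\<^bsub>Z2\<^esub>), \<one>)"

definition el_Z :: "(nat \<Rightarrow> int) \<Rightarrow> (((nat \<Rightarrow> int) \<times> (nat \<Rightarrow> int) \<Rightarrow>\<^sub>0 int) set \<times> (nat \<Rightarrow> int)) \<times> 'c" where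
  "el_Z a = ((\<one>\<^bsub>Lambda2_Z2\<^esub>, a), \<one>)"

definition el_T :: "(((nat \<Rightarrow> int) \<times> (nat \<Rightarrow> int) \<Rightarrow>\<^sub>0 int) set \<times> (nat \<Rightarrow> int)) \<times> 'c" where
  "el_T = ((\<one>\<^bsub>Lambda2_Z2\<^esub>, \<one>\<^bsub>Z2\<^esub>), t)"

lemma el_closed [simp]:
  "\<alpha> \<in> carrier Lambda2_Z2 \<Longrightarrow> el_L \<alpha> \<in> carrier E"
  "a \<in> carrier Z2 \<Longrightarrow> el_Z a \<in> carrier E"
  "el_T \<in> carrier E"
  by (auto simp: el_L_def el_Z_def el_T_def carrier_E)

lemma el_L_mult:
  "\<alpha> \<in> carrier Lambda2_Z2 \<Longrightarrow> \<beta> \<in> carrier Lambda2_Z2 \<Longrightarrow>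
   el_L (\<alpha> \<otimes>\<^bsub>Lambda2_Z2\<^esub> \<beta>) = el_L \<alpha> \<otimes>\<^bsub>E\<^esub> el_L \<beta>"
  by (simp add: el_L_def mult_E)

lemma el_L_one: "el_L \<one>\<^bsub>Lambda2_Z2\<^esub> = \<one>\<^bsub>E\<^esub>"
  by (simp add: el_L_def one_E)

lemma el_Z_one: "el_Z \<one>\<^bsub>Z2\<^esub> = \<one>\<^bsub>E\<^esub>"
  by (simp add: el_Z_def one_E)

lemma act_one [simp]: "act c \<one>\<^bsub>Z2\<^esub> = \<one>\<^bsub>Z2\<^esub>"
  by (simp add: twist_def)

lemma el_L_central:
  assumes "\<alpha> \<in> carrier Lambda2_Z2" "x \<in> carrier E"
  shows "el_L \<alpha> \<otimes>\<^bsub>E\<^esub> x = x \<otimes>\<^bsub>E\<^esub> el_L \<alpha>"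
  using assms by (cases x rule: prod.exhaust, cases "fst x")
    (auto simp: el_L_def carrier_E mult_E Z2.ext.m_comm)

lemma el_Z_mult:
  "a \<in> carrier Z2 \<Longrightarrow> b \<in> carrier Z2 \<Longrightarrow>
   el_Z a \<otimes>\<^bsub>E\<^esub> el_Z b = el_L (Z2.half_wedge a b) \<otimes>\<^bsub>E\<^esub> el_Z (a \<otimes>\<^bsub>Z2\<^esub> b)"
  by (simp add: el_L_def el_Z_def mult_E)

lemma el_Z_inv: "a \<in> carrier Z2 \<Longrightarrow> inv\<^bsub>E\<^esub> el_Z a = el_Z (inv\<^bsub>Z2\<^esub> a)"
  by (rule E.inv_equality)
    (simp_all add: el_Z_mult Z2.half_wedge_inv_left Z2.half_wedge_self el_L_one el_Z_one)

lemma el_T_Z: "a \<in> carrier Z2 \<Longrightarrow> el_T \<otimes>\<^bsub>E\<^esub> el_Z a = el_Z (inv\<^bsub>Z2\<^esub> a) \<otimes>\<^bsub>E\<^esub> el_T"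
  by (simp add: el_T_def el_Z_def mult_E)

lemma el_T_conj: "a \<in> carrier Z2 \<Longrightarrow> el_T \<otimes>\<^bsub>E\<^esub> el_Z a \<otimes>\<^bsub>E\<^esub> inv\<^bsub>E\<^esub> el_T = el_Z (inv\<^bsub>Z2\<^esub> a)"
  by (simp add: el_T_Z E.m_assoc)

lemma kernel_decomposition:
  assumes "\<alpha> \<in> carrier Lambda2_Z2" "a \<in> carrier Z2"
  shows "((\<alpha>, a), \<one>) = el_L \<alpha> \<otimes>\<^bsub>E\<^esub> el_Z a"
  using assms by (simp add: el_L_def el_Z_def mult_E)

end

section \<open>Commutator calculus\<close>

definition commutator :: "'a monoid \<Rightarrow> 'a \<Rightarrow> 'a \<Rightarrow> 'a" where
  "commutator G x y = x \<otimes>\<^bsub>G\<^esub> y \<otimes>\<^bsub>G\<^esub> inv\<^bsub>G\<^esub> x \<otimes>\<^bsub>G\<^esub> inv\<^bsub>G\<^esub> y"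

locale plain_group = group G for G :: "'a monoid" (structure)
begin

lemmas word_simps = m_assoc inv_mult_group inv_cancel

lemma commutator_closed [simp]: "x \<in> carrier G \<Longrightarrow> y \<in> carrier G \<Longrightarrow> commutator G x y \<in> carrier G"
  by (simp add: commutator_def)

lemma commutator_one_iff:
  assumes "x \<in> carrier G" "y \<in> carrier G"
  shows "commutator G x y = \<one> \<longleftrightarrow> x \<otimes> y = y \<otimes> x"
proof -
  have "commutator G x y = (x \<otimes> y) \<otimes> inv (y \<otimes> x)"
    using assms by (simp add: commutator_def word_simps)
  then show ?thesis
    using assms by (simp add: mult_inv_eq_one_iff)
qed

lemma commutator_self [simp]: "x \<in> carrier G \<Longrightarrow> commutator G x x = \<one>"
  by (simp add: commutator_one_iff)

lemma commutator_mult_left: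
  "x \<in> carrier G \<Longrightarrow> y \<in> carrier G \<Longrightarrow> z \<in> carrier G \<Longrightarrow>
   commutator G (x \<otimes> y) z = x \<otimes> commutator G y z \<otimes> inv x \<otimes> commutator G x z"
  by (simp add: commutator_def word_simps)

lemma commutator_mult_right:
  "x \<in> carrier G \<Longrightarrow> y \<in> carrier G \<Longrightarrow> z \<in> carrier G \<Longrightarrow>
   commutator G x (y \<otimes> z) = commutator G x y \<otimes> (y \<otimes> commutator G x z \<otimes> inv y)"
  by (simp add: commutator_def word_simps)

lemma commutator_inv: "x \<in> carrier G \<Longrightarrow> y \<in> carrier G \<Longrightarrow> inv commutator G x y = commutator G y x"
  by (simp add: commutator_def word_simps)

lemma commutator_inv_right:
  "x \<in> carrier G \<Longrightarrow> y \<in> carrier G \<Longrightarrow> commutator G x (inv y) = inv y \<otimes> inv commutator G x y \<otimes> y"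
  by (simp add: commutator_def word_simps)

lemma conj_commutator:
  "x \<in> carrier G \<Longrightarrow> y \<in> carrier G \<Longrightarrow> z \<in> carrier G \<Longrightarrow>
   z \<otimes> commutator G x y \<otimes> inv z = commutator G (z \<otimes> x \<otimes> inv z) (z \<otimes> y \<otimes> inv z)"
  by (simp add: commutator_def word_simps)

lemma commute_mult:
  "x \<in> carrier G \<Longrightarrow> y \<in> carrier G \<Longrightarrow> z \<in> carrier G \<Longrightarrow> x \<otimes> y = y \<otimes> x \<Longrightarrow> x \<otimes> z = z \<otimes> x \<Longrightarrow>
   x \<otimes> (y \<otimes> z) = (y \<otimes> z) \<otimes> x"
  by (metis m_assoc)

lemma commute_inv:
  assumes "x \<in> carrier G" "y \<in> carrier G" "x \<otimes> y = y \<otimes> x"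
  shows "x \<otimes> inv y = inv y \<otimes> x"
  using assms by (metis inv_cancel(1) inv_closed m_assoc m_closed r_inv r_one)

lemma conj_commute: "x \<in> carrier G \<Longrightarrow> y \<in> carrier G \<Longrightarrow> x \<otimes> y = y \<otimes> x \<Longrightarrow> x \<otimes> y \<otimes> inv x = y"
  by (simp add: m_assoc)

lemma commute_commutator:
  assumes "x \<in> carrier G" "y \<in> carrier G" "z \<in> carrier G" "x \<otimes> y = y \<otimes> x" "x \<otimes> z = z \<otimes> x"
  shows "x \<otimes> commutator G y z = commutator G y z \<otimes> x"
  unfolding commutator_def using assms by (intro commute_mult commute_inv) simp_all

text \<open>The elements that normalize \<open>S\<close> form a subgroup, and so do the elements whose commutator with a
  given element lies in \<open>S\<close>; both subgroups contain the generators.\<close>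

lemma commutators_in_subgroup:
  assumes S: "subgroup S G" and X0: "X0 \<subseteq> carrier G"
    and gen: "\<And>U. subgroup U G \<Longrightarrow> X0 \<subseteq> U \<Longrightarrow> carrier G \<subseteq> U"
    and conj: "\<And>u s. u \<in> X0 \<Longrightarrow> s \<in> S \<Longrightarrow> u \<otimes> s \<otimes> inv u \<in> S \<and> inv u \<otimes> s \<otimes> u \<in> S"
    and comm: "\<And>u v. u \<in> X0 \<Longrightarrow> v \<in> X0 \<Longrightarrow> commutator G u v \<in> S"
    and x: "x \<in> carrier G" and y: "y \<in> carrier G"
  shows "commutator G x y \<in> S"
proof -
  note Sc = subgroup.mem_carrier[OF S] and Sm = subgroup.m_closed[OF S] and Si = subgroup.m_inv_closed[OF S]
  have normal: "u \<otimes> s \<otimes> inv u \<in> S \<and> inv u \<otimes> s \<otimes> u \<in> S" if u: "u \<in> carrier G" and s: "s \<in> S" for u s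
  proof -
    let ?U = "{u \<in> carrier G. \<forall>s \<in> S. u \<otimes> s \<otimes> inv u \<in> S \<and> inv u \<otimes> s \<otimes> u \<in> S}"
    have "subgroup ?U G"
    proof (rule subgroupI)
      show "?U \<noteq> {}"
        using one_closed Sc by (auto intro!: exI[of _ \<one>])
    next
      fix a b assume a: "a \<in> ?U" and b: "b \<in> ?U"
      have "a \<otimes> b \<otimes> s \<otimes> inv (a \<otimes> b) = a \<otimes> (b \<otimes> s \<otimes> inv b) \<otimes> inv a"
        "inv (a \<otimes> b) \<otimes> s \<otimes> (a \<otimes> b) = inv b \<otimes> (inv a \<otimes> s \<otimes> a) \<otimes> b" if "s \<in> S" for s
        using a b Sc[OF that] by (simp_all add: word_simps)
      then show "a \<otimes> b \<in> ?U"
        using a b by auto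
    qed auto
    moreover have "X0 \<subseteq> ?U"
      using X0 conj by auto
    ultimately show ?thesis
      using gen[of ?U] u s by blast
  qed
  have extend: "commutator G u y \<in> S"
    if u: "u \<in> carrier G" and uv: "\<And>v. v \<in> X0 \<Longrightarrow> commutator G u v \<in> S" and y: "y \<in> carrier G" for u y
  proof -
    let ?U = "{v \<in> carrier G. commutator G u v \<in> S}"
    have "subgroup ?U G"
    proof (rule subgroupI)
      show "?U \<noteq> {}"
        using u subgroup.one_closed[OF S] by (auto intro!: exI[of _ \<one>] simp: commutator_def)
    next
      fix a b assume ab: "a \<in> ?U" "b \<in> ?U"
      then have "commutator G u a \<otimes> (a \<otimes> commutator G u b \<otimes> inv a) \<in> S"
        using normal by (intro Sm[of "commutator G u a"]) auto
      then show "a \<otimes> b \<in> ?U"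
        using ab u by (simp add: commutator_mult_right)
    next
      fix a assume "a \<in> ?U"
      then show "inv a \<in> ?U"
        using normal[of a "inv commutator G u a"] u Si by (auto simp: commutator_inv_right)
    qed auto
    moreover have "X0 \<subseteq> ?U"
      using X0 uv by auto
    ultimately show ?thesis
      using gen[of ?U] y by blast
  qed
  have "commutator G x v \<in> S" if v: "v \<in> X0" for v
  proof -
    have "inv commutator G v x \<in> S"
      using extend[of v x] v X0 comm x Si by blast
    then show ?thesis
      using v X0 x commutator_inv[of v x] by auto
  qed
  then show ?thesis
    using extend x y by blast
qed

end

lemma hom_commutator:
  assumes "group G" "group H" "h \<in> hom G H" "x \<in> carrier G" "y \<in> carrier G"
  shows "h (commutator G x y) = commutator H (h x) (h y)"
proof -
  interpret group_hom G H h
    using assms by (simp add: group_hom_def group_hom_axioms_def)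
  show ?thesis
    using assms by (simp add: commutator_def)
qed

context infinite_cyclic
begin

sublocale E: plain_group E
  by unfold_locales

lemma commutator_el_L:
  assumes "\<alpha> \<in> carrier Lambda2_Z2" "x \<in> carrier E"
  shows "commutator E (el_L \<alpha>) x = \<one>\<^bsub>E\<^esub>"
  using assms el_L_central by (simp add: E.commutator_one_iff)

lemma commutator_el_Z:
  assumes a: "a \<in> carrier Z2" and b: "b \<in> carrier Z2"
  shows "commutator E (el_Z a) (el_Z b) = el_L (wedge Z2 a b)"
proof -
  have "el_Z a \<otimes>\<^bsub>E\<^esub> el_Z b = el_L (wedge Z2 a b) \<otimes>\<^bsub>E\<^esub> (el_Z b \<otimes>\<^bsub>E\<^esub> el_Z a)"
  proof -
    have "wedge Z2 a b \<otimes>\<^bsub>Lambda2_Z2\<^esub> Z2.half_wedge b a = Z2.half_wedge a b"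
      using a b by (simp add: Z2.half_wedge_square[symmetric] Z2.half_wedge_swap[of b a] Z2.ext.m_assoc)
    then show ?thesis
      using a b by (simp add: el_Z_mult E.m_assoc[symmetric] el_L_mult[symmetric] Z2.m_comm)
  qed
  then show ?thesis
    using a b by (simp add: commutator_def E.word_simps)
qed

lemma commutator_el_Z_T:
  assumes b: "b \<in> carrier Z2"
  shows "commutator E (el_Z b) el_T = el_Z (b \<otimes>\<^bsub>Z2\<^esub> b)"
proof -
  have "commutator E (el_Z b) el_T = el_Z b \<otimes>\<^bsub>E\<^esub> (el_T \<otimes>\<^bsub>E\<^esub> el_Z (inv\<^bsub>Z2\<^esub> b) \<otimes>\<^bsub>E\<^esub> inv\<^bsub>E\<^esub> el_T)"
    using b by (simp add: commutator_def E.m_assoc el_Z_inv)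
  then show ?thesis
    using b by (simp add: el_T_conj el_Z_mult Z2.half_wedge_self el_L_one)
qed

end

section \<open>Central extensions of $N_w \rtimes C$\<close>

locale N_w_central_extension =
  infinite_cyclic C t + Y: plain_group Y for C :: "'c monoid" and t and Y :: "'y monoid" (structure) +
  fixes p
  assumes p_hom: "p \<in> hom Y (N_w_semidirect C t)"
    and p_surj: "p ` carrier Y = carrier (N_w_semidirect C t)"
    and p_central: "k \<in> carrier Y \<Longrightarrow> p k = \<one>\<^bsub>N_w_semidirect C t\<^esub> \<Longrightarrow> x \<in> carrier Y \<Longrightarrow> k \<otimes> x = x \<otimes> k"
begin

sublocale p: group_hom Y E p
  by (simp add: group_hom_def group_hom_axioms_def p_hom Y.is_group group_E)

lemma p_commutator: "x \<in> carrier Y \<Longrightarrow> y \<in> carrier Y \<Longrightarrow> p (commutator Y x y) = commutator E (p x) (p y)"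
  by (rule hom_commutator[OF Y.is_group group_E p_hom])

lemma lift_exists: "z \<in> carrier E \<Longrightarrow> \<exists>x \<in> carrier Y. p x = z"
  using p_surj by (metis imageE)

lemma same_image:
  assumes "x \<in> carrier Y" "y \<in> carrier Y" "p x = p y"
  obtains k where "k \<in> carrier Y" "p k = \<one>\<^bsub>E\<^esub>" "x = y \<otimes> k"
  using that[of "inv y \<otimes> x"] assms by (simp add: Y.inv_cancel)

text \<open>Since the kernel is central, a commutator depends only on the images of its entries.\<close>

lemma commutator_cong:
  assumes x: "x \<in> carrier Y" "x' \<in> carrier Y" "p x = p x'" and y: "y \<in> carrier Y" "y' \<in> carrier Y" "p y = p y'"
  shows "commutator Y x y = commutator Y x' y'"
proof -
  obtain k where k: "k \<in> carrier Y" "p k = \<one>\<^bsub>E\<^esub>" "x = x' \<otimes> k"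
    using same_image[OF x] by blast
  obtain l where l: "l \<in> carrier Y" "p l = \<one>\<^bsub>E\<^esub>" "y = y' \<otimes> l"
    using same_image[OF y] by blast
  have 1: "commutator Y k y = \<one>"
    using k y p_central by (simp add: Y.commutator_one_iff)
  have 2: "commutator Y x' l = \<one>"
    using l x p_central[OF l(1,2) x(2)] by (simp add: Y.commutator_one_iff)
  have "commutator Y x y = commutator Y x' y"
    unfolding k(3) using k x y 1 by (simp add: Y.commutator_mult_left)
  also have "\<dots> = commutator Y x' y'"
    unfolding l(3) using l x y 2 by (simp add: Y.commutator_mult_right)
  finally show ?thesis .
qed

definition \<tau> where
  "\<tau> = (SOME x. x \<in> carrier Y \<and> p x = el_T)"

lemma \<tau> [simp]: "\<tau> \<in> carrier Y" "p \<tau> = el_T"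
proof -
  have "\<exists>x. x \<in> carrier Y \<and> p x = el_T"
    using lift_exists[OF el_closed(3)] by blast
  from someI_ex[OF this] show "\<tau> \<in> carrier Y" "p \<tau> = el_T"
    unfolding \<tau>_def by blast+
qed

definition s where
  "s a = (SOME x. x \<in> carrier Y \<and> p x = el_Z a)"

lemma s [simp]:
  assumes "a \<in> carrier Z2"
  shows "s a \<in> carrier Y" "p (s a) = el_Z a"
proof -
  have "\<exists>x. x \<in> carrier Y \<and> p x = el_Z a"
    using lift_exists[OF el_closed(2)[OF assms]] by blast
  from someI_ex[OF this] show "s a \<in> carrier Y" "p (s a) = el_Z a"
    unfolding s_def by blast+
qed

definition L where
  "L = {x \<in> carrier Y. \<exists>\<alpha> \<in> carrier Lambda2_Z2. p x = el_L \<alpha>}"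

lemma L_closed: "x \<in> L \<Longrightarrow> x \<in> carrier Y"
  by (simp add: L_def)

lemma kernel_in_L: "k \<in> carrier Y \<Longrightarrow> p k = \<one>\<^bsub>E\<^esub> \<Longrightarrow> k \<in> L"
  unfolding L_def using el_L_one by (auto intro!: bexI[of _ "\<one>\<^bsub>Lambda2_Z2\<^esub>"])

lemma subgroup_L: "subgroup L Y"
proof (rule Y.subgroupI)
  show "L \<noteq> {}"
    using kernel_in_L[OF Y.one_closed] by auto
next
  fix x y assume "x \<in> L" "y \<in> L"
  then obtain \<alpha> \<beta> where "x \<in> carrier Y" "y \<in> carrier Y" "\<alpha> \<in> carrier Lambda2_Z2" "\<beta> \<in> carrier Lambda2_Z2"
    "p x = el_L \<alpha>" "p y = el_L \<beta>"
    by (auto simp: L_def)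
  then show "x \<otimes> y \<in> L"
    unfolding L_def by (auto simp: el_L_mult intro!: bexI[of _ "\<alpha> \<otimes>\<^bsub>Lambda2_Z2\<^esub> \<beta>"])
next
  fix x assume "x \<in> L"
  then obtain \<alpha> where x: "x \<in> carrier Y" "\<alpha> \<in> carrier Lambda2_Z2" "p x = el_L \<alpha>"
    by (auto simp: L_def)
  then have "inv\<^bsub>E\<^esub> el_L \<alpha> = el_L (inv\<^bsub>Lambda2_Z2\<^esub> \<alpha>)"
    by (intro E.inv_equality) (simp_all add: el_L_mult[symmetric] el_L_one)
  then show "inv x \<in> L"
    unfolding L_def using x by (auto intro!: bexI[of _ "inv\<^bsub>Lambda2_Z2\<^esub> \<alpha>"])
qed (auto simp: L_def)

text \<open>The commutator pairing between \<open>L\<close> and a lift of \<open>el_Z b\<close> is killed by 2, because conjugation by \<open>\<tau>\<close>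
  fixes it and inverts its second argument; as \<open>\<Lambda>\<^sup>2 \<int>\<^sub>2\<close> is 2-divisible, it vanishes.\<close>

lemma L_commutes_s:
  assumes x: "x \<in> L" and b: "b \<in> carrier Z2"
  shows "x \<otimes> s b = s b \<otimes> x"
proof -
  let ?c = "\<lambda>x. commutator Y x (s b)"
  have central: "y \<otimes> ?c x = ?c x \<otimes> y" if "x \<in> L" "y \<in> carrier Y" for x y
  proof (rule p_central[symmetric])
    show "p (?c x) = \<one>\<^bsub>E\<^esub>"
      using that b by (auto simp: L_def p_commutator commutator_el_L)
  qed (use that b in \<open>auto simp: L_def\<close>)
  have square: "?c x \<otimes> ?c x = \<one>" if x: "x \<in> L" for x
  proof -
    obtain \<alpha> where \<alpha>: "\<alpha> \<in> carrier Lambda2_Z2" "p x = el_L \<alpha>" and xY: "x \<in> carrier Y"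
      using x by (auto simp: L_def)
    have "?c x = \<tau> \<otimes> ?c x \<otimes> inv \<tau>"
      using central[OF x, of \<tau>] xY b by (simp add: Y.m_assoc)
    also have "\<dots> = commutator Y (\<tau> \<otimes> x \<otimes> inv \<tau>) (\<tau> \<otimes> s b \<otimes> inv \<tau>)"
      using xY b by (intro Y.conj_commutator) auto
    also have "\<dots> = commutator Y x (inv s b)"
      using xY b \<alpha> E.conj_commute[OF el_closed(3) el_closed(1)[OF \<alpha>(1)] el_L_central[OF \<alpha>(1) el_closed(3), symmetric]]
      by (intro commutator_cong) (simp_all add: el_T_conj el_Z_inv)
    also have "\<dots> = inv ?c x"
      using Y.commutator_inv_right[of x "s b"] xY b central[OF x, of "s b"]
        Y.commute_inv[of "s b" "?c x"] by (simp add: Y.m_assoc) (metis Y.inv_cancel(1) Y.inv_closed Y.commutator_closed s(1))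
    finally have "?c x \<otimes> ?c x = inv ?c x \<otimes> ?c x" by simp
    then show ?thesis
      using xY b by simp
  qed
  obtain \<alpha> where \<alpha>: "\<alpha> \<in> carrier Lambda2_Z2" "p x = el_L \<alpha>" and xY: "x \<in> carrier Y"
    using x by (auto simp: L_def)
  obtain y where y: "y \<in> carrier Y" "p y = el_L (half Lambda2_Z2 \<alpha>)"
    using lift_exists[of "el_L (half Lambda2_Z2 \<alpha>)"] Z2.half_square(1)[OF \<alpha>(1)] by auto
  have yL: "y \<in> L"
    using y Z2.half_square(1)[OF \<alpha>(1)] by (auto simp: L_def)
  have "?c x = ?c (y \<otimes> y)"
    using y xY b \<alpha> Z2.half_square[OF \<alpha>(1)]
    by (intro commutator_cong) (simp_all add: el_L_mult[symmetric])
  also have "\<dots> = ?c y \<otimes> ?c y"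
    using y b central[OF yL y(1)] by (simp add: Y.commutator_mult_left Y.m_assoc)
  finally have "?c x = \<one>"
    using square[OF yL] by simp
  then show ?thesis
    using xY b by (simp add: Y.commutator_one_iff)
qed

text \<open>Modulo the central kernel, \<open>L\<close> is generated by commutators of the lifts \<open>s a\<close>, and \<open>L\<close> commutes with these lifts.\<close>

lemma L_commutes_L:
  assumes x: "x \<in> L" and y: "y \<in> L"
  shows "x \<otimes> y = y \<otimes> x"
proof -
  have xY: "x \<in> carrier Y" using x by (rule L_closed)
  have "\<forall>y \<in> carrier Y. p y = el_L \<beta> \<longrightarrow> x \<otimes> y = y \<otimes> x" if "\<beta> \<in> carrier Lambda2_Z2" for \<beta>
    using that
  proof (induction rule: Z2.exterior_square_induct)
    case one
    show ?case
      using p_central[of _ x] xY by (auto simp: el_L_one)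
  next
    case (wedge a b)
    show ?case
    proof (intro ballI impI)
      fix y assume y: "y \<in> carrier Y" "p y = el_L (wedge Z2 a b)"
      then obtain k where k: "k \<in> carrier Y" "p k = \<one>\<^bsub>E\<^esub>" "y = commutator Y (s a) (s b) \<otimes> k"
        using same_image[of y "commutator Y (s a) (s b)"] wedge by (auto simp: p_commutator commutator_el_Z)
      have "x \<otimes> commutator Y (s a) (s b) = commutator Y (s a) (s b) \<otimes> x"
        using wedge x xY by (intro Y.commute_commutator L_commutes_s) auto
      then show "x \<otimes> y = y \<otimes> x"
        unfolding k(3) using k xY wedge p_central[of k x] by (intro Y.commute_mult) auto
    qed
  next
    case (mult \<alpha> \<beta>)
    show ?case
    proof (intro ballI impI)
      fix y assume y: "y \<in> carrier Y" "p y = el_L (\<alpha> \<otimes>\<^bsub>Lambda2_Z2\<^esub> \<beta>)"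
      obtain u where u: "u \<in> carrier Y" "p u = el_L \<alpha>"
        using lift_exists[of "el_L \<alpha>"] mult by auto
      have "p (inv u \<otimes> y) = el_L \<beta>"
        using u y mult by (simp add: el_L_mult E.inv_cancel)
      then have "x \<otimes> (inv u \<otimes> y) = (inv u \<otimes> y) \<otimes> x" "x \<otimes> u = u \<otimes> x"
        using mult u y by auto
      then have "x \<otimes> (u \<otimes> (inv u \<otimes> y)) = (u \<otimes> (inv u \<otimes> y)) \<otimes> x"
        using u y xY by (intro Y.commute_mult[of x u "inv u \<otimes> y"]) auto
      then show "x \<otimes> y = y \<otimes> x"
        using u y by (simp add: Y.inv_cancel)
    qed
  qed
  then show ?thesis
    using y by (auto simp: L_def)
qed

definition N where
  "N = {x \<in> carrier Y. snd (p x) = \<one>\<^bsub>C\<^esub>}"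

definition z where
  "z x = snd (fst (p x))"

lemma N_closed: "x \<in> N \<Longrightarrow> x \<in> carrier Y"
  by (simp add: N_def)

lemma N_decomposition:
  assumes "x \<in> N"
  obtains \<alpha> where "\<alpha> \<in> carrier Lambda2_Z2" "z x \<in> carrier Z2" "p x = el_L \<alpha> \<otimes>\<^bsub>E\<^esub> el_Z (z x)"
proof -
  have "p x \<in> carrier E" "snd (p x) = \<one>\<^bsub>C\<^esub>"
    using assms by (auto simp: N_def)
  then have "p x = ((fst (fst (p x)), z x), \<one>\<^bsub>C\<^esub>)" "fst (fst (p x)) \<in> carrier Lambda2_Z2" "z x \<in> carrier Z2"
    by (auto simp: carrier_E z_def prod_eq_iff mem_Times_iff)
  then show thesis
    using that kernel_decomposition by metis
qed

lemma z_closed [simp]: "x \<in> N \<Longrightarrow> z x \<in> carrier Z2"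
  using N_decomposition by metis

lemma N_I:
  assumes "x \<in> carrier Y" "\<alpha> \<in> carrier Lambda2_Z2" "a \<in> carrier Z2" "p x = el_L \<alpha> \<otimes>\<^bsub>E\<^esub> el_Z a"
  shows "x \<in> N" "z x = a"
  using assms by (simp_all add: N_def z_def kernel_decomposition[symmetric])

lemma s_N: "a \<in> carrier Z2 \<Longrightarrow> s a \<in> N" "a \<in> carrier Z2 \<Longrightarrow> z (s a) = a"
  using N_I[of "s a" "\<one>\<^bsub>Lambda2_Z2\<^esub>" a] by (simp_all add: el_L_one)

lemma L_N: "x \<in> L \<Longrightarrow> x \<in> N" "x \<in> L \<Longrightarrow> z x = \<one>\<^bsub>Z2\<^esub>"
  using N_I[of x _ "\<one>\<^bsub>Z2\<^esub>"] by (auto simp: L_def el_Z_one)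

lemma N_mult:
  assumes x: "x \<in> N" and y: "y \<in> N"
  shows "x \<otimes> y \<in> N" "z (x \<otimes> y) = z x \<otimes>\<^bsub>Z2\<^esub> z y"
proof -
  obtain \<alpha> where \<alpha>: "\<alpha> \<in> carrier Lambda2_Z2" "p x = ((\<alpha>, z x), \<one>\<^bsub>C\<^esub>)"
    using N_decomposition[OF x] kernel_decomposition by metis
  obtain \<beta> where \<beta>: "\<beta> \<in> carrier Lambda2_Z2" "p y = ((\<beta>, z y), \<one>\<^bsub>C\<^esub>)"
    using N_decomposition[OF y] kernel_decomposition by metis
  have "p (x \<otimes> y) = p x \<otimes>\<^bsub>E\<^esub> p y"
    using x y by (simp add: N_closed)
  also have "\<dots> = ((\<alpha> \<otimes>\<^bsub>Lambda2_Z2\<^esub> \<beta> \<otimes>\<^bsub>Lambda2_Z2\<^esub> Z2.half_wedge (z x) (z y), z x \<otimes>\<^bsub>Z2\<^esub> z y), \<one>\<^bsub>C\<^esub>)"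
    using \<alpha> \<beta> x y by (simp add: mult_E)
  finally show "x \<otimes> y \<in> N" "z (x \<otimes> y) = z x \<otimes>\<^bsub>Z2\<^esub> z y"
    using x y by (simp_all add: N_def z_def)
qed

lemma N_inv:
  assumes x: "x \<in> N"
  shows "inv x \<in> N" "z (inv x) = inv\<^bsub>Z2\<^esub> z x"
proof -
  obtain \<alpha> where \<alpha>: "\<alpha> \<in> carrier Lambda2_Z2" "p x = el_L \<alpha> \<otimes>\<^bsub>E\<^esub> el_Z (z x)"
    using N_decomposition[OF x] by metis
  have "inv\<^bsub>E\<^esub> el_L \<alpha> = el_L (inv\<^bsub>Lambda2_Z2\<^esub> \<alpha>)"
    using \<alpha> by (intro E.inv_equality) (simp_all add: el_L_mult[symmetric] el_L_one)
  then have "p (inv x) = el_Z (inv\<^bsub>Z2\<^esub> z x) \<otimes>\<^bsub>E\<^esub> el_L (inv\<^bsub>Lambda2_Z2\<^esub> \<alpha>)"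
    using x \<alpha> by (simp add: N_closed E.inv_mult_group el_Z_inv)
  also have "\<dots> = el_L (inv\<^bsub>Lambda2_Z2\<^esub> \<alpha>) \<otimes>\<^bsub>E\<^esub> el_Z (inv\<^bsub>Z2\<^esub> z x)"
    using x \<alpha> by (simp add: el_L_central)
  finally show "inv x \<in> N" "z (inv x) = inv\<^bsub>Z2\<^esub> z x"
    using N_I[of "inv x" "inv\<^bsub>Lambda2_Z2\<^esub> \<alpha>" "inv\<^bsub>Z2\<^esub> z x"] x \<alpha> by (simp_all add: N_closed)
qed

lemma N_z_one: "x \<in> N \<Longrightarrow> z x = \<one>\<^bsub>Z2\<^esub> \<Longrightarrow> x \<in> L"
  using N_decomposition[of x] unfolding L_def by (auto simp: el_Z_one N_closed) 

lemma same_z: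
  assumes "x \<in> N" "y \<in> N" "z x = z y"
  obtains l where "l \<in> L" "x = y \<otimes> l"
proof (rule that[of "inv y \<otimes> x"])
  show "inv y \<otimes> x \<in> L"
    using assms by (intro N_z_one) (simp_all add: N_mult N_inv)
  show "x = y \<otimes> (inv y \<otimes> x)"
    using assms by (simp add: N_closed Y.inv_cancel)
qed

lemma L_commutes_N:
  assumes x: "x \<in> L" and y: "y \<in> N"
  shows "x \<otimes> y = y \<otimes> x"
proof -
  obtain l where l: "l \<in> L" "y = s (z y) \<otimes> l"
    using same_z[OF y s_N(1)] s_N(2) y by (metis z_closed)
  have "x \<otimes> (s (z y) \<otimes> l) = (s (z y) \<otimes> l) \<otimes> x"
    using x y l L_commutes_s[OF x] L_commutes_L[OF x] by (intro Y.commute_mult) (auto simp: L_closed)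
  then show ?thesis
    using l(2) by simp
qed

lemma commutator_N_cong:
  assumes x: "x \<in> N" "x' \<in> N" "z x = z x'" and y: "y \<in> N" "y' \<in> N" "z y = z y'"
  shows "commutator Y x y = commutator Y x' y'"
proof -
  obtain k where k: "k \<in> L" "x = x' \<otimes> k"
    using same_z[OF x] by blast
  obtain l where l: "l \<in> L" "y = y' \<otimes> l"
    using same_z[OF y] by blast
  have 1: "commutator Y k y = \<one>"
    using k y L_commutes_N by (simp add: Y.commutator_one_iff N_closed L_closed)
  have 2: "commutator Y x' l = \<one>"
    using l x L_commutes_N[OF l(1) x(2)] by (simp add: Y.commutator_one_iff N_closed L_closed)
  have "commutator Y x y = commutator Y x' y"
    unfolding k(2) using k x y 1 by (simp add: Y.commutator_mult_left N_closed L_closed)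
  also have "\<dots> = commutator Y x' y'"
    unfolding l(2) using l x y 2 by (simp add: Y.commutator_mult_right N_closed L_closed)
  finally show ?thesis .
qed

lemma commutator_s_L:
  "a \<in> carrier Z2 \<Longrightarrow> b \<in> carrier Z2 \<Longrightarrow> commutator Y (s a) (s b) \<in> L"
  unfolding L_def by (auto simp: p_commutator commutator_el_Z)

lemma comm_group_L: "comm_group (Y\<lparr>carrier := L\<rparr>)"
  by (rule group.group_comm_groupI[OF subgroup.subgroup_is_group[OF subgroup_L Y.is_group]])
    (simp add: L_commutes_L)

lemma commutator_s_mult_left:
  assumes "a \<in> carrier Z2" "b \<in> carrier Z2" "c \<in> carrier Z2"
  shows "commutator Y (s (a \<otimes>\<^bsub>Z2\<^esub> b)) (s c) = commutator Y (s a) (s c) \<otimes> commutator Y (s b) (s c)"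
proof -
  let ?d = "commutator Y (s b) (s c)"
  have "commutator Y (s (a \<otimes>\<^bsub>Z2\<^esub> b)) (s c) = commutator Y (s a \<otimes> s b) (s c)"
    using assms by (intro commutator_N_cong) (simp_all add: N_mult s_N)
  also have "\<dots> = s a \<otimes> ?d \<otimes> inv s a \<otimes> commutator Y (s a) (s c)"
    using assms by (intro Y.commutator_mult_left) auto
  also have "s a \<otimes> ?d \<otimes> inv s a = ?d"
    using assms L_commutes_s[OF commutator_s_L, of b c a] by (intro Y.conj_commute) auto
  also have "?d \<otimes> commutator Y (s a) (s c) = commutator Y (s a) (s c) \<otimes> ?d"
    using assms by (intro L_commutes_L commutator_s_L)
  finally show ?thesis .
qed

lemma commutator_s_mult_right:
  assumes "a \<in> carrier Z2" "b \<in> carrier Z2" "c \<in> carrier Z2"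
  shows "commutator Y (s a) (s (b \<otimes>\<^bsub>Z2\<^esub> c)) = commutator Y (s a) (s b) \<otimes> commutator Y (s a) (s c)"
proof -
  let ?d = "commutator Y (s a) (s c)"
  have "commutator Y (s a) (s (b \<otimes>\<^bsub>Z2\<^esub> c)) = commutator Y (s a) (s b \<otimes> s c)"
    using assms by (intro commutator_N_cong) (simp_all add: N_mult s_N)
  also have "\<dots> = commutator Y (s a) (s b) \<otimes> (s b \<otimes> ?d \<otimes> inv s b)"
    using assms by (intro Y.commutator_mult_right) auto
  also have "s b \<otimes> ?d \<otimes> inv s b = ?d"
    using assms L_commutes_s[OF commutator_s_L, of a c b] by (intro Y.conj_commute) auto
  finally show ?thesis .
qed

text \<open>The commutator of lifts is bilinear, because its values lie in \<open>L\<close> and thus commute with the lifts.\<close>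

lemma \<sigma>_exists:
  "\<exists>\<sigma>. \<sigma> \<in> hom Lambda2_Z2 (Y\<lparr>carrier := L\<rparr>) \<and>
     (\<forall>a \<in> carrier Z2. \<forall>b \<in> carrier Z2. \<sigma> (wedge Z2 a b) = commutator Y (s a) (s b))"
  by (rule Z2.exterior_square_universal[OF comm_group_L, where \<beta> = "\<lambda>a b. commutator Y (s a) (s b)"])
    (auto simp: commutator_s_L commutator_s_mult_left commutator_s_mult_right)

definition \<sigma> where
  "\<sigma> = (SOME \<sigma>. \<sigma> \<in> hom Lambda2_Z2 (Y\<lparr>carrier := L\<rparr>) \<and>
     (\<forall>a \<in> carrier Z2. \<forall>b \<in> carrier Z2. \<sigma> (wedge Z2 a b) = commutator Y (s a) (s b)))"

lemma \<sigma>_hom: "\<sigma> \<in> hom Lambda2_Z2 (Y\<lparr>carrier := L\<rparr>)"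
  and \<sigma>_wedge: "a \<in> carrier Z2 \<Longrightarrow> b \<in> carrier Z2 \<Longrightarrow> \<sigma> (wedge Z2 a b) = commutator Y (s a) (s b)"
  using someI_ex[OF \<sigma>_exists] unfolding \<sigma>_def by blast+

lemma \<sigma>_L: "\<alpha> \<in> carrier Lambda2_Z2 \<Longrightarrow> \<sigma> \<alpha> \<in> L"
  using hom_in_carrier[OF \<sigma>_hom] by simp

lemma \<sigma>_closed [simp]: "\<alpha> \<in> carrier Lambda2_Z2 \<Longrightarrow> \<sigma> \<alpha> \<in> carrier Y"
  using \<sigma>_L L_closed by blast

lemma \<sigma>_mult: "\<alpha> \<in> carrier Lambda2_Z2 \<Longrightarrow> \<beta> \<in> carrier Lambda2_Z2 \<Longrightarrow> \<sigma> (\<alpha> \<otimes>\<^bsub>Lambda2_Z2\<^esub> \<beta>) = \<sigma> \<alpha> \<otimes> \<sigma> \<beta>"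
  using hom_mult[OF \<sigma>_hom] by simp

lemma \<sigma>_one: "\<sigma> \<one>\<^bsub>Lambda2_Z2\<^esub> = \<one>"
  using hom_one[OF \<sigma>_hom Z2.ext.is_group comm_group.axioms(2)[OF comm_group_L]] by simp

lemma \<sigma>_inv: "\<alpha> \<in> carrier Lambda2_Z2 \<Longrightarrow> inv \<sigma> \<alpha> = \<sigma> (inv\<^bsub>Lambda2_Z2\<^esub> \<alpha>)"
  by (rule Y.inv_equality) (simp_all add: \<sigma>_mult[symmetric] \<sigma>_one)

lemma p_\<sigma>: "\<alpha> \<in> carrier Lambda2_Z2 \<Longrightarrow> p (\<sigma> \<alpha>) = el_L \<alpha>"
  by (induction rule: Z2.exterior_square_induct)
    (simp_all add: \<sigma>_one el_L_one \<sigma>_wedge p_commutator commutator_el_Z \<sigma>_mult el_L_mult)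

lemma commutator_N: "x \<in> N \<Longrightarrow> y \<in> N \<Longrightarrow> commutator Y x y = \<sigma> (wedge Z2 (z x) (z y))"
  by (subst \<sigma>_wedge) (auto intro!: commutator_N_cong simp: s_N)

lemma \<tau>_conj_N:
  assumes x: "x \<in> N"
  shows "\<tau> \<otimes> x \<otimes> inv \<tau> \<in> N" "z (\<tau> \<otimes> x \<otimes> inv \<tau>) = inv\<^bsub>Z2\<^esub> z x"
    and "inv \<tau> \<otimes> x \<otimes> \<tau> \<in> N" "z (inv \<tau> \<otimes> x \<otimes> \<tau>) = inv\<^bsub>Z2\<^esub> z x"
proof -
  obtain \<alpha> where \<alpha>: "\<alpha> \<in> carrier Lambda2_Z2" "p x = el_L \<alpha> \<otimes>\<^bsub>E\<^esub> el_Z (z x)"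
    using N_decomposition[OF x] by metis
  have c1: "el_T \<otimes>\<^bsub>E\<^esub> (el_L \<alpha> \<otimes>\<^bsub>E\<^esub> el_Z (z x)) \<otimes>\<^bsub>E\<^esub> inv\<^bsub>E\<^esub> el_T = el_L \<alpha> \<otimes>\<^bsub>E\<^esub> el_Z (inv\<^bsub>Z2\<^esub> z x)"
  proof -
    have "el_T \<otimes>\<^bsub>E\<^esub> (el_L \<alpha> \<otimes>\<^bsub>E\<^esub> el_Z (z x)) \<otimes>\<^bsub>E\<^esub> inv\<^bsub>E\<^esub> el_T =
        (el_T \<otimes>\<^bsub>E\<^esub> el_L \<alpha>) \<otimes>\<^bsub>E\<^esub> el_Z (z x) \<otimes>\<^bsub>E\<^esub> inv\<^bsub>E\<^esub> el_T"
      using x \<alpha> by (simp add: E.m_assoc)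
    also have "\<dots> = el_L \<alpha> \<otimes>\<^bsub>E\<^esub> (el_T \<otimes>\<^bsub>E\<^esub> el_Z (z x) \<otimes>\<^bsub>E\<^esub> inv\<^bsub>E\<^esub> el_T)"
      using x \<alpha> by (simp add: el_L_central[symmetric] E.m_assoc)
    finally show ?thesis
      using x by (simp add: el_T_conj)
  qed
  have c2: "inv\<^bsub>E\<^esub> el_T \<otimes>\<^bsub>E\<^esub> (el_L \<alpha> \<otimes>\<^bsub>E\<^esub> el_Z (z x)) \<otimes>\<^bsub>E\<^esub> el_T = el_L \<alpha> \<otimes>\<^bsub>E\<^esub> el_Z (inv\<^bsub>Z2\<^esub> z x)"
  proof -
    have "el_Z (z x) \<otimes>\<^bsub>E\<^esub> el_T = el_T \<otimes>\<^bsub>E\<^esub> el_Z (inv\<^bsub>Z2\<^esub> z x)"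
      using el_T_Z[of "inv\<^bsub>Z2\<^esub> z x"] x by simp
    then have "inv\<^bsub>E\<^esub> el_T \<otimes>\<^bsub>E\<^esub> (el_L \<alpha> \<otimes>\<^bsub>E\<^esub> el_Z (z x)) \<otimes>\<^bsub>E\<^esub> el_T =
        inv\<^bsub>E\<^esub> el_T \<otimes>\<^bsub>E\<^esub> (el_L \<alpha> \<otimes>\<^bsub>E\<^esub> el_T) \<otimes>\<^bsub>E\<^esub> el_Z (inv\<^bsub>Z2\<^esub> z x)"
      using x \<alpha> by (simp add: E.m_assoc)
    then show ?thesis
      using x \<alpha> by (simp add: el_L_central E.word_simps)
  qed
  have "p (\<tau> \<otimes> x \<otimes> inv \<tau>) = el_L \<alpha> \<otimes>\<^bsub>E\<^esub> el_Z (inv\<^bsub>Z2\<^esub> z x)"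
    "p (inv \<tau> \<otimes> x \<otimes> \<tau>) = el_L \<alpha> \<otimes>\<^bsub>E\<^esub> el_Z (inv\<^bsub>Z2\<^esub> z x)"
    using c1 c2 x \<alpha> by (simp_all add: N_closed)
  then show "\<tau> \<otimes> x \<otimes> inv \<tau> \<in> N" "z (\<tau> \<otimes> x \<otimes> inv \<tau>) = inv\<^bsub>Z2\<^esub> z x"
    "inv \<tau> \<otimes> x \<otimes> \<tau> \<in> N" "z (inv \<tau> \<otimes> x \<otimes> \<tau>) = inv\<^bsub>Z2\<^esub> z x"
    using x \<alpha> N_I[of "\<tau> \<otimes> x \<otimes> inv \<tau>" \<alpha> "inv\<^bsub>Z2\<^esub> z x"] N_I[of "inv \<tau> \<otimes> x \<otimes> \<tau>" \<alpha> "inv\<^bsub>Z2\<^esub> z x"]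
    by (auto simp: N_closed)
qed

text \<open>Conjugation by \<open>\<tau>\<close> inverts both entries of a wedge product.\<close>

lemma \<tau>_commutes_\<sigma>: "\<alpha> \<in> carrier Lambda2_Z2 \<Longrightarrow> \<tau> \<otimes> \<sigma> \<alpha> = \<sigma> \<alpha> \<otimes> \<tau>"
proof (induction rule: Z2.exterior_square_induct)
  case one
  then show ?case by (simp add: \<sigma>_one)
next
  case (wedge a b)
  have "\<tau> \<otimes> commutator Y (s a) (s b) \<otimes> inv \<tau> = commutator Y (\<tau> \<otimes> s a \<otimes> inv \<tau>) (\<tau> \<otimes> s b \<otimes> inv \<tau>)"
    using wedge by (intro Y.conj_commutator) auto
  also have "\<dots> = \<sigma> (wedge Z2 (inv\<^bsub>Z2\<^esub> a) (inv\<^bsub>Z2\<^esub> b))"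
    using wedge by (simp add: commutator_N \<tau>_conj_N s_N)
  also have "wedge Z2 (inv\<^bsub>Z2\<^esub> a) (inv\<^bsub>Z2\<^esub> b) = wedge Z2 a b"
    using wedge by (simp add: Z2.wedge_inv_left Z2.wedge_inv_right)
  finally have "\<tau> \<otimes> \<sigma> (wedge Z2 a b) \<otimes> inv \<tau> = \<sigma> (wedge Z2 a b)"
    using wedge by (simp add: \<sigma>_wedge)
  then have "\<tau> \<otimes> \<sigma> (wedge Z2 a b) \<otimes> inv \<tau> \<otimes> \<tau> = \<sigma> (wedge Z2 a b) \<otimes> \<tau>"
    by simp
  then show ?case
    using wedge by (simp add: Y.m_assoc)
next
  case (mult \<alpha> \<beta>)
  then show ?case
    by (simp add: \<sigma>_mult Y.commute_mult)
qed

lemma L_commutes_\<tau>: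
  assumes x: "x \<in> L"
  shows "x \<otimes> \<tau> = \<tau> \<otimes> x"
proof -
  obtain \<alpha> where \<alpha>: "\<alpha> \<in> carrier Lambda2_Z2" "p x = el_L \<alpha>" and xY: "x \<in> carrier Y"
    using x by (auto simp: L_def)
  obtain k where k: "k \<in> carrier Y" "p k = \<one>\<^bsub>E\<^esub>" "x = \<sigma> \<alpha> \<otimes> k"
    using same_image[of x "\<sigma> \<alpha>"] \<alpha> xY p_\<sigma> by auto
  have "\<tau> \<otimes> (\<sigma> \<alpha> \<otimes> k) = (\<sigma> \<alpha> \<otimes> k) \<otimes> \<tau>"
    using \<alpha> k \<tau>_commutes_\<sigma>[OF \<alpha>(1)] p_central[of k \<tau>] by (intro Y.commute_mult) auto
  then show ?thesis
    using k by simp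
qed

definition \<delta> where
  "\<delta> b = commutator Y (s b) \<tau>"

lemma \<delta>_closed [simp]: "b \<in> carrier Z2 \<Longrightarrow> \<delta> b \<in> carrier Y"
  by (simp add: \<delta>_def)

lemma commutator_\<tau>:
  assumes y: "y \<in> N"
  shows "commutator Y y \<tau> = \<delta> (z y)"
proof -
  obtain l where l: "l \<in> L" "y = s (z y) \<otimes> l"
    using same_z[OF y s_N(1)] s_N(2) y by (metis z_closed)
  have "commutator Y l \<tau> = \<one>"
    using L_commutes_\<tau>[OF l(1)] l by (simp add: Y.commutator_one_iff L_closed)
  then have "commutator Y (s (z y) \<otimes> l) \<tau> = commutator Y (s (z y)) \<tau>"
    using y l(1) by (simp add: Y.commutator_mult_left L_closed)
  then show ?thesis
    using l(2) by (simp add: \<delta>_def)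
qed

lemma p_\<delta>:
  assumes b: "b \<in> carrier Z2"
  shows "p (\<delta> b) = el_Z (b \<otimes>\<^bsub>Z2\<^esub> b)"
  using b by (simp add: \<delta>_def p_commutator commutator_el_Z_T)

lemma \<delta>_N: "b \<in> carrier Z2 \<Longrightarrow> \<delta> b \<in> N" "b \<in> carrier Z2 \<Longrightarrow> z (\<delta> b) = b \<otimes>\<^bsub>Z2\<^esub> b"
  using N_I[of "\<delta> b" "\<one>\<^bsub>Lambda2_Z2\<^esub>" "b \<otimes>\<^bsub>Z2\<^esub> b"] by (simp_all add: p_\<delta> el_L_one)

lemma \<sigma>_commutes_N: "\<alpha> \<in> carrier Lambda2_Z2 \<Longrightarrow> x \<in> N \<Longrightarrow> \<sigma> \<alpha> \<otimes> x = x \<otimes> \<sigma> \<alpha>"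
  by (rule L_commutes_N[OF \<sigma>_L])

text \<open>In the expansion of \<open>\<delta> (a + b)\<close> as the commutator of \<open>s b \<otimes> s a\<close> with \<open>\<tau>\<close>, the factor \<open>\<delta> a\<close> appears
  conjugated by \<open>s b\<close>; as \<open>\<delta> a\<close> lies over \<open>2a\<close>, this costs \<open>\<sigma> (b \<and> 2a)\<close>.\<close>

lemma \<delta>_mult:
  assumes a: "a \<in> carrier Z2" and b: "b \<in> carrier Z2"
  shows "\<delta> a \<otimes> \<delta> b = \<sigma> (inv\<^bsub>Lambda2_Z2\<^esub> wedge Z2 b (a \<otimes>\<^bsub>Z2\<^esub> a)) \<otimes> \<delta> (a \<otimes>\<^bsub>Z2\<^esub> b)"
proof -
  let ?w = "wedge Z2 b (a \<otimes>\<^bsub>Z2\<^esub> a)"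
  have "\<delta> (a \<otimes>\<^bsub>Z2\<^esub> b) = commutator Y (s b \<otimes> s a) \<tau>"
    using a b by (simp add: commutator_\<tau> N_mult s_N Z2.m_comm)
  also have "\<dots> = s b \<otimes> \<delta> a \<otimes> inv s b \<otimes> \<delta> b"
    using a b unfolding \<delta>_def by (intro Y.commutator_mult_left) auto
  also have "s b \<otimes> \<delta> a \<otimes> inv s b = commutator Y (s b) (\<delta> a) \<otimes> \<delta> a"
    using a b by (simp add: commutator_def Y.m_assoc)
  also have "commutator Y (s b) (\<delta> a) = \<sigma> ?w"
    using a b by (simp add: commutator_N s_N \<delta>_N)
  finally show ?thesis
    using a b by (simp add: Y.m_assoc[symmetric] \<sigma>_mult[symmetric] \<sigma>_one)
qed

lemma \<delta>_one: "\<delta> \<one>\<^bsub>Z2\<^esub> = \<one>"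
proof -
  have "s \<one>\<^bsub>Z2\<^esub> \<in> L"
    by (rule kernel_in_L) (simp_all add: el_Z_one)
  then show ?thesis
    using L_commutes_\<tau> by (simp add: \<delta>_def Y.commutator_one_iff)
qed

text \<open>The commutator subgroup of \<open>Y\<close>, in a form from which its intersection with the kernel can be read off.\<close>

definition S where
  "S = {\<sigma> \<alpha> \<otimes> \<delta> b | \<alpha> b. \<alpha> \<in> carrier Lambda2_Z2 \<and> b \<in> carrier Z2}"

lemma SI: "\<alpha> \<in> carrier Lambda2_Z2 \<Longrightarrow> b \<in> carrier Z2 \<Longrightarrow> \<sigma> \<alpha> \<otimes> \<delta> b \<in> S"
  by (auto simp: S_def)

lemma S_N: "x \<in> S \<Longrightarrow> x \<in> N"
  by (auto simp: S_def \<delta>_N N_mult L_N[OF \<sigma>_L])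

lemma \<sigma>_S: "\<alpha> \<in> carrier Lambda2_Z2 \<Longrightarrow> \<sigma> \<alpha> \<in> S"
  using SI[of \<alpha> "\<one>\<^bsub>Z2\<^esub>"] by (simp add: \<delta>_one)

lemma \<delta>_S: "b \<in> carrier Z2 \<Longrightarrow> \<delta> b \<in> S"
  using SI[of "\<one>\<^bsub>Lambda2_Z2\<^esub>" b] by (simp add: \<sigma>_one)

lemma S_mult:
  assumes "x \<in> S" "y \<in> S"
  shows "x \<otimes> y \<in> S"
proof -
  obtain \<alpha> a \<beta> b where x: "\<alpha> \<in> carrier Lambda2_Z2" "a \<in> carrier Z2" "x = \<sigma> \<alpha> \<otimes> \<delta> a"
    and y: "\<beta> \<in> carrier Lambda2_Z2" "b \<in> carrier Z2" "y = \<sigma> \<beta> \<otimes> \<delta> b"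
    using assms by (auto simp: S_def)
  have "x \<otimes> y = \<sigma> \<alpha> \<otimes> (\<delta> a \<otimes> \<sigma> \<beta>) \<otimes> \<delta> b"
    using x y by (simp add: Y.m_assoc)
  also have "\<dots> = \<sigma> \<alpha> \<otimes> \<sigma> \<beta> \<otimes> (\<delta> a \<otimes> \<delta> b)"
    using x y by (simp add: \<sigma>_commutes_N[symmetric] \<delta>_N Y.m_assoc)
  also have "\<dots> = \<sigma> (\<alpha> \<otimes>\<^bsub>Lambda2_Z2\<^esub> \<beta> \<otimes>\<^bsub>Lambda2_Z2\<^esub> inv\<^bsub>Lambda2_Z2\<^esub> wedge Z2 b (a \<otimes>\<^bsub>Z2\<^esub> a)) \<otimes> \<delta> (a \<otimes>\<^bsub>Z2\<^esub> b)"
    using x y by (simp add: \<delta>_mult \<sigma>_mult Y.m_assoc)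
  finally show ?thesis
    using x y by (simp add: SI)
qed

lemma subgroup_S: "subgroup S Y"
proof (rule Y.subgroupI)
  show "S \<subseteq> carrier Y"
    using S_N N_closed by blast
  show "S \<noteq> {}"
    using \<sigma>_S[of "\<one>\<^bsub>Lambda2_Z2\<^esub>"] by auto
next
  fix x assume "x \<in> S"
  then obtain \<alpha> a where x: "\<alpha> \<in> carrier Lambda2_Z2" "a \<in> carrier Z2" "x = \<sigma> \<alpha> \<otimes> \<delta> a"
    by (auto simp: S_def)
  let ?w = "inv\<^bsub>Lambda2_Z2\<^esub> wedge Z2 a (inv\<^bsub>Z2\<^esub> a \<otimes>\<^bsub>Z2\<^esub> inv\<^bsub>Z2\<^esub> a)"
  have w: "\<delta> (inv\<^bsub>Z2\<^esub> a) \<otimes> \<delta> a = \<sigma> ?w"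
    using x by (simp add: \<delta>_mult \<delta>_one)
  have "inv \<delta> a = inv \<sigma> ?w \<otimes> \<delta> (inv\<^bsub>Z2\<^esub> a)"
    using x by (intro Y.inv_equality) (simp_all add: Y.m_assoc w)
  then have "inv \<delta> a \<in> S"
    using x by (simp add: \<sigma>_inv SI)
  then show "inv x \<in> S"
    using x by (simp add: Y.inv_mult_group \<sigma>_inv S_mult \<sigma>_S)
qed (rule S_mult)

text \<open>The image \<open>(\<alpha>, 2a)\<close> determines \<open>\<alpha>\<close> and \<open>a\<close>, since the 2-adic integers have no 2-torsion.\<close>

lemma S_kernel:
  assumes "x \<in> S" "p x = \<one>\<^bsub>E\<^esub>"
  shows "x = \<one>"
proof -
  obtain \<alpha> a where x: "\<alpha> \<in> carrier Lambda2_Z2" "a \<in> carrier Z2" "x = \<sigma> \<alpha> \<otimes> \<delta> a"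
    using assms by (auto simp: S_def)
  have "p x = ((\<alpha>, a \<otimes>\<^bsub>Z2\<^esub> a), \<one>\<^bsub>C\<^esub>)"
    using x by (simp add: p_\<sigma> p_\<delta> kernel_decomposition)
  then have "\<alpha> = \<one>\<^bsub>Lambda2_Z2\<^esub>" "a \<otimes>\<^bsub>Z2\<^esub> a = \<one>\<^bsub>Z2\<^esub>"
    using assms(2) by (simp_all add: one_E)
  then show ?thesis
    using x Z2.no_two_torsion[of a] by (simp add: \<sigma>_one \<delta>_one)
qed

lemma N_\<tau>_generate:
  assumes U: "subgroup U Y" and sub: "insert \<tau> N \<subseteq> U"
  shows "carrier Y \<subseteq> U"
proof
  fix y assume y: "y \<in> carrier Y"
  have hom: "(\<lambda>x. snd (p x)) \<in> hom Y C"
  proof (rule homI)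
    show "snd (p x) \<in> carrier C" if "x \<in> carrier Y" for x
      using p.hom_closed[OF that] by (auto simp: carrier_E)
    show "snd (p (x \<otimes> x')) = snd (p x) \<otimes>\<^bsub>C\<^esub> snd (p x')" if "x \<in> carrier Y" "x' \<in> carrier Y" for x x'
      using p.hom_closed[OF that(1)] p.hom_closed[OF that(2)] that
      by (cases "p x", cases "p x'", cases "fst (p x)", cases "fst (p x')") (auto simp: carrier_E mult_E)
  qed
  interpret q: group_hom Y C "\<lambda>x. snd (p x)"
    by (simp add: group_hom_def group_hom_axioms_def hom Y.is_group is_group)
  have "\<tau> \<in> U" "N \<subseteq> U"
    using sub by auto
  define i where "i = exponent (snd (p y))"
  let ?u = "\<tau> [^] i"
  have u: "?u \<in> U"
    using Y.subgroup_int_pow_closed[OF U \<open>\<tau> \<in> U\<close>] .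
  have "snd (p ?u) = t [^]\<^bsub>C\<^esub> i"
    using q.hom_int_pow[of \<tau> i] by (simp add: el_T_def)
  also have "\<dots> = snd (p y)"
    unfolding i_def using q.hom_closed[OF y] by (rule pow_exponent)
  finally have "y \<otimes> inv ?u \<in> N"
    using y q.hom_mult[of y "inv ?u"] q.hom_inv[of ?u] q.hom_closed[OF y] by (simp add: N_def)
  then have "y \<otimes> inv ?u \<otimes> ?u \<in> U"
    using u \<open>N \<subseteq> U\<close> subgroup.m_closed[OF U] by blast
  then show "y \<in> U"
    using y by (simp add: Y.m_assoc)
qed

lemma commutator_S:
  assumes "x \<in> carrier Y" "y \<in> carrier Y"
  shows "commutator Y x y \<in> S"
proof (rule Y.commutators_in_subgroup[OF subgroup_S _ N_\<tau>_generate _ _ assms])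
  show "insert \<tau> N \<subseteq> carrier Y"
    using N_closed by auto
next
  fix u v assume u: "u \<in> insert \<tau> N" and v: "v \<in> insert \<tau> N"
  show "commutator Y u v \<in> S"
  proof (cases "u = \<tau>")
    case True
    show ?thesis
    proof (cases "v = \<tau>")
      case True
      then show ?thesis
        using \<open>u = \<tau>\<close> \<sigma>_S[of "\<one>\<^bsub>Lambda2_Z2\<^esub>"] by (simp add: \<sigma>_one)
    next
      case False
      then have "v \<in> N" using v by simp
      then have "inv commutator Y v \<tau> \<in> S"
        by (simp add: commutator_\<tau> \<delta>_S subgroup.m_inv_closed[OF subgroup_S])
      then show ?thesis
        using \<open>u = \<tau>\<close> \<open>v \<in> N\<close> by (simp add: Y.commutator_inv N_closed)
    qed
  next
    case False
    then have "u \<in> N" using u by simp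
    then show ?thesis
      using v by (auto simp: commutator_\<tau> \<delta>_S commutator_N \<sigma>_S)
  qed
next
  fix u x assume u: "u \<in> insert \<tau> N" and x: "x \<in> S"
  have N_conj: "v \<otimes> x \<otimes> inv v \<in> S" if "v \<in> N" for v
  proof -
    have "v \<otimes> x \<otimes> inv v = commutator Y v x \<otimes> x"
      using that S_N[OF x] by (simp add: commutator_def Y.m_assoc N_closed)
    also have "\<dots> \<in> S"
      using that S_N[OF x] x by (simp add: commutator_N \<sigma>_S S_mult)
    finally show ?thesis .
  qed
  obtain \<alpha> a where xx: "\<alpha> \<in> carrier Lambda2_Z2" "a \<in> carrier Z2" "x = \<sigma> \<alpha> \<otimes> \<delta> a"
    using x by (auto simp: S_def)
  have "\<tau> \<otimes> x \<otimes> inv \<tau> = \<sigma> \<alpha> \<otimes> (\<tau> \<otimes> \<delta> a \<otimes> inv \<tau>)"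
    using xx by (simp add: Y.m_assoc[symmetric] \<tau>_commutes_\<sigma>)
  also have "\<tau> \<otimes> \<delta> a \<otimes> inv \<tau> = commutator Y (\<tau> \<otimes> s a \<otimes> inv \<tau>) (\<tau> \<otimes> \<tau> \<otimes> inv \<tau>)"
    unfolding \<delta>_def using xx by (intro Y.conj_commutator) auto
  also have "\<dots> = \<delta> (inv\<^bsub>Z2\<^esub> a)"
    using xx by (simp add: Y.m_assoc) (simp add: Y.m_assoc[symmetric] commutator_\<tau> \<tau>_conj_N s_N)
  finally have 1: "\<tau> \<otimes> x \<otimes> inv \<tau> \<in> S"
    using xx by (simp add: SI)
  have "inv \<tau> \<otimes> x \<otimes> \<tau> = \<sigma> \<alpha> \<otimes> (inv \<tau> \<otimes> \<delta> a \<otimes> \<tau>)"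
    using xx Y.commute_inv[of "\<sigma> \<alpha>" \<tau>] by (simp add: Y.m_assoc[symmetric] \<tau>_commutes_\<sigma>)
  also have "inv \<tau> \<otimes> \<delta> a \<otimes> \<tau> = commutator Y (inv \<tau> \<otimes> s a \<otimes> \<tau>) (inv \<tau> \<otimes> \<tau> \<otimes> \<tau>)"
    unfolding \<delta>_def using xx Y.conj_commutator[of "s a" \<tau> "inv \<tau>"] by simp
  also have "\<dots> = \<delta> (inv\<^bsub>Z2\<^esub> a)"
    using xx by (simp add: commutator_\<tau> \<tau>_conj_N s_N)
  finally have 2: "inv \<tau> \<otimes> x \<otimes> \<tau> \<in> S"
    using xx by (simp add: SI)
  show "u \<otimes> x \<otimes> inv u \<in> S \<and> inv u \<otimes> x \<otimes> u \<in> S"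
    using u 1 2 N_conj[of u] N_conj[of "inv u"] N_inv(1)[of u] N_closed[of u] by auto
qed

end

lemma (in infinite_cyclic) second_homology_E: "bar_cycles 2 E \<subseteq> bar_boundaries 2 E"
proof (rule second_homology_vanishes[OF group_E])
  fix Y :: "((((((nat \<Rightarrow> int) \<times> (nat \<Rightarrow> int) \<Rightarrow>\<^sub>0 int) set \<times> (nat \<Rightarrow> int)) \<times> 'a) list \<Rightarrow>\<^sub>0 int) set \<times>
    ((((nat \<Rightarrow> int) \<times> (nat \<Rightarrow> int) \<Rightarrow>\<^sub>0 int) set \<times> (nat \<Rightarrow> int)) \<times> 'a)) monoid" and p
  assume Y: "group Y" and p: "p \<in> hom Y E" "p ` carrier Y = carrier E"
    and c: "\<And>k x. k \<in> carrier Y \<Longrightarrow> p k = \<one>\<^bsub>E\<^esub> \<Longrightarrow> x \<in> carrier Y \<Longrightarrow> k \<otimes>\<^bsub>Y\<^esub> x = x \<otimes>\<^bsub>Y\<^esub> k"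
  interpret Y: plain_group Y
    using Y by (simp add: plain_group_def)
  interpret Y: N_w_central_extension C t Y p
    by unfold_locales (use p c in auto)
  show "\<exists>S. subgroup S Y \<and>
        (\<forall>x \<in> carrier Y. \<forall>y \<in> carrier Y. x \<otimes>\<^bsub>Y\<^esub> y \<otimes>\<^bsub>Y\<^esub> inv\<^bsub>Y\<^esub> x \<otimes>\<^bsub>Y\<^esub> inv\<^bsub>Y\<^esub> y \<in> S) \<and>
        (\<forall>s \<in> S. p s = \<one>\<^bsub>E\<^esub> \<longrightarrow> s = \<one>\<^bsub>Y\<^esub>)"
    using Y.subgroup_S Y.commutator_S Y.S_kernel unfolding commutator_def by blast
qed

section \<open>First homology of a group and its commutators\<close>

definition homology1_class :: "'a monoid \<Rightarrow> 'a \<Rightarrow> ('a list \<Rightarrow>\<^sub>0 int) set" where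
  "homology1_class G g = bar_boundaries 1 G #>\<^bsub>bar_chains 1 G\<^esub> frag_of [g]"

abbreviation homology1 :: "'a monoid \<Rightarrow> ('a list \<Rightarrow>\<^sub>0 int) set monoid" where
  "homology1 G \<equiv> bar_chains 1 G Mod bar_boundaries 1 G"

lemmas bar_boundaries_1_normal = bar_boundaries_normal[OF bar_boundaries_1_chains]

lemma comm_group_homology1: "group G \<Longrightarrow> comm_group (homology1 G)"
  by (rule comm_group.abelian_FactGroup[OF comm_group_bar_chains normal_imp_subgroup[OF bar_boundaries_1_normal]])

lemma homology1_class_eq_iff:
  assumes G: "group G" and "g \<in> carrier G" "h \<in> carrier G"
  shows "homology1_class G g = homology1_class G h \<longleftrightarrow> frag_of [g] - frag_of [h] \<in> bar_boundaries 1 G"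
  unfolding homology1_class_def using assms
  by (subst normal.coset_eq_iff[OF bar_boundaries_1_normal[OF G]]) (simp_all add: inv_bar_chains)

lemma homology1_class_one_iff:
  assumes G: "group G" and "g \<in> carrier G"
  shows "homology1_class G g = \<one>\<^bsub>homology1 G\<^esub> \<longleftrightarrow> frag_of [g] \<in> bar_boundaries 1 G"
  unfolding homology1_class_def one_FactGroup using assms
  by (intro normal.coset_one_iff[OF bar_boundaries_1_normal[OF G]]) simp

lemma homology1_class_hom:
  assumes G: "group G"
  shows "homology1_class G \<in> hom G (homology1 G)"
proof (rule homI)
  interpret G: group G by fact
  let ?C = "bar_chains 1 G" and ?B = "bar_boundaries 1 G"
  interpret N: normal ?B ?C by (rule bar_boundaries_1_normal[OF G])
  show "homology1_class G g \<in> carrier (homology1 G)" if "g \<in> carrier G" for g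
    unfolding homology1_class_def using that by (intro N.coset_in_Mod) simp
  fix g h assume g: "g \<in> carrier G" and h: "h \<in> carrier G"
  have "frag_of [g \<otimes>\<^bsub>G\<^esub> h] - (frag_of [g] + frag_of [h]) = bar_boundary G (- frag_of [g, h])"
    by (simp add: bar_boundary_minus bar_boundary_of2)
  moreover have "- frag_of [g, h] \<in> chains 2 G"
    using g h by (intro bar_chains_minus) simp
  ultimately have "frag_of [g \<otimes>\<^bsub>G\<^esub> h] - (frag_of [g] + frag_of [h]) \<in> ?B"
    unfolding bar_boundaries_1 by blast
  then have "homology1_class G (g \<otimes>\<^bsub>G\<^esub> h) = ?B #>\<^bsub>?C\<^esub> (frag_of [g] + frag_of [h])"
    unfolding homology1_class_def using g h
    by (subst N.coset_eq_iff) (simp_all add: inv_bar_chains bar_chains_add algebra_simps)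
  then show "homology1_class G (g \<otimes>\<^bsub>G\<^esub> h) = homology1_class G g \<otimes>\<^bsub>homology1 G\<^esub> homology1_class G h"
    using N.mult_coset_Mod[of "frag_of [g]" "frag_of [h]"] g h by (simp add: homology1_class_def)
qed

definition null_homologous :: "'a monoid \<Rightarrow> 'a set" where
  "null_homologous G = {g \<in> carrier G. frag_of [g] \<in> bar_boundaries 1 G}"

lemma subgroup_null_homologous:
  assumes G: "group G"
  shows "subgroup (null_homologous G) G"
proof -
  interpret group_hom G "homology1 G" "homology1_class G"
    using comm_group_homology1[OF G] G homology1_class_hom[OF G]
    by (simp add: group_hom_def group_hom_axioms_def comm_group.axioms)
  have "null_homologous G = kernel G (homology1 G) (homology1_class G)"
    using homology1_class_one_iff[OF G] by (auto simp: null_homologous_def kernel_def)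
  then show ?thesis
    using subgroup_kernel by simp
qed

lemma commutator_null_homologous:
  assumes G: "group G" and x: "x \<in> carrier G" and y: "y \<in> carrier G"
  shows "commutator G x y \<in> null_homologous G"
proof -
  interpret A: comm_group "homology1 G" by (rule comm_group_homology1[OF G])
  interpret A': plain_group "homology1 G" by unfold_locales
  interpret G: plain_group G using G by (simp add: plain_group_def)
  note q = homology1_class_hom[OF G]
  have "homology1_class G (commutator G x y) = \<one>\<^bsub>homology1 G\<^esub>"
    using x y hom_in_carrier[OF q] hom_commutator[OF G A.is_group q x y]
    by (simp add: A'.commutator_one_iff A.m_comm)
  then show ?thesis
    using homology1_class_one_iff[OF G] x y by (simp add: null_homologous_def)
qed

lemma null_homologous_diff:
  assumes G: "group G" and g: "g \<in> null_homologous G" and h: "h \<in> carrier G"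
  shows "frag_of [g \<otimes>\<^bsub>G\<^esub> h] - frag_of [h] \<in> bar_boundaries 1 G"
proof -
  interpret A: comm_group "homology1 G" by (rule comm_group_homology1[OF G])
  interpret G: group G by fact
  note q = homology1_class_hom[OF G]
  have "g \<in> carrier G" "homology1_class G g = \<one>\<^bsub>homology1 G\<^esub>"
    using g homology1_class_one_iff[OF G] by (auto simp: null_homologous_def)
  then have "homology1_class G (g \<otimes>\<^bsub>G\<^esub> h) = homology1_class G h"
    using h hom_in_carrier[OF q h] by (simp add: hom_mult[OF q])
  then show ?thesis
    using homology1_class_eq_iff[OF G] \<open>g \<in> carrier G\<close> h by simp
qed

lemma chain1_homologous_single:
  assumes G: "group G" and c: "c \<in> chains 1 G"
  shows "\<exists>g \<in> carrier G. c - frag_of [g] \<in> bar_boundaries 1 G"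
proof -
  interpret G: group G by fact
  note B = additive_subgroup_boundaries[of 1 G]
  have prod: "frag_of [g] + frag_of [h] - frag_of [g \<otimes>\<^bsub>G\<^esub> h] \<in> bar_boundaries 1 G"
    if "g \<in> carrier G" "h \<in> carrier G" for g h
  proof -
    have "bar_boundary G (frag_of [g, h]) \<in> bar_boundaries 1 G"
      unfolding bar_boundaries_1 using that by (intro imageI) simp
    then show ?thesis
      by (simp add: bar_boundary_of2 algebra_simps)
  qed
  show ?thesis
    using c
  proof (induction rule: bar_chains_induct)
    case zero
    show ?case
      using additive_subgroup_minus[OF B prod[of "\<one>\<^bsub>G\<^esub>" "\<one>\<^bsub>G\<^esub>"]] by (intro bexI[of _ "\<one>\<^bsub>G\<^esub>"]) simp_all
  next
    case (of xs)
    then show ?case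
      using B by (auto simp: length_1_iff additive_subgroup_def intro!: bexI[of _ "hd xs"])
  next
    case (diff x y)
    then obtain g h where g: "g \<in> carrier G" "x - frag_of [g] \<in> bar_boundaries 1 G"
      and h: "h \<in> carrier G" "y - frag_of [h] \<in> bar_boundaries 1 G"
      by blast
    have "frag_of [g \<otimes>\<^bsub>G\<^esub> inv\<^bsub>G\<^esub> h] + frag_of [h] - frag_of [g] \<in> bar_boundaries 1 G"
      using prod[of "g \<otimes>\<^bsub>G\<^esub> inv\<^bsub>G\<^esub> h" h] g h by (simp add: G.m_assoc)
    then have "(x - frag_of [g]) - (y - frag_of [h]) - (frag_of [g \<otimes>\<^bsub>G\<^esub> inv\<^bsub>G\<^esub> h] + frag_of [h] - frag_of [g])
        \<in> bar_boundaries 1 G"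
      using B g(2) h(2) unfolding additive_subgroup_def by blast
    then show ?case
      using g h by (intro bexI[of _ "g \<otimes>\<^bsub>G\<^esub> inv\<^bsub>G\<^esub> h"]) (simp_all add: algebra_simps)
  qed
qed

lemma boundary_hom_trivial:
  assumes G: "group G" and A: "comm_group A" and d: "d \<in> hom G A"
    and g: "g \<in> carrier G" and b: "frag_of [g] \<in> bar_boundaries 1 G"
  shows "d g = \<one>\<^bsub>A\<^esub>"
  using hom_on_chains[OF G A d] b g unfolding bar_boundaries_1 by (metis imageE)

section \<open>The map from the Klein bottle group\<close>

text \<open>The cocycle vanishes on the cyclic subgroup generated by \<open>e\<close>; this makes \<open>\<eta>\<close> multiplicative.\<close>

lemma (in two_adic_like) half_wedge_pow: "half_wedge (e [^] (i :: int)) (e [^] (j :: int)) = \<one>\<^bsub>\<Lambda>\<^esub>"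
proof -
  have 1: "subgroup {a \<in> carrier G. half_wedge a b = \<one>\<^bsub>\<Lambda>\<^esub>} G" if "b \<in> carrier G" for b
    by (rule subgroupI) (use that in \<open>auto simp: half_wedge_mult_left half_wedge_inv_left intro!: exI[of _ \<one>]\<close>)
  have 2: "subgroup {b \<in> carrier G. half_wedge a b = \<one>\<^bsub>\<Lambda>\<^esub>} G" if "a \<in> carrier G" for a
    by (rule subgroupI) (use that in \<open>auto simp: half_wedge_mult_right half_wedge_inv_right intro!: exI[of _ \<one>]\<close>)
  have "half_wedge (e [^] i) e = \<one>\<^bsub>\<Lambda>\<^esub>"
    using subgroup_int_pow_closed[OF 1[OF e_closed], of e i] by (simp add: half_wedge_self)
  then show ?thesis
    using subgroup_int_pow_closed[OF 2, of "e [^] i" e j] by simp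
qed

context infinite_cyclic
begin

abbreviation "K \<equiv> Klein_bottle_group C t"

lemma K_twisted: "K = twisted_product integer_group (\<lambda>n. - n)"
  by (simp add: Klein_bottle_group_def twisted_product_def)

lemma negation_hom: "(\<lambda>n. - n) \<in> hom integer_group integer_group"
  by (auto simp: hom_def integer_group_def)

lemma group_K: "group K"
  unfolding K_twisted by (rule group_twisted[OF _ negation_hom]) simp_all

lemma carrier_K: "carrier K = UNIV \<times> carrier C"
  by (simp add: K_twisted integer_group_def)

lemma mult_K: "(m, c) \<otimes>\<^bsub>K\<^esub> (n, d) = (m + twist (\<lambda>n. - n) c n, c \<otimes> d)"
  unfolding K_twisted by (subst mult_twisted[OF _ negation_hom]) simp_all

lemma one_K: "\<one>\<^bsub>K\<^esub> = (0, \<one>)"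
  by (simp add: K_twisted one_twisted integer_group_def)

definition \<eta> where
  "\<eta> = (\<lambda>(n :: int, c). ((\<one>\<^bsub>Lambda2_Z2\<^esub>, Z2_one [^]\<^bsub>Z2\<^esub> n), c))"

lemma \<eta>_hom: "\<eta> \<in> hom K E"
proof (rule homI)
  show "\<eta> x \<in> carrier E" if "x \<in> carrier K" for x
    using that by (auto simp: \<eta>_def carrier_K carrier_E)
  fix x y assume x: "x \<in> carrier K" and y: "y \<in> carrier K"
  obtain m c n d where e: "x = (m, c)" "y = (n, d)" by (cases x, cases y)
  have tw: "act c (Z2_one [^]\<^bsub>Z2\<^esub> n) = Z2_one [^]\<^bsub>Z2\<^esub> (twist (\<lambda>n. - n) c n)"
    by (simp add: twist_def Z2.int_pow_neg)
  show "\<eta> (x \<otimes>\<^bsub>K\<^esub> y) = \<eta> x \<otimes>\<^bsub>E\<^esub> \<eta> y"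
    using x y by (simp add: e \<eta>_def mult_K mult_E carrier_K tw Z2.half_wedge_pow Z2.int_pow_mult)
qed

lemma el_L_null_homologous: "\<alpha> \<in> carrier Lambda2_Z2 \<Longrightarrow> el_L \<alpha> \<in> null_homologous E"
proof (induction rule: Z2.exterior_square_induct)
  case one
  then show ?case
    using subgroup.one_closed[OF subgroup_null_homologous[OF group_E]] by (simp add: el_L_one)
next
  case (wedge a b)
  then show ?case
    using commutator_null_homologous[OF group_E, of "el_Z a" "el_Z b"] by (simp add: commutator_el_Z)
next
  case (mult \<alpha> \<beta>)
  then show ?case
    by (simp add: el_L_mult subgroup.m_closed[OF subgroup_null_homologous[OF group_E]])
qed

text \<open>Commutators account for the exterior square and for \<open>2\<int>\<^sub>2\<close>; the last binary digit and the factor \<open>C\<close> come from the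
  Klein bottle group.\<close>

lemma E_mod_null_homologous:
  assumes "x \<in> carrier E"
  shows "\<exists>u \<in> null_homologous E. \<exists>k \<in> carrier K. x = u \<otimes>\<^bsub>E\<^esub> \<eta> k"
proof -
  obtain \<alpha> a c where x: "x = ((\<alpha>, a), c)" and cl: "\<alpha> \<in> carrier Lambda2_Z2" "a \<in> carrier Z2" "c \<in> carrier C"
    using assms by (auto simp: carrier_E)
  obtain i :: int where i: "Z2.digit a = Z2_one [^]\<^bsub>Z2\<^esub> i"
    using Z2.digit_cases[of a] int_pow_0[of Z2 Z2_one] Z2.int_pow_1[OF Z2.e_closed] by metis
  define b where "b = Z2.quot a \<otimes>\<^bsub>Z2\<^esub> Z2.quot a"
  have b: "b \<in> carrier Z2" and a: "a = b \<otimes>\<^bsub>Z2\<^esub> Z2_one [^]\<^bsub>Z2\<^esub> i"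
    using Z2.quot[OF cl(2)] by (simp_all add: b_def i[symmetric] Z2.m_comm)
  let ?h = "Z2.half_wedge b (Z2_one [^]\<^bsub>Z2\<^esub> i)"
  let ?\<beta> = "\<alpha> \<otimes>\<^bsub>Lambda2_Z2\<^esub> inv\<^bsub>Lambda2_Z2\<^esub> ?h"
  let ?u = "el_L ?\<beta> \<otimes>\<^bsub>E\<^esub> el_Z b"
  have "el_Z b \<in> null_homologous E"
    using commutator_null_homologous[OF group_E, of "el_Z (Z2.quot a)" el_T] cl by (simp add: commutator_el_Z_T b_def)
  then have "?u \<in> null_homologous E"
    using el_L_null_homologous[of ?\<beta>] cl b by (simp add: subgroup.m_closed[OF subgroup_null_homologous[OF group_E]])
  moreover have "x = ?u \<otimes>\<^bsub>E\<^esub> \<eta> (i, c)"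
    using cl b by (simp add: x \<eta>_def kernel_decomposition[symmetric] mult_E Z2.ext.m_assoc a[symmetric])
  ultimately show ?thesis
    using cl by (auto simp: carrier_K)
qed

lemma even_null_homologous:
  assumes n: "even n"
  shows "(n, \<one>) \<in> null_homologous K"
proof -
  interpret K: group K by (rule group_K)
  obtain m where m: "n = m + m"
    using n by (auto elim!: evenE)
  have "inv\<^bsub>K\<^esub> (m, \<one>) = (- m, \<one>)" "inv\<^bsub>K\<^esub> (0, t) = (0, inv t)"
    by (rule K.inv_equality; simp add: mult_K one_K carrier_K twist_def)+
  then have "commutator K (m, \<one>) (0, t) = (n, \<one>)"
    by (simp add: commutator_def mult_K m)
  then show ?thesis
    using commutator_null_homologous[OF group_K, of "(m, \<one>)" "(0, t)"] by (simp add: carrier_K)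
qed

text \<open>The projection of \<open>E\<close> to \<open>C\<close> and the last binary digit, as a homomorphism to \<open>\<int>/2\<close>, detect the
  first homology classes of the image of \<open>\<eta>\<close>.\<close>

lemma \<eta>_kernel_homology:
  assumes k: "k \<in> carrier K" and b: "\<eta> k \<in> null_homologous E"
  shows "k \<in> null_homologous K"
proof -
  obtain n c where e: "k = (n, c)" and c: "c \<in> carrier C"
    using k by (auto simp: carrier_K)
  have C: "comm_group C"
    by (rule group_comm_groupI) (rule commutative)
  have snd: "snd \<in> hom E C"
    by (auto simp: hom_def carrier_E mult_E)
  have "snd (\<eta> k) = \<one>"
    using b by (intro boundary_hom_trivial[OF group_E C snd]) (auto simp: null_homologous_def)
  then have c1: "c = \<one>"
    by (simp add: e \<eta>_def)
  have first: "(\<lambda>a. a 1) \<in> hom Z2 (integer_mod_group 2)"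
    by (rule homI) (auto simp: padic_mult padic_carrier dest: spec[of _ 1])
  then have in_mod: "a 1 \<in> carrier (integer_mod_group 2)" if "a \<in> carrier Z2" for a
    using that by (rule hom_in_carrier)
  have par: "(\<lambda>x. snd (fst x) 1) \<in> hom E (integer_mod_group 2)"
  proof (rule homI)
    fix x y assume x: "x \<in> carrier E" and y: "y \<in> carrier E"
    obtain \<alpha> a c \<beta> b d where e: "x = ((\<alpha>, a), c)" "y = ((\<beta>, b), d)"
      by (cases x, cases y, cases "fst x", cases "fst y") auto
    have b: "b \<in> carrier Z2" using y by (simp add: e carrier_E)
    have "(a 1 + act c b 1) mod 2 = (a 1 + b 1) mod 2"
    proof (cases "even (exponent c)")
      case False
      have "(a 1 + (- b 1) mod 2) mod 2 = (a 1 + b 1) mod 2" by presburger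
      then show ?thesis
        using False b by (simp add: twist_def padic_inv)
    qed (simp add: twist_def)
    then show "snd (fst (x \<otimes>\<^bsub>E\<^esub> y)) 1 = snd (fst x) 1 \<otimes>\<^bsub>integer_mod_group 2\<^esub> snd (fst y) 1"
      using x y by (simp add: e carrier_E mult_E padic_mult)
  qed (auto simp: carrier_E intro!: in_mod)
  interpret first: group_hom Z2 "integer_mod_group 2" "\<lambda>a. a 1"
    by (simp add: group_hom_def group_hom_axioms_def first Z2.is_group)
  have "snd (fst (\<eta> k)) 1 = \<one>\<^bsub>integer_mod_group 2\<^esub>"
    using b by (intro boundary_hom_trivial[OF group_E _ par, where g = "\<eta> k"]) (auto simp: null_homologous_def)
  then have "(Z2_one [^]\<^bsub>Z2\<^esub> n) 1 = 0"
    by (simp add: e \<eta>_def)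
  then have "(n * Z2_one 1) mod 2 = 0"
    using first.hom_int_pow[OF Z2.e_closed, of n] by (simp add: int_pow_integer_mod_group)
  then have "even n"
    by (simp add: Z2_one_def) presburger
  then show ?thesis
    using even_null_homologous by (simp add: e c1)
qed

theorem HZ_map_\<eta>: "HZ_map K E \<eta>"
proof (rule HZ_mapI[OF group_K group_E \<eta>_hom])
  fix x assume "x \<in> chains 1 E"
  then obtain g where g: "g \<in> carrier E" "x - frag_of [g] \<in> bar_boundaries 1 E"
    using chain1_homologous_single[OF group_E] by blast
  obtain u k where u: "u \<in> null_homologous E" and k: "k \<in> carrier K" and gk: "g = u \<otimes>\<^bsub>E\<^esub> \<eta> k"
    using E_mod_null_homologous[OF g(1)] by blast
  have "frag_of [g] - frag_of [\<eta> k] \<in> bar_boundaries 1 E"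
    unfolding gk by (rule null_homologous_diff[OF group_E u hom_in_carrier[OF \<eta>_hom k]])
  from additive_subgroup_add[OF additive_subgroup_boundaries g(2) this]
  have "x - bar_map \<eta> (frag_of [k]) \<in> bar_boundaries 1 E"
    by simp
  then obtain y where "y \<in> chains 2 E" "x - bar_map \<eta> (frag_of [k]) = bar_boundary E y"
    unfolding bar_boundaries_1 by blast
  then have "x = bar_map \<eta> (frag_of [k]) + bar_boundary E y"
    by (metis add.commute diff_add_cancel)
  then show "\<exists>x'\<in>chains 1 K. \<exists>y\<in>chains 2 E. x = bar_map \<eta> x' + bar_boundary E y"
    using k \<open>y \<in> _\<close> by (intro bexI[of _ "frag_of [k]"] bexI[of _ y]) simp_all
next
  fix x y assume x: "x \<in> chains 1 K" and y: "y \<in> chains 2 E"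
    and xy: "bar_map \<eta> x = bar_boundary E y"
  obtain k where k: "k \<in> carrier K" and xk: "x - frag_of [k] \<in> bar_boundaries 1 K"
    using chain1_homologous_single[OF group_K x] by blast
  then obtain y' where y': "y' \<in> chains 2 K" "x - frag_of [k] = bar_boundary K y'"
    unfolding bar_boundaries_1 by blast
  have "frag_of [\<eta> k] = bar_map \<eta> x - bar_map \<eta> (bar_boundary K y')"
    using y'(2)[symmetric] by (simp add: bar_map_diff)
  also have "\<dots> = bar_boundary E (y - bar_map \<eta> y')"
    using y' xy by (simp add: bar_map_boundary2[OF \<eta>_hom] bar_boundary_diff)
  finally have "frag_of [\<eta> k] \<in> bar_boundaries 1 E"
    unfolding bar_boundaries_1 using bar_chains_diff[OF y bar_map_chains[OF \<eta>_hom y'(1)]] by blast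
  then have "k \<in> null_homologous K"
    using hom_in_carrier[OF \<eta>_hom k] by (intro \<eta>_kernel_homology[OF k]) (simp add: null_homologous_def)
  then have "frag_of [k] \<in> bar_boundaries 1 K"
    by (simp add: null_homologous_def)
  from additive_subgroup_add[OF additive_subgroup_boundaries xk this] have "x \<in> bar_boundaries 1 K"
    by simp
  then show "\<exists>x'\<in>chains 2 K. x = bar_boundary K x'"
    unfolding bar_boundaries_1 by blast
next
  fix x assume "x \<in> chains 2 E" "bar_boundary E x = 0"
  then have "x \<in> bar_boundaries 2 E"
    using second_homology_E by (auto simp: bar_cycles_def)
  then obtain y where "y \<in> chains 3 E" "x = bar_boundary E y"
    unfolding bar_boundaries_2 by blast
  then show "\<exists>x'\<in>chains 2 K. \<exists>y\<in>chains 3 E.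
      bar_boundary K x' = 0 \<and> x = bar_map \<eta> x' + bar_boundary E y"
    by (intro bexI[of _ 0] bexI[of _ y]) simp_all
qed

end

section \<open>Locality of $N_w \rtimes C$\<close>

context infinite_cyclic
begin

text \<open>The tower \<open>\<int>/2\<^sup>n \<rtimes> C\<close>, with limit \<open>\<int>\<^sub>2 \<rtimes> C\<close>.\<close>

definition residue_level :: "nat \<Rightarrow> (int \<times> 'c) monoid" where
  "residue_level n = twisted_product (integer_mod_group (2 ^ n)) (\<lambda>k. (- k) mod 2 ^ n)"

lemma residue_carrier: "carrier (residue_level n) = {0..<2 ^ n} \<times> carrier C"
  by (simp add: residue_level_def carrier_integer_mod_group)

lemma negation_mod_hom:
  "(\<lambda>k. (- k) mod 2 ^ n) \<in> hom (integer_mod_group (2 ^ n)) (integer_mod_group (2 ^ n))"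
  by (rule homI) (auto simp: carrier_integer_mod_group mod_simps intro!: arg_cong[where f = "\<lambda>z. z mod 2 ^ n"])

lemma negation_mod_involution:
  "k \<in> carrier (integer_mod_group (2 ^ n)) \<Longrightarrow> (- ((- k) mod 2 ^ n)) mod 2 ^ n = (k :: int)"
  by (simp add: carrier_integer_mod_group mod_simps)

lemma group_residue_level: "group (residue_level n)"
  unfolding residue_level_def
  by (rule group_twisted[OF _ negation_mod_hom negation_mod_involution]) simp_all

lemma mult_residue:
  assumes "l \<in> {0..<2 ^ n}"
  shows "(k, c) \<otimes>\<^bsub>residue_level n\<^esub> (l, d) = ((k + (if even (exponent c) then l else - l)) mod 2 ^ n, c \<otimes> d)"
proof -
  have "(k, c) \<otimes>\<^bsub>residue_level n\<^esub> (l, d) = ((k + twist (\<lambda>k. (- k) mod 2 ^ n) c l) mod 2 ^ n, c \<otimes> d)"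
    unfolding residue_level_def using assms
    by (subst mult_twisted[OF _ negation_mod_hom negation_mod_involution]) (simp_all add: carrier_integer_mod_group)
  then show ?thesis
    by (simp add: twist_def mod_simps)
qed

lemma one_residue: "\<one>\<^bsub>residue_level n\<^esub> = (0, \<one>)"
  by (simp add: residue_level_def one_twisted)

definition reduce :: "nat \<Rightarrow> int \<times> 'c \<Rightarrow> int \<times> 'c" where
  "reduce n = (\<lambda>(k, c). (k mod 2 ^ n, c))"

lemma reduce_hom: "reduce n \<in> hom (residue_level (Suc n)) (residue_level n)"
proof (rule homI)
  show "reduce n x \<in> carrier (residue_level n)" if "x \<in> carrier (residue_level (Suc n))" for x
    using that by (auto simp: reduce_def residue_carrier)
  fix x y assume "x \<in> carrier (residue_level (Suc n))" and y: "y \<in> carrier (residue_level (Suc n))"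
  obtain k c l d where e: "x = (k, c)" "y = (l, d)" by (cases x, cases y)
  have "l \<in> {0..<2 ^ Suc n}" using y by (simp add: e residue_carrier)
  then have "x \<otimes>\<^bsub>residue_level (Suc n)\<^esub> y = ((k + (if even (exponent c) then l else - l)) mod 2 ^ Suc n, c \<otimes> d)"
    by (simp add: e mult_residue)
  then have "reduce n (x \<otimes>\<^bsub>residue_level (Suc n)\<^esub> y) = ((k + (if even (exponent c) then l else - l)) mod 2 ^ n, c \<otimes> d)"
    by (simp add: reduce_def mod_mod_cancel)
  also have "\<dots> = reduce n x \<otimes>\<^bsub>residue_level n\<^esub> reduce n y"
    by (simp add: e reduce_def mult_residue mod_simps)
  finally show "reduce n (x \<otimes>\<^bsub>residue_level (Suc n)\<^esub> y) = reduce n x \<otimes>\<^bsub>residue_level n\<^esub> reduce n y" .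
qed

text \<open>For \<open>n = 0\<close> the group is a copy of \<open>C\<close>. In the step, the kernel has exponent 2, so inversion fixes it and it is central.\<close>

lemma HZ_local_residue_level: "HZ_local TYPE('g) TYPE('h) (residue_level n)"
proof (induction n)
  case 0
  have "comm_group (residue_level 0)"
  proof (rule group.group_comm_groupI[OF group_residue_level])
    fix x y assume "x \<in> carrier (residue_level 0)" "y \<in> carrier (residue_level 0)"
    then show "x \<otimes>\<^bsub>residue_level 0\<^esub> y = y \<otimes>\<^bsub>residue_level 0\<^esub> x"
      by (cases x, cases y) (simp add: residue_carrier mult_residue commutative)
  qed
  then show ?case by (rule HZ_local_comm_group)
next
  case (Suc n)
  show ?case
  proof (rule HZ_local_central_extension[OF group_residue_level reduce_hom _ _ Suc.IH])
    show "reduce n ` carrier (residue_level (Suc n)) = carrier (residue_level n)"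
    proof (intro equalityI subsetI)
      fix x assume "x \<in> carrier (residue_level n)"
      then have "x \<in> carrier (residue_level (Suc n))" "reduce n x = x"
        by (auto simp: residue_carrier reduce_def)
      then show "x \<in> reduce n ` carrier (residue_level (Suc n))" by (metis imageI)
    qed (use hom_in_carrier[OF reduce_hom] in auto)
  next
    fix z x assume z: "z \<in> carrier (residue_level (Suc n))" "reduce n z = \<one>\<^bsub>residue_level n\<^esub>"
      and x: "x \<in> carrier (residue_level (Suc n))"
    obtain k c l d where e: "z = (k, c)" "x = (l, d)" by (cases z, cases x)
    have c: "c = \<one>" and k: "k mod 2 ^ n = 0" "0 \<le> k" "k < 2 ^ Suc n" and l: "0 \<le> l" "l < 2 ^ Suc n" and d: "d \<in> carrier C"
      using z x by (auto simp: e reduce_def one_residue residue_carrier)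
    \<comment> \<open>\<open>k\<close> is 0 or \<open>2\<^sup>n\<close>, hence its own negative modulo \<open>2\<^sup>n\<^sup>+\<^sup>1\<close>\<close>
    have "2 ^ Suc n dvd 2 * k"
      using k(1) by (simp add: mod_eq_0_iff_dvd)
    then have "2 ^ Suc n dvd (l + k) - (l - k)" by simp
    then have "(l + k) mod 2 ^ Suc n = (l - k) mod 2 ^ Suc n"
      by (simp only: mod_eq_dvd_iff)
    then show "z \<otimes>\<^bsub>residue_level (Suc n)\<^esub> x = x \<otimes>\<^bsub>residue_level (Suc n)\<^esub> z"
      using k l d by (simp add: e c mult_residue add.commute)
  qed
qed

abbreviation "Z2_semidirect \<equiv> twisted_product Z2 (\<lambda>a. inv\<^bsub>Z2\<^esub> a)"

lemma inversion_hom: "(\<lambda>a. inv\<^bsub>Z2\<^esub> a) \<in> hom Z2 Z2"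
  by (rule homI) (simp_all add: Z2.inv_mult)

lemma group_Z2_semidirect: "group Z2_semidirect"
  by (rule group_twisted[OF Z2.is_group inversion_hom]) simp

lemma mult_Z2_semidirect:
  "b \<in> carrier Z2 \<Longrightarrow> (a, c) \<otimes>\<^bsub>Z2_semidirect\<^esub> (b, d) = (a \<otimes>\<^bsub>Z2\<^esub> act c b, c \<otimes> d)"
  by (rule mult_twisted[OF Z2.is_group inversion_hom]) simp_all

lemma HZ_local_Z2_semidirect: "HZ_local TYPE('g) TYPE('h) Z2_semidirect"
proof (rule HZ_local_inverse_limit[OF group_Z2_semidirect HZ_local_residue_level])
  show "(\<lambda>(x, c). (x n, c)) \<in> hom Z2_semidirect (residue_level n)" for n
  proof (rule homI)
    show "(\<lambda>(x, c). (x n, c)) x \<in> carrier (residue_level n)" if "x \<in> carrier Z2_semidirect" for x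
      using that by (auto simp: residue_carrier Z2_carrier)
    fix x y assume x: "x \<in> carrier Z2_semidirect" and y: "y \<in> carrier Z2_semidirect"
    obtain a c b d where e: "x = (a, c)" "y = (b, d)" by (cases x, cases y)
    have b: "b \<in> carrier Z2" using y by (simp add: e)
    then have "b n \<in> {0..<2 ^ n}" by (simp add: Z2_carrier)
    then show "(\<lambda>(x, c). (x n, c)) (x \<otimes>\<^bsub>Z2_semidirect\<^esub> y) =
        (\<lambda>(x, c). (x n, c)) x \<otimes>\<^bsub>residue_level n\<^esub> (\<lambda>(x, c). (x n, c)) y"
      using b by (simp add: e mult_Z2_semidirect mult_residue padic_mult twist_def padic_inv mod_simps)
  qed
  show "reduce n \<in> hom (residue_level (Suc n)) (residue_level n)" for n
    by (rule reduce_hom)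
  show "reduce n ((\<lambda>(x, c). (x (Suc n), c)) x) = (\<lambda>(x, c). (x n, c)) x" if "x \<in> carrier Z2_semidirect" for n x
    using that by (auto simp: reduce_def Z2_carrier)
next
  fix y :: "nat \<Rightarrow> int \<times> 'c"
  assume y: "\<And>n. y n \<in> carrier (residue_level n)" and red: "\<And>n. reduce n (y (Suc n)) = y n"
  have fst: "fst (y (Suc n)) mod 2 ^ n = fst (y n)" and snd: "snd (y (Suc n)) = snd (y n)" for n
    using red[of n] by (auto simp: reduce_def split_beta prod_eq_iff)
  have snd0: "snd (y n) = snd (y 0)" for n
    by (induction n) (simp_all add: snd)
  have "fst (y n) \<in> {0..<2 ^ n}" "snd (y n) \<in> carrier C" for n
    using y[of n] by (auto simp: residue_carrier mem_Times_iff)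
  then have "((\<lambda>n. fst (y n)), snd (y 0)) \<in> carrier Z2_semidirect"
    using fst by (simp add: Z2_carrier)
  moreover have "(\<lambda>(x, c). (x n, c)) ((\<lambda>n. fst (y n)), snd (y 0)) = y n" for n
    using snd0[of n] by (simp add: prod_eq_iff)
  ultimately show "\<exists>x \<in> carrier Z2_semidirect. \<forall>n. (\<lambda>(x, c). (x n, c)) x = y n"
    by blast
next
  fix x y :: "(nat \<Rightarrow> int) \<times> 'c"
  assume "\<And>n. (\<lambda>(x, c). (x n, c)) x = (\<lambda>(x, c). (x n, c)) y"
  then show "x = y"
    by (cases x, cases y) auto
qed

text \<open>The projection to \<open>\<int>\<^sub>2 \<rtimes> C\<close> has kernel the exterior square, which \<open>t\<close> fixes and which is central in \<open>N\<^sub>w\<close>.\<close>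

lemma HZ_local_E: "HZ_local TYPE('g) TYPE('h) E"
proof (rule HZ_local_central_extension[OF group_E _ _ _ HZ_local_Z2_semidirect])
  show "(\<lambda>((\<alpha>, a), c). (a, c)) \<in> hom E Z2_semidirect"
    by (rule homI) (auto simp: carrier_E mult_E mult_Z2_semidirect)
  show "(\<lambda>((\<alpha>, a), c). (a, c)) ` carrier E = carrier Z2_semidirect"
  proof (intro equalityI subsetI)
    fix x assume "x \<in> carrier Z2_semidirect"
    then have "((\<one>\<^bsub>Lambda2_Z2\<^esub>, fst x), snd x) \<in> carrier E"
      by (auto simp: carrier_E)
    then show "x \<in> (\<lambda>((\<alpha>, a), c). (a, c)) ` carrier E"
      by (rule rev_image_eqI) simp
  qed (auto simp: carrier_E)
next
  fix k x assume k: "k \<in> carrier E" "(\<lambda>((\<alpha>, a), c). (a, c)) k = \<one>\<^bsub>Z2_semidirect\<^esub>" and x: "x \<in> carrier E"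
  then obtain \<alpha> where "\<alpha> \<in> carrier Lambda2_Z2" "k = el_L \<alpha>"
    by (auto simp: carrier_E one_twisted el_L_def)
  then show "k \<otimes>\<^bsub>E\<^esub> x = x \<otimes>\<^bsub>E\<^esub> k"
    using el_L_central x by simp
qed

section \<open>The localization of the Klein bottle group\<close>

theorem HZ_localization_E: "HZ_localization TYPE('g) TYPE('h) K \<eta> E"
  by (simp add: HZ_localization_def HZ_map_\<eta> HZ_local_E)

definition triples :: "(((nat \<Rightarrow> int) \<times> (nat \<Rightarrow> int) \<Rightarrow>\<^sub>0 int) set \<times> (nat \<Rightarrow> int) \<times> 'c) monoid" where
  "triples = \<lparr>carrier = carrier Lambda2_Z2 \<times> carrier Z2 \<times> carrier C,
     monoid.mult = (\<lambda>(\<alpha>, a, c) (\<beta>, b, d). case ((\<alpha>, a), c) \<otimes>\<^bsub>E\<^esub> ((\<beta>, b), d) of ((\<gamma>, x), e) \<Rightarrow> (\<gamma>, x, e)),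
     one = (\<one>\<^bsub>Lambda2_Z2\<^esub>, \<one>\<^bsub>Z2\<^esub>, \<one>)\<rparr>"

lemma reassociate_iso: "(\<lambda>((\<alpha>, a), c). (\<alpha>, a, c)) \<in> iso E triples"
proof (rule isoI)
  show "(\<lambda>((\<alpha>, a), c). (\<alpha>, a, c)) \<in> hom E triples"
    by (rule homI) (auto simp: carrier_E triples_def mult_E)
  show "bij_betw (\<lambda>((\<alpha>, a), c). (\<alpha>, a, c)) (carrier E) (carrier triples)"
    by (rule bij_betwI[where g = "\<lambda>(\<alpha>, a, c). ((\<alpha>, a), c)"]) (auto simp: carrier_E triples_def)
qed

lemma group_triples: "group triples"
proof -
  have "group (triples\<lparr>one := (\<lambda>((\<alpha>, a), c). (\<alpha>, a, c)) \<one>\<^bsub>E\<^esub>\<rparr>)"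
    by (rule E.iso_imp_img_group[OF reassociate_iso])
  then show ?thesis
    by (simp add: one_E triples_def)
qed

lemma mult_triples:
  assumes "\<alpha> \<in> carrier Lambda2_Z2" "\<beta> \<in> carrier Lambda2_Z2" "a \<in> carrier Z2" "b \<in> carrier Z2"
  shows "(\<alpha>, a, t [^] i) \<otimes>\<^bsub>triples\<^esub> (\<beta>, b, t [^] j) =
    (\<alpha> \<otimes>\<^bsub>Lambda2_Z2\<^esub> \<beta> \<otimes>\<^bsub>Lambda2_Z2\<^esub>
       (half Lambda2_Z2 (wedge Z2 a b) [^]\<^bsub>Lambda2_Z2\<^esub> ((-1 :: int) ^ nat \<bar>i\<bar>)),
     a \<otimes>\<^bsub>Z2\<^esub> (b [^]\<^bsub>Z2\<^esub> ((-1 :: int) ^ nat \<bar>i\<bar>)),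
     t [^] (i + j))"
proof -
  have "(\<alpha>, a, t [^] i) \<otimes>\<^bsub>triples\<^esub> (\<beta>, b, t [^] j) =
    (\<alpha> \<otimes>\<^bsub>Lambda2_Z2\<^esub> \<beta> \<otimes>\<^bsub>Lambda2_Z2\<^esub> Z2.half_wedge a (act (t [^] i) b), a \<otimes>\<^bsub>Z2\<^esub> act (t [^] i) b, t [^] (i + j))"
    using assms by (simp add: triples_def mult_E int_pow_mult)
  moreover have "(-1 :: int) ^ nat \<bar>i\<bar> = (if even i then 1 else -1)"
    by (simp add: even_nat_iff)
  ultimately show ?thesis
    using assms by (simp add: twist_def Z2.half_wedge_eq Z2.half_wedge_inv_right Z2.int_pow_neg Z2.ext.int_pow_neg)
qed

end

theorem proposition9p2:
  fixes C :: "'c monoid" and t :: 'c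
  assumes "group C" and "t \<in> carrier C" and "carrier C = generate C {t}" and "infinite (carrier C)"
  shows "(\<exists>\<eta>. HZ_localization TYPE('g) TYPE('h) (Klein_bottle_group C t) \<eta> (N_w_semidirect C t)) \<and>
    (\<exists>M :: (((nat \<Rightarrow> int) \<times> (nat \<Rightarrow> int) \<Rightarrow>\<^sub>0 int) set \<times> (nat \<Rightarrow> int) \<times> 'c) monoid.
       carrier M = carrier Lambda2_Z2 \<times> carrier Z2 \<times> carrier C \<and>
       (\<forall>\<alpha> \<in> carrier Lambda2_Z2. \<forall>\<beta> \<in> carrier Lambda2_Z2. \<forall>a \<in> carrier Z2. \<forall>b \<in> carrier Z2.
          \<forall>(i :: int) (j :: int).
            (\<alpha>, a, t [^]\<^bsub>C\<^esub> i) \<otimes>\<^bsub>M\<^esub> (\<beta>, b, t [^]\<^bsub>C\<^esub> j) =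
              (\<alpha> \<otimes>\<^bsub>Lambda2_Z2\<^esub> \<beta> \<otimes>\<^bsub>Lambda2_Z2\<^esub>
                 (half Lambda2_Z2 (wedge Z2 a b) [^]\<^bsub>Lambda2_Z2\<^esub> ((-1 :: int) ^ nat \<bar>i\<bar>)),
               a \<otimes>\<^bsub>Z2\<^esub> (b [^]\<^bsub>Z2\<^esub> ((-1 :: int) ^ nat \<bar>i\<bar>)),
               t [^]\<^bsub>C\<^esub> (i + j))) \<and>
       (\<lambda>((\<alpha>, a), c). (\<alpha>, a, c)) \<in> iso (N_w_semidirect C t) M \<and>
       (\<exists>\<eta>. HZ_localization TYPE('g) TYPE('h) (Klein_bottle_group C t) \<eta> M))"
proof -
  interpret infinite_cyclic C t
    using assms by (simp add: infinite_cyclic_def infinite_cyclic_axioms_def)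
  note loc = HZ_localization_E[where ?'g = 'g and ?'h = 'h]
  show ?thesis
  proof (intro conjI exI[of _ \<eta>] exI[of _ triples] exI[of _ "(\<lambda>((\<alpha>, a), c). (\<alpha>, a, c)) \<circ> \<eta>"])
    show "carrier triples = carrier Lambda2_Z2 \<times> carrier Z2 \<times> carrier C"
      by (simp add: triples_def)
    show "HZ_localization TYPE('g) TYPE('h) K ((\<lambda>((\<alpha>, a), c). (\<alpha>, a, c)) \<circ> \<eta>) triples"
      by (rule HZ_localization_iso[OF loc group_triples reassociate_iso])
  qed (use loc mult_triples reassociate_iso in auto)
qed

end
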